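(* Let $m\ge2$ be an integer and suppose that $(S_n)$ satisfies the growth condition of order $m$ (defined in the context). Then for every real $p$ with $1\le p<m-1$ there exists a constant $C>0$ such that for all $n$ $$W_p(dF_n,d\Phi)\le CB_n^{-1}.$$
   Context: $(S_n)_{n\ge1}$ is a sequence of centered real random variables with $\sigma_n=\|S_n\|_{L^2}>0$ and $\sigma_n\to\infty$. $(A_n)$ is a bounded real sequence and $(B_n)$ is a positive sequence with $B_n=\sigma_n+O(1)$. Put $W_n=(S_n-A_n)/B_n$ and $F_n(x)=\mathbb P(W_n\le x)$; $\Phi$ is the standard normal distribution function. Put $\Lambda_n(t)=\ln\mathbb E[e^{itS_n/\sigma_n}]+t^2/2$. Growth condition of order $m$: for all $3\le j\le m+1$ there exist constants $C_j,\varepsilon_j>0$ such that for all $n$, $\sup_{t\in[-\varepsilon_j\sigma_n,\varepsilon_j\sigma_n]}|\Lambda_n^{(j)}(t)|\le C_j\sigma_n^{-(j-2)}$ (implicitly, $\Lambda_n$ is well defined and has these derivatives there). For $p\ge1$ and Borel probability measures $\mu,\nu$ on $\mathbb R$ with finite absolute moments of order $p$, $W_p(\mu,\nu)=\inf\|X-Y\|_{L^p}$, where the infimum is over all couplings $(X,Y)$ of $\mu$ and $\nu$ (random pairs with $X\sim\mu$, $Y\sim\nu$). $dF_n$ and $d\Phi$ denote the probability measures with distribution functions $F_n$ and $\Phi$. *)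

theory Defs
  imports "HOL-Probability.Probability" "HOL-Library.Landau_Symbols"
begin

definition L2_norm :: "'a measure \<Rightarrow> ('a \<Rightarrow> real) \<Rightarrow> real" where
  "L2_norm M X = sqrt (LINT w|M. (X w)\<^sup>2)"

definition centered_L2 :: "'a measure \<Rightarrow> ('a \<Rightarrow> real) \<Rightarrow> bool" where
  "centered_L2 M X \<longleftrightarrow>
     X \<in> borel_measurable M \<and> integrable M (\<lambda>w. (X w)\<^sup>2) \<and>
     integrable M X \<and> (LINT w|M. X w) = 0"

text \<open>
  The logarithm of a nonvanishing continuous function \<open>f\<close> with \<open>f 0 = 1\<close> is its continuous
  branch that vanishes at 0. It is unique, see \<open>cont_log_eqI\<close> below; the principal branch \<open>Ln\<close>
  would introduce jumps where \<open>f\<close> crosses the negative real axis. The value at \<open>t\<close> is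
  meaningful only if \<open>f\<close> has no zero between 0 and \<open>t\<close>.
\<close>

definition cont_log :: "(real \<Rightarrow> complex) \<Rightarrow> real \<Rightarrow> complex" where
  "cont_log f t =
     (THE z. \<exists>g. continuous_on (closed_segment 0 t) g \<and> g 0 = 0 \<and>
               (\<forall>s\<in>closed_segment 0 t. exp (g s) = f s) \<and> g t = z)"

lemma cont_log_unique:
  fixes g h :: "real \<Rightarrow> complex"
  assumes g: "continuous_on (closed_segment 0 t) g" "g 0 = 0"
    and h: "continuous_on (closed_segment 0 t) h" "h 0 = 0"
    and eq: "\<And>s. s \<in> closed_segment 0 t \<Longrightarrow> exp (g s) = exp (h s)"
  shows "g t = h t"
proof -
  let ?d = "\<lambda>s. g s - h s"
  have val: "\<exists>k::int. ?d s = of_int (2 * k) * pi * \<i>" if "s \<in> closed_segment 0 t" for s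
    using eq[OF that] by (auto simp: exp_eq algebra_simps)
  have "?d constant_on closed_segment 0 t"
  proof (rule continuous_discrete_range_constant)
    show "connected (closed_segment 0 t)" by simp
    show "continuous_on (closed_segment 0 t) ?d"
      using g(1) h(1) by (intro continuous_intros)
    fix x assume x: "x \<in> closed_segment 0 t"
    have "1 \<le> norm (?d y - ?d x)" if y: "y \<in> closed_segment 0 t" and ne: "?d y \<noteq> ?d x" for y
    proof -
      obtain k l :: int where k: "?d y = of_int (2 * k) * pi * \<i>"
        and l: "?d x = of_int (2 * l) * pi * \<i>"
        using val x y by blast
      have "k \<noteq> l" using ne k l by auto
      then have "1 \<le> \<bar>real_of_int (k - l)\<bar>" by linarith
      moreover have "?d y - ?d x = of_real (2 * pi * real_of_int (k - l)) * \<i>"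
        unfolding k l by (simp add: algebra_simps)
      then have "norm (?d y - ?d x) = 2 * pi * \<bar>real_of_int (k - l)\<bar>"
        by (simp only: norm_mult norm_of_real norm_ii) (simp add: abs_mult)
      moreover have "1 \<le> 2 * pi" using pi_gt3 by linarith
      ultimately show ?thesis using mult_mono[of 1 "2 * pi" 1] by fastforce
    qed
    then show "\<exists>e>0. \<forall>y. y \<in> closed_segment 0 t \<and> ?d y \<noteq> ?d x \<longrightarrow> e \<le> norm (?d y - ?d x)"
      by (intro exI[of _ 1]) auto
  qed
  then have "?d t = ?d 0" by (auto simp: constant_on_def)
  then show ?thesis using g(2) h(2) by simp
qed

lemma cont_log_eqI:
  assumes "continuous_on (closed_segment 0 t) g" "g 0 = 0"
    and "\<And>s. s \<in> closed_segment 0 t \<Longrightarrow> exp (g s) = f s"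
  shows "cont_log f t = g t"
  unfolding cont_log_def
proof (rule the_equality)
  show "\<exists>h. continuous_on (closed_segment 0 t) h \<and> h 0 = 0 \<and>
      (\<forall>s\<in>closed_segment 0 t. exp (h s) = f s) \<and> h t = g t"
    using assms by blast
next
  fix z
  assume "\<exists>h. continuous_on (closed_segment 0 t) h \<and> h 0 = 0 \<and>
      (\<forall>s\<in>closed_segment 0 t. exp (h s) = f s) \<and> h t = z"
  then show "z = g t"
    using assms cont_log_unique[of t _ g] by metis
qed

text \<open>Iterated derivative of a function of a real variable; one-sided at end points of \<open>I\<close>.\<close>

definition nth_vderiv :: "real set \<Rightarrow> nat \<Rightarrow> (real \<Rightarrow> 'b::real_normed_vector) \<Rightarrow> real \<Rightarrow> 'b" where
  "nth_vderiv I k f = ((\<lambda>g t. vector_derivative g (at t within I)) ^^ k) f"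

definition times_differentiable_on ::
    "nat \<Rightarrow> (real \<Rightarrow> 'b::real_normed_vector) \<Rightarrow> real set \<Rightarrow> bool" where
  "times_differentiable_on k f I \<longleftrightarrow> (\<forall>i<k. nth_vderiv I i f differentiable_on I)"

definition normalized_char :: "'a measure \<Rightarrow> ('a \<Rightarrow> real) \<Rightarrow> real \<Rightarrow> complex" where
  "normalized_char M X = char (distr M borel (\<lambda>w. X w / L2_norm M X))"

definition Lambda :: "'a measure \<Rightarrow> ('a \<Rightarrow> real) \<Rightarrow> real \<Rightarrow> complex" where
  "Lambda M X t = cont_log (normalized_char M X) t + of_real (t\<^sup>2 / 2)"

text \<open>The nonvanishing clause says that the logarithm is well defined on the interval.\<close>

definition growth_condition :: "'a measure \<Rightarrow> (nat \<Rightarrow> 'a \<Rightarrow> real) \<Rightarrow> nat \<Rightarrow> bool" where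
  "growth_condition M S m \<longleftrightarrow>
     (\<forall>j\<in>{3..m + 1}. \<exists>C>0. \<exists>\<epsilon>>0. \<forall>n\<ge>1.
        let \<sigma> = L2_norm M (S n); I = {- \<epsilon> * \<sigma>..\<epsilon> * \<sigma>} in
          (\<forall>t\<in>I. normalized_char M (S n) t \<noteq> 0) \<and>
          times_differentiable_on j (Lambda M (S n)) I \<and>
          (\<forall>t\<in>I. norm (nth_vderiv I j (Lambda M (S n)) t) \<le> C / \<sigma> ^ (j - 2)))"

definition Lp_norm :: "real \<Rightarrow> 'a measure \<Rightarrow> ('a \<Rightarrow> real) \<Rightarrow> ennreal" where
  "Lp_norm p M f =
     (let s = \<integral>\<^sup>+x. ennreal (\<bar>f x\<bar> powr p) \<partial>M
      in if s = \<infinity> then \<infinity> else ennreal (enn2real s powr (1 / p)))"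

definition couplings :: "real measure \<Rightarrow> real measure \<Rightarrow> (real \<times> real) measure set" where
  "couplings \<mu> \<nu> =
     {\<gamma>. prob_space \<gamma> \<and> sets \<gamma> = sets (borel \<Otimes>\<^sub>M borel) \<and>
         distr \<gamma> borel fst = \<mu> \<and> distr \<gamma> borel snd = \<nu>}"

text \<open>
  A coupling is represented by its joint law. The value is \<open>\<infinity>\<close> if the distance is not finite,
  so an upper bound by a real number also asserts that the distance is finite.
\<close>

definition wasserstein :: "real \<Rightarrow> real measure \<Rightarrow> real measure \<Rightarrow> ennreal" where
  "wasserstein p \<mu> \<nu> = (INF \<gamma>\<in>couplings \<mu> \<nu>. Lp_norm p \<gamma> (\<lambda>z. fst z - snd z))"

text \<open>
  The probability measure with distribution function \<open>x \<mapsto> P (X \<le> x)\<close> is the law \<open>distr M borel X\<close>.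
\<close>

lemma cdf_distr_eq:
  assumes "X \<in> borel_measurable M"
  shows "cdf (distr M borel X) x = measure M {w \<in> space M. X w \<le> x}"
  unfolding cdf_def using assms
  by (subst measure_distr) (auto intro!: arg_cong[where f = "measure M"])

end

theory Submission
  imports Defs "HOL-Real_Asymp.Real_Asymp"
begin

text \<open>
  Write \<open>s = 1/\<sigma>\<^sub>n\<close> and \<open>X = S\<^sub>n/\<sigma>\<^sub>n\<close>. Let \<open>Z\<close> be independent of \<open>X\<close>, with many moments and a
  characteristic function supported in a small interval, and put \<open>Y = X + s Z\<close>. Then
  \<open>\<parallel>X - Y\<parallel>\<^sub>p = O(s)\<close>, and the characteristic function of \<open>Y\<close> lives where the growth condition controls
  \<open>\<Lambda>\<^sub>n\<close>. Expanding \<open>exp \<Lambda>\<^sub>n\<close> and the factor coming from \<open>Z\<close> up to order \<open>s\<^sup>m\<^sup>-\<^sup>1\<close> and inverting the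
  Fourier transform, the density of \<open>Y\<close> differs from the normal density \<open>g\<close> by
  \<open>O(s (1 + |y|)\<^sup>K g(y) + s\<^sup>m\<^sup>-\<^sup>1 (1 + |y|)\<^sup>-\<^sup>m)\<close>. The monotone map \<open>T = \<Phi>\<^sup>-\<^sup>1 \<circ> F\<^sub>Y\<close> sends \<open>Y\<close> to a
  standard normal variable and moves a typical \<open>y\<close> by at most a multiple of
  \<open>s (1 + |y|)\<^sup>K + s\<^sup>m\<^sup>-\<^sup>1 / g(y)\<close>; since \<open>p < m - 1\<close>, this gives \<open>\<parallel>T(Y) - Y\<parallel>\<^sub>p = O(s)\<close>. As \<open>T(Y)\<close> is a
  function of \<open>Y\<close>, all variables live on one probability space and no couplings have to be glued.
\<close>

text \<open>The growth condition says nothing about the characteristic function of \<open>X\<close>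
  beyond \<open>|t| \<le> \<epsilon> \<sigma>\<^sub>n\<close>, and \<open>X\<close> may be lattice,
  so there need be no density to expand. The noise \<open>s Z\<close> is affordable because it has
  the size of the bound to be shown, and its characteristic function vanishes where no information
  is available. The two error terms differ in kind. Polynomials in \<open>t\<close> times
  \<open>exp (- t\<^sup>2 / 2)\<close> transform to polynomials times \<open>g\<close>, hence stay
  small relative to \<open>g\<close> in the tails. The remainder is only known to have
  \<open>m\<close> derivatives, which gives the decay \<open>(1 + |y|)^(-m)\<close> and no
  comparison with \<open>g\<close>: near \<open>y\<^sup>2 = 2 (m - 1) ln (1/s)\<close> the
  displacement bound becomes void. Beyond that point both laws have mass about
  \<open>s^(m-1)\<close> up to logarithms, which is negligible against \<open>s^p\<close> as
  \<open>p < m - 1\<close>; the same inequality makes \<open>(1 + |y|)^(p-m)\<close> integrable.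
  Centering and normalization make \<open>\<Lambda>\<^sub>n\<close> vanish to third order at 0, so
  for small \<open>\<epsilon>\<close> the bound on the third derivative alone gives
  \<open>|\<Lambda>\<^sub>n| \<le> t\<^sup>2 / 4\<close>, and half of the Gaussian decay survives in
  \<open>exp (\<Lambda>\<^sub>n - t\<^sup>2 / 2)\<close>.\<close>

abbreviation (input) gauss :: "real \<Rightarrow> real" where "gauss \<equiv> std_normal_density"

abbreviation (input) std_normal_law ("\<N>") where "\<N> \<equiv> std_normal_distribution"

abbreviation (input) std_normal_cdf ("\<Phi>") where "\<Phi> \<equiv> cdf std_normal_distribution"

abbreviation (input) wt :: "real \<Rightarrow> real" where "wt y \<equiv> 1 + \<bar>y\<bar>"

abbreviation (input) gexp :: "real \<Rightarrow> real" where "gexp y \<equiv> exp (- y\<^sup>2 / 2)"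

abbreviation (input) dens :: "(real \<Rightarrow> real) \<Rightarrow> real measure" where
  "dens f \<equiv> density lborel (\<lambda>y. ennreal (f y))"

abbreviation (input) near_normal :: "real \<Rightarrow> nat \<Rightarrow> nat \<Rightarrow> real \<Rightarrow> (real \<Rightarrow> real) \<Rightarrow> bool" where
  "near_normal C0 K m s f \<equiv>
     \<forall>y. \<bar>f y - gauss y\<bar> \<le> C0 * (s * wt y ^ K * gauss y + s ^ (m - 1) * wt y powr (- real m))"

section \<open>Symbol classes\<close>

text \<open>
  \<open>symbol \<sigma> I k a c u\<close>: the derivatives of \<open>u n\<close> up to order \<open>k\<close> are
  \<open>O(\<sigma>\<^sub>n\<^sup>-\<^sup>a (1 + |t|)\<^sup>K exp (c t\<^sup>2))\<close> on \<open>I n\<close>, uniformly in \<open>n\<close>.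
  The class is closed under sums, products, integration from 0 and composition with \<open>exp\<close>, so
  no Leibniz or Faa di Bruno formula is needed.
\<close>

definition wbounded :: "(nat \<Rightarrow> real) \<Rightarrow> (nat \<Rightarrow> real set) \<Rightarrow> nat \<Rightarrow> real \<Rightarrow> (nat \<Rightarrow> real \<Rightarrow> complex) \<Rightarrow> bool" where
  "wbounded \<sigma> I a c u \<longleftrightarrow> (\<forall>n. continuous_on (I n) (u n)) \<and>
     (\<exists>C\<ge>0. \<exists>K. \<forall>n. \<forall>t\<in>I n. norm (u n t) \<le> C * (1 / \<sigma> n) ^ a * wt t ^ K * exp (c * t\<^sup>2))"

primrec symbol :: "(nat \<Rightarrow> real) \<Rightarrow> (nat \<Rightarrow> real set) \<Rightarrow> nat \<Rightarrow> nat \<Rightarrow> real \<Rightarrow> (nat \<Rightarrow> real \<Rightarrow> complex) \<Rightarrow> bool" where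
  "symbol \<sigma> I 0 a c u \<longleftrightarrow> wbounded \<sigma> I a c u"
| "symbol \<sigma> I (Suc k) a c u \<longleftrightarrow> wbounded \<sigma> I a c u \<and>
     (\<exists>u'. (\<forall>n. \<forall>t\<in>I n. (u n has_vector_derivative u' n t) (at t within I n)) \<and> symbol \<sigma> I k a c u')"

text \<open>Polynomials in \<open>t\<close> of bounded degree with coefficients \<open>O(\<sigma>\<^sub>n\<^sup>-\<^sup>a)\<close>.\<close>

inductive poly_family :: "(nat \<Rightarrow> real) \<Rightarrow> nat \<Rightarrow> (nat \<Rightarrow> real \<Rightarrow> complex) \<Rightarrow> bool" for \<sigma> a where
  monom: "C \<ge> 0 \<Longrightarrow> (\<And>n. norm (d n) \<le> C * (1 / \<sigma> n) ^ a) \<Longrightarrow> poly_family \<sigma> a (\<lambda>n t. d n * of_real t ^ i)"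
| add: "poly_family \<sigma> a u \<Longrightarrow> poly_family \<sigma> a v \<Longrightarrow> poly_family \<sigma> a (\<lambda>n t. u n t + v n t)"

text \<open>Remainders of the exponential series are closed under differentiation, the order
  dropping by one. As the remainder of order \<open>q\<close> is \<open>O(z^q)\<close> near 0,
  inserting a function of size \<open>1/\<sigma>\<^sub>n\<close> gains \<open>q\<close> powers of
  \<open>1/\<sigma>\<^sub>n\<close>.\<close>

definition exp_tail :: "nat \<Rightarrow> complex \<Rightarrow> complex" where
  "exp_tail q z = exp z - (\<Sum>k<q. z ^ k / fact k)"

section \<open>Closure properties of symbol classes\<close>

lemma symbol_wbounded: "symbol \<sigma> I k a c u \<Longrightarrow> wbounded \<sigma> I a c u"
  by (cases k) auto

lemma symbol_SucI:
  assumes "wbounded \<sigma> I a c u"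
    and "\<And>n t. t \<in> I n \<Longrightarrow> (u n has_vector_derivative u' n t) (at t within I n)"
    and "symbol \<sigma> I k a c u'"
  shows "symbol \<sigma> I (Suc k) a c u"
  using assms by auto

lemma symbol_SucD: "symbol \<sigma> I (Suc k) a c u \<Longrightarrow> symbol \<sigma> I k a c u"
proof (induction k arbitrary: u)
  case (Suc k)
  then show ?case by (metis symbol.simps(2))
qed auto

lemma symbol_mono_order:
  assumes "symbol \<sigma> I k a c u" "j \<le> k"
  shows "symbol \<sigma> I j a c u"
  using assms(2,1) by (induction k rule: dec_induct) (auto dest: symbol_SucD simp del: symbol.simps)

lemma wbounded_cong: "wbounded \<sigma> I a c u \<Longrightarrow> (\<And>n t. t \<in> I n \<Longrightarrow> u n t = v n t) \<Longrightarrow> wbounded \<sigma> I a c v"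
  unfolding wbounded_def by (metis (no_types, lifting) continuous_on_cong)

lemma symbol_cong: "symbol \<sigma> I k a c u \<Longrightarrow> (\<And>n t. t \<in> I n \<Longrightarrow> u n t = v n t) \<Longrightarrow> symbol \<sigma> I k a c v"
proof (induction k)
  case (Suc k)
  then obtain u' where u': "\<forall>n. \<forall>t\<in>I n. (u n has_vector_derivative u' n t) (at t within I n)" "symbol \<sigma> I k a c u'"
    by auto
  have "\<forall>n. \<forall>t\<in>I n. (v n has_vector_derivative u' n t) (at t within I n)"
    using u'(1) Suc.prems(2) by (metis has_vector_derivative_transform)
  then show ?case using u'(2) Suc.prems wbounded_cong[of \<sigma> I a c u v] by auto
qed (auto intro: wbounded_cong)

lemma wbounded_add:
  assumes "\<And>n. \<sigma> n > 0" "wbounded \<sigma> I a c u" "wbounded \<sigma> I a c v"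
  shows "wbounded \<sigma> I a c (\<lambda>n t. u n t + v n t)"
proof -
  obtain C K where C: "C \<ge> 0" "\<And>n t. t \<in> I n \<Longrightarrow> norm (u n t) \<le> C * (1 / \<sigma> n) ^ a * wt t ^ K * exp (c * t\<^sup>2)"
    using assms(2) unfolding wbounded_def by blast
  obtain D L where D: "D \<ge> 0" "\<And>n t. t \<in> I n \<Longrightarrow> norm (v n t) \<le> D * (1 / \<sigma> n) ^ a * wt t ^ L * exp (c * t\<^sup>2)"
    using assms(3) unfolding wbounded_def by blast
  have "norm (u n t + v n t) \<le> (C + D) * (1 / \<sigma> n) ^ a * wt t ^ max K L * exp (c * t\<^sup>2)" if "t \<in> I n" for n t
  proof -
    have "norm (u n t + v n t) \<le> C * (1 / \<sigma> n) ^ a * wt t ^ K * exp (c * t\<^sup>2) + D * (1 / \<sigma> n) ^ a * wt t ^ L * exp (c * t\<^sup>2)"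
      using norm_triangle_ineq[of "u n t" "v n t"] C(2)[OF that] D(2)[OF that] by linarith
    also have "\<dots> \<le> C * (1 / \<sigma> n) ^ a * wt t ^ max K L * exp (c * t\<^sup>2) + D * (1 / \<sigma> n) ^ a * wt t ^ max K L * exp (c * t\<^sup>2)"
      using C(1) D(1) assms(1)[of n] by (intro add_mono mult_right_mono mult_left_mono power_increasing) auto
    finally show ?thesis by (simp add: algebra_simps)
  qed
  moreover have "C + D \<ge> 0" using C D by simp
  ultimately show ?thesis using assms(2,3) unfolding wbounded_def
    by (intro conjI allI continuous_intros exI[of _ "C + D"] exI[of _ "max K L"]) auto
qed

lemma symbol_add:
  assumes "\<And>n. \<sigma> n > 0"
  shows "symbol \<sigma> I k a c u \<Longrightarrow> symbol \<sigma> I k a c v \<Longrightarrow> symbol \<sigma> I k a c (\<lambda>n t. u n t + v n t)"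
proof (induction k arbitrary: u v)
  case (Suc k)
  then obtain u' v' where u': "\<forall>n. \<forall>t\<in>I n. (u n has_vector_derivative u' n t) (at t within I n)" "symbol \<sigma> I k a c u'"
    and v': "\<forall>n. \<forall>t\<in>I n. (v n has_vector_derivative v' n t) (at t within I n)" "symbol \<sigma> I k a c v'"
    by auto
  have "\<And>n t. t\<in>I n \<Longrightarrow> ((\<lambda>t. u n t + v n t) has_vector_derivative u' n t + v' n t) (at t within I n)"
    using u'(1) v'(1) by (auto intro!: derivative_intros)
  moreover have "wbounded \<sigma> I a c (\<lambda>n t. u n t + v n t)"
    using Suc.prems by (intro wbounded_add assms) (auto dest: symbol_wbounded)
  ultimately show ?case using Suc.IH[OF u'(2) v'(2)] by (intro symbol_SucI) auto
qed (auto intro: wbounded_add assms)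

lemma wbounded_mult:
  assumes "\<And>n. \<sigma> n > 0" "wbounded \<sigma> I a c u" "wbounded \<sigma> I b d v"
  shows "wbounded \<sigma> I (a + b) (c + d) (\<lambda>n t. u n t * v n t)"
proof -
  obtain C K where C: "C \<ge> 0" "\<And>n t. t \<in> I n \<Longrightarrow> norm (u n t) \<le> C * (1 / \<sigma> n) ^ a * wt t ^ K * exp (c * t\<^sup>2)"
    using assms(2) unfolding wbounded_def by blast
  obtain D L where D: "D \<ge> 0" "\<And>n t. t \<in> I n \<Longrightarrow> norm (v n t) \<le> D * (1 / \<sigma> n) ^ b * wt t ^ L * exp (d * t\<^sup>2)"
    using assms(3) unfolding wbounded_def by blast
  have "norm (u n t * v n t) \<le> (C * D) * (1 / \<sigma> n) ^ (a + b) * wt t ^ (K + L) * exp ((c + d) * t\<^sup>2)" if "t \<in> I n" for n t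
  proof -
    have "norm (u n t * v n t) \<le> (C * (1 / \<sigma> n) ^ a * wt t ^ K * exp (c * t\<^sup>2)) * (D * (1 / \<sigma> n) ^ b * wt t ^ L * exp (d * t\<^sup>2))"
      unfolding norm_mult using C(2)[OF that] D(2)[OF that] C(1) assms(1)[of n]
      by (intro mult_mono) (auto intro!: mult_nonneg_nonneg)
    then show ?thesis by (simp only: power_add distrib_right exp_add mult_ac)
  qed
  moreover have "C * D \<ge> 0" using C D by simp
  ultimately show ?thesis using assms(2,3) unfolding wbounded_def
    by (intro conjI allI continuous_intros exI[of _ "C * D"] exI[of _ "K + L"]) auto
qed

lemma symbol_mult:
  assumes "\<And>n. \<sigma> n > 0"
  shows "symbol \<sigma> I k a c u \<Longrightarrow> symbol \<sigma> I k b d v \<Longrightarrow> symbol \<sigma> I k (a + b) (c + d) (\<lambda>n t. u n t * v n t)"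
proof (induction k arbitrary: u v)
  case (Suc k)
  then obtain u' v' where u': "\<forall>n. \<forall>t\<in>I n. (u n has_vector_derivative u' n t) (at t within I n)" "symbol \<sigma> I k a c u'"
    and v': "\<forall>n. \<forall>t\<in>I n. (v n has_vector_derivative v' n t) (at t within I n)" "symbol \<sigma> I k b d v'"
    by auto
  have "\<And>n t. t\<in>I n \<Longrightarrow> ((\<lambda>t. u n t * v n t) has_vector_derivative u n t * v' n t + u' n t * v n t) (at t within I n)"
    using u'(1) v'(1) by (auto intro!: has_vector_derivative_mult)
  moreover have "symbol \<sigma> I k (a + b) (c + d) (\<lambda>n t. u n t * v' n t + u' n t * v n t)"
    using Suc.prems by (intro symbol_add assms Suc.IH u' v') (auto dest: symbol_SucD simp del: symbol.simps)
  moreover have "wbounded \<sigma> I (a + b) (c + d) (\<lambda>n t. u n t * v n t)"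
    using Suc.prems by (intro wbounded_mult assms) (auto dest: symbol_wbounded)
  ultimately show ?case by (intro symbol_SucI)
qed (auto intro: wbounded_mult assms)

lemma symbol_zero: "symbol \<sigma> I k a c (\<lambda>n t. 0)"
proof -
  have "wbounded \<sigma> I a c (\<lambda>n t. 0)"
    unfolding wbounded_def by (intro conjI allI continuous_intros exI[of _ 0]) auto
  then show ?thesis by (induction k) (auto intro!: exI[of _ "\<lambda>n t. 0"])
qed

lemma symbol_const:
  assumes "C \<ge> 0" "\<And>n. norm (d n) \<le> C * (1 / \<sigma> n) ^ a"
  shows "symbol \<sigma> I k a 0 (\<lambda>n t. d n)"
proof -
  have "wbounded \<sigma> I a 0 (\<lambda>n t. d n)"
    unfolding wbounded_def using assms by (intro conjI allI continuous_intros exI[of _ C] exI[of _ 0]) auto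
  then show ?thesis by (cases k) (auto intro!: exI[of _ "\<lambda>n t. 0"] symbol_zero)
qed

lemma symbol_of_real: "symbol \<sigma> I k 0 0 (\<lambda>n t. of_real t)"
proof -
  have "wbounded \<sigma> I 0 0 (\<lambda>n t. of_real t)"
    unfolding wbounded_def by (intro conjI allI continuous_intros exI[of _ 1] exI[of _ 1]) auto
  then show ?thesis
    by (cases k) (auto intro!: exI[of _ "\<lambda>n t. 1"] symbol_const[of 1] derivative_eq_intros)
qed

lemma symbol_power:
  assumes "\<And>n. \<sigma> n > 0" "symbol \<sigma> I k a 0 u"
  shows "symbol \<sigma> I k (q * a) 0 (\<lambda>n t. u n t ^ q)"
proof (induction q)
  case 0
  show ?case by (auto intro!: symbol_const[of 1])
next
  case (Suc q)
  show ?case using symbol_mult[OF assms(1) assms(2) Suc] by simp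
qed

lemma symbol_cmult:
  assumes "\<And>n. \<sigma> n > 0" "symbol \<sigma> I k a c u"
  shows "symbol \<sigma> I k a c (\<lambda>n t. z * u n t)"
  using symbol_mult[OF assms(1) symbol_const[of "norm z" "\<lambda>_. z" \<sigma> 0] assms(2)] by simp

lemma symbol_sum:
  assumes "\<And>n. \<sigma> n > 0" "\<And>i. i \<in> A \<Longrightarrow> symbol \<sigma> I k a c (u i)"
  shows "symbol \<sigma> I k a c (\<lambda>n t. \<Sum>i\<in>A. u i n t)"
  using assms(2)
proof (induction A rule: infinite_finite_induct)
  case (insert x F)
  then show ?case by (simp add: symbol_add assms(1))
qed (auto intro: symbol_zero)

lemma symbol_weaken_exp:
  assumes "\<And>n. \<sigma> n > 0" "c \<le> d"
  shows "symbol \<sigma> I k a c u \<Longrightarrow> symbol \<sigma> I k a d u"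
proof -
  have *: "wbounded \<sigma> I a d u" if u: "wbounded \<sigma> I a c u" for u
  proof -
    obtain C K where C: "C \<ge> 0" "\<And>n t. t \<in> I n \<Longrightarrow> norm (u n t) \<le> C * (1 / \<sigma> n) ^ a * wt t ^ K * exp (c * t\<^sup>2)"
      using u unfolding wbounded_def by blast
    have "norm (u n t) \<le> C * (1 / \<sigma> n) ^ a * wt t ^ K * exp (d * t\<^sup>2)" if "t \<in> I n" for n t
    proof -
      have "C * (1 / \<sigma> n) ^ a * wt t ^ K * exp (c * t\<^sup>2) \<le> C * (1 / \<sigma> n) ^ a * wt t ^ K * exp (d * t\<^sup>2)"
        using C(1) assms(1)[of n] assms(2) by (intro mult_left_mono) (auto intro!: mult_right_mono)
      then show ?thesis using C(2)[OF that] by linarith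
    qed
    then show ?thesis using u C(1) unfolding wbounded_def by blast
  qed
  show "symbol \<sigma> I k a c u \<Longrightarrow> symbol \<sigma> I k a d u"
  proof (induction k arbitrary: u)
    case (Suc k)
    then obtain u' where u': "\<forall>n. \<forall>t\<in>I n. (u n has_vector_derivative u' n t) (at t within I n)" "symbol \<sigma> I k a c u'"
      by auto
    show ?case using u' Suc.IH[OF u'(2)] *[OF symbol_wbounded[OF Suc.prems]] by (intro symbol_SucI) auto
  qed (simp add: *)
qed

text \<open>As \<open>1/\<sigma>\<^sub>n\<close> is at most \<open>1/\<delta>\<close>, surplus
  powers of it can be traded for a constant; this is what nests the classes of different
  scales.\<close>

lemma pow_inv_le:
  fixes s \<delta> :: real
  assumes "\<delta> > 0" "s \<ge> \<delta>" "b \<le> a"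
  shows "(1 / s) ^ a \<le> (1 / \<delta>) ^ (a - b) * (1 / s) ^ b"
proof -
  have "(1 / s) ^ a = (1 / s) ^ (a - b) * (1 / s) ^ b"
    using assms(3) by (simp flip: power_add)
  also have "\<dots> \<le> (1 / \<delta>) ^ (a - b) * (1 / s) ^ b"
    using assms by (intro mult_right_mono power_mono) (auto simp: frac_le)
  finally show ?thesis .
qed

lemma symbol_weaken_scale:
  assumes "\<delta> > 0" "\<And>n. \<sigma> n \<ge> \<delta>" "b \<le> a"
  shows "symbol \<sigma> I k a c u \<Longrightarrow> symbol \<sigma> I k b c u"
proof -
  have *: "wbounded \<sigma> I b c u" if u: "wbounded \<sigma> I a c u" for u
  proof -
    obtain C K where C: "C \<ge> 0" "\<And>n t. t \<in> I n \<Longrightarrow> norm (u n t) \<le> C * (1 / \<sigma> n) ^ a * wt t ^ K * exp (c * t\<^sup>2)"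
      using u unfolding wbounded_def by blast
    have "norm (u n t) \<le> (C * (1 / \<delta>) ^ (a - b)) * (1 / \<sigma> n) ^ b * wt t ^ K * exp (c * t\<^sup>2)" if "t \<in> I n" for n t
    proof -
      have "C * (1 / \<sigma> n) ^ a * wt t ^ K * exp (c * t\<^sup>2) \<le> C * ((1 / \<delta>) ^ (a - b) * (1 / \<sigma> n) ^ b) * wt t ^ K * exp (c * t\<^sup>2)"
        using C(1) pow_inv_le[OF assms(1,2,3)] by (intro mult_right_mono mult_left_mono) auto
      then show ?thesis using C(2)[OF that] by (simp add: mult_ac)
    qed
    then show ?thesis using u C(1) assms(1) unfolding wbounded_def
      by (intro conjI exI[of _ "C * (1 / \<delta>) ^ (a - b)"] exI[of _ K]) auto
  qed
  show "symbol \<sigma> I k a c u \<Longrightarrow> symbol \<sigma> I k b c u"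
  proof (induction k arbitrary: u)
    case (Suc k)
    then obtain u' where u': "\<forall>n. \<forall>t\<in>I n. (u n has_vector_derivative u' n t) (at t within I n)" "symbol \<sigma> I k a c u'"
      by auto
    show ?case using u' Suc.IH[OF u'(2)] *[OF symbol_wbounded[OF Suc.prems]] by (intro symbol_SucI) auto
  qed (simp add: *)
qed

text \<open>The mean value inequality on the segment from 0 to \<open>t\<close> costs one factor
  \<open>|t|\<close>, which the free exponent of the weight absorbs; the scale is unchanged. The
  weight at an intermediate point must not exceed the one at \<open>t\<close>, hence
  \<open>c \<ge> 0\<close>.\<close>

lemma symbol_integrate:
  assumes pos: "\<And>n. \<sigma> n > 0"
    and I: "\<And>n. convex (I n)" "\<And>n. 0 \<in> I n"
    and zero: "\<And>n. u n 0 = 0"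
    and deriv: "\<And>n t. t \<in> I n \<Longrightarrow> (u n has_vector_derivative u' n t) (at t within I n)"
    and c: "c \<ge> 0" and u': "symbol \<sigma> I k a c u'"
  shows "symbol \<sigma> I (Suc k) a c u"
proof -
  obtain C K where C: "C \<ge> 0" "\<And>n t. t \<in> I n \<Longrightarrow> norm (u' n t) \<le> C * (1 / \<sigma> n) ^ a * wt t ^ K * exp (c * t\<^sup>2)"
    using symbol_wbounded[OF u'] unfolding wbounded_def by blast
  have "norm (u n t) \<le> C * (1 / \<sigma> n) ^ a * wt t ^ Suc K * exp (c * t\<^sup>2)" if t: "t \<in> I n" for n t
  proof -
    let ?B = "C * (1 / \<sigma> n) ^ a * wt t ^ K * exp (c * t\<^sup>2)"
    have seg: "closed_segment 0 t \<subseteq> I n"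
      using I t by (simp add: closed_segment_subset)
    have "norm (u n t - u n 0) \<le> ?B * norm (t - 0)"
    proof (rule differentiable_bound[where S = "closed_segment 0 t" and f' = "\<lambda>r h. h *\<^sub>R u' n r"])
      fix r assume r: "r \<in> closed_segment 0 t"
      show "(u n has_derivative (\<lambda>h. h *\<^sub>R u' n r)) (at r within closed_segment 0 t)"
        using deriv[of r n] r seg has_vector_derivative_within_subset
        unfolding has_vector_derivative_def[symmetric] by blast
      have rt: "\<bar>r\<bar> \<le> \<bar>t\<bar>" using r by (auto simp: closed_segment_eq_real_ivl split: if_splits)
      have "onorm (\<lambda>h. h *\<^sub>R u' n r) \<le> norm (u' n r)"
        by (intro onorm_le) (simp add: mult.commute)
      also have "\<dots> \<le> C * (1 / \<sigma> n) ^ a * wt r ^ K * exp (c * r\<^sup>2)" using C(2) r seg by blast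
      also have "\<dots> \<le> ?B"
        using C(1) pos[of n] c rt abs_le_square_iff[of r t]
        by (intro mult_mono mult_left_mono power_mono) (auto intro!: mult_left_mono)
      finally show "onorm (\<lambda>h. h *\<^sub>R u' n r) \<le> ?B" .
    qed auto
    also have "?B * norm (t - 0) \<le> ?B * wt t"
      using C(1) pos[of n] by (intro mult_left_mono) (auto intro!: mult_nonneg_nonneg)
    finally show ?thesis using zero by (simp add: mult_ac)
  qed
  moreover have "continuous_on (I n) (u n)" for n
    by (meson deriv continuous_on_eq_continuous_within has_vector_derivative_continuous)
  ultimately have "wbounded \<sigma> I a c u" using C(1) unfolding wbounded_def by blast
  then show ?thesis using deriv u' by auto
qed

text \<open>The derivative of the Taylor remainder of \<open>D 0\<close> with \<open>N + 1\<close>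
  terms is the remainder of \<open>D 1\<close> with \<open>N\<close> terms, and every remainder with
  at least one term vanishes at 0. So \<open>N\<close> integrations carry the bound on the top
  derivative over to the remainder, each adding one order of differentiability.\<close>

lemma symbol_taylor:
  assumes pos: "\<And>n. \<sigma> n > 0"
    and I: "\<And>n. convex (I n)" "\<And>n. 0 \<in> I n"
    and c: "c \<ge> 0"
    and deriv: "\<And>n i t. i < N \<Longrightarrow> t \<in> I n \<Longrightarrow> (D i n has_vector_derivative D (Suc i) n t) (at t within I n)"
    and DN: "symbol \<sigma> I k a c (D N)"
  shows "symbol \<sigma> I (k + N) a c (\<lambda>n t. D 0 n t - (\<Sum>i<N. D i n 0 * of_real t ^ i / fact i))"
  using deriv DN
proof (induction N arbitrary: D)
  case (Suc N)
  let ?v = "\<lambda>n t. D 0 n t - (\<Sum>i<Suc N. D i n 0 * of_real t ^ i / fact i)"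
  let ?v' = "\<lambda>n t. D (Suc 0) n t - (\<Sum>i<N. D (Suc i) n 0 * of_real t ^ i / fact i)"
  have IH: "symbol \<sigma> I (k + N) a c ?v'"
    using Suc.IH[of "\<lambda>i. D (Suc i)"] Suc.prems by simp
  have "(?v n has_vector_derivative ?v' n t) (at t within I n)" if "t \<in> I n" for n t
  proof -
    have 1: "((\<lambda>t. D (Suc i) n 0 * of_real t ^ Suc i / fact (Suc i)) has_vector_derivative D (Suc i) n 0 * of_real t ^ i / fact i) (at t within I n)" for i
    proof -
      have "((\<lambda>t. of_real t ^ Suc i :: complex) has_vector_derivative of_nat (Suc i) * of_real t ^ i) (at t within I n)"
        using DERIV_power[OF DERIV_ident, where n = "Suc i"] by (intro has_vector_derivative_real_field) simp
      then have "((\<lambda>t. (D (Suc i) n 0 / fact (Suc i)) * of_real t ^ Suc i) has_vector_derivative (D (Suc i) n 0 / fact (Suc i)) * (of_nat (Suc i) * of_real t ^ i)) (at t within I n)"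
        by (intro has_vector_derivative_mult_right)
      moreover have "(D (Suc i) n 0 / fact (Suc i)) * (of_nat (Suc i) * of_real t ^ i) = D (Suc i) n 0 * of_real t ^ i / fact i"
        by (simp add: fact_Suc field_simps del: of_nat_Suc)
      moreover have "(\<lambda>t. (D (Suc i) n 0 / fact (Suc i)) * of_real t ^ Suc i) = (\<lambda>t. D (Suc i) n 0 * of_real t ^ Suc i / fact (Suc i))"
        by auto
      ultimately show ?thesis by metis
    qed
    have 2: "((\<lambda>t. \<Sum>i<N. D (Suc i) n 0 * of_real t ^ Suc i / fact (Suc i)) has_vector_derivative (\<Sum>i<N. D (Suc i) n 0 * of_real t ^ i / fact i)) (at t within I n)"
      using 1 by (intro has_vector_derivative_sum) auto
    have "((\<lambda>t. D 0 n t - (D 0 n 0 + (\<Sum>i<N. D (Suc i) n 0 * of_real t ^ Suc i / fact (Suc i)))) has_vector_derivative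
       D (Suc 0) n t - (0 + (\<Sum>i<N. D (Suc i) n 0 * of_real t ^ i / fact i))) (at t within I n)"
      using Suc.prems(1)[of 0 t n] that 2 by (intro has_vector_derivative_diff has_vector_derivative_add has_vector_derivative_const) auto
    then show ?thesis unfolding sum.lessThan_Suc_shift by simp
  qed
  moreover have "?v n 0 = 0" for n
    unfolding sum.lessThan_Suc_shift by simp
  ultimately have "symbol \<sigma> I (Suc (k + N)) a c ?v"
    by (intro symbol_integrate[OF pos I _ _ c IH]) auto
  then show ?case by simp
qed simp

text \<open>Extension by zero from a closed interval is smooth only if the function is flat at the
  end points. Vanishing on a strip inside the interval ensures this for all derivatives at
  once.\<close>

lemma symbol_glue:
  assumes pos: "\<And>n. \<sigma> n > 0" and eps: "0 < \<epsilon>'" "\<epsilon>' < \<epsilon>"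
  shows "symbol \<sigma> (\<lambda>n. {-\<epsilon> * \<sigma> n..\<epsilon> * \<sigma> n}) k a c u \<Longrightarrow>
    (\<And>n t. t \<in> {-\<epsilon> * \<sigma> n..\<epsilon> * \<sigma> n} \<Longrightarrow> \<epsilon>' * \<sigma> n < \<bar>t\<bar> \<Longrightarrow> u n t = 0) \<Longrightarrow>
    symbol \<sigma> (\<lambda>n. UNIV) k a c (\<lambda>n t. if \<bar>t\<bar> \<le> \<epsilon> * \<sigma> n then u n t else 0)"
proof (induction k arbitrary: u)
  have e: "\<epsilon>' * \<sigma> n < \<epsilon> * \<sigma> n" for n using eps pos by simp
  have I: "t \<in> {-\<epsilon> * \<sigma> n..\<epsilon> * \<sigma> n} \<longleftrightarrow> \<bar>t\<bar> \<le> \<epsilon> * \<sigma> n" for n t by auto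
  have *: "wbounded \<sigma> (\<lambda>n. UNIV) a c (\<lambda>n t. if \<bar>t\<bar> \<le> \<epsilon> * \<sigma> n then u n t else 0)"
    if u: "wbounded \<sigma> (\<lambda>n. {-\<epsilon> * \<sigma> n..\<epsilon> * \<sigma> n}) a c u"
      and z: "\<And>n t. t \<in> {-\<epsilon> * \<sigma> n..\<epsilon> * \<sigma> n} \<Longrightarrow> \<epsilon>' * \<sigma> n < \<bar>t\<bar> \<Longrightarrow> u n t = 0" for u
  proof -
    obtain C K where C: "C \<ge> 0" "\<And>n t. t \<in> {-\<epsilon> * \<sigma> n..\<epsilon> * \<sigma> n} \<Longrightarrow> norm (u n t) \<le> C * (1 / \<sigma> n) ^ a * wt t ^ K * exp (c * t\<^sup>2)"
      using u unfolding wbounded_def by blast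
    have "norm (if \<bar>t\<bar> \<le> \<epsilon> * \<sigma> n then u n t else 0) \<le> C * (1 / \<sigma> n) ^ a * wt t ^ K * exp (c * t\<^sup>2)" for n t
      using C(1) C(2)[of t n] pos[of n] I[of t n] by auto
    moreover have "continuous_on UNIV (\<lambda>t. if \<bar>t\<bar> \<le> \<epsilon> * \<sigma> n then u n t else 0)" for n
    proof -
      have "continuous_on ({t. \<bar>t\<bar> \<le> \<epsilon> * \<sigma> n} \<union> {t. \<bar>t\<bar> \<ge> \<epsilon> * \<sigma> n}) (\<lambda>t. if \<bar>t\<bar> \<le> \<epsilon> * \<sigma> n then u n t else 0)"
      proof (rule continuous_on_If)
        have "{t. \<bar>t\<bar> \<le> \<epsilon> * \<sigma> n} = {-\<epsilon> * \<sigma> n..\<epsilon> * \<sigma> n}" by auto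
        then show "continuous_on {t. \<bar>t\<bar> \<le> \<epsilon> * \<sigma> n} (u n)" using u unfolding wbounded_def by simp
        show "closed {t. \<bar>t\<bar> \<le> \<epsilon> * \<sigma> n}" "closed {t. \<bar>t\<bar> \<ge> \<epsilon> * \<sigma> n}"
          by (intro closed_Collect_le continuous_intros)+
      qed (use z[of _ n] e[of n] I in \<open>auto intro!: z[of _ n] simp del: abs_le_iff\<close>)
      moreover have "{t. \<bar>t\<bar> \<le> \<epsilon> * \<sigma> n} \<union> {t. \<bar>t\<bar> \<ge> \<epsilon> * \<sigma> n} = UNIV" by auto
      ultimately show ?thesis by simp
    qed
    ultimately show ?thesis using C(1) unfolding wbounded_def by blast
  qed
  {
    case 0
    then show ?case using * by simp
  next
    case (Suc k)
    let ?I = "\<lambda>n. {-\<epsilon> * \<sigma> n..\<epsilon> * \<sigma> n}"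
    obtain u' where u': "\<forall>n. \<forall>t\<in>?I n. (u n has_vector_derivative u' n t) (at t within ?I n)" "symbol \<sigma> ?I k a c u'"
      using Suc.prems(1) unfolding symbol.simps by blast
    let ?O = "\<lambda>n. {t. \<epsilon>' * \<sigma> n < \<bar>t\<bar>}"
    have opO: "open (?O n)" for n by (intro open_Collect_less continuous_intros)
    \<comment> \<open>The derivative vanishes on the same strip because \<open>u\<close> is locally
      zero there, so the induction hypothesis applies to \<open>u'\<close>. At an end point this
      relies on the uniqueness of one-sided derivatives.\<close>
    have z': "u' n t = 0" if t: "t \<in> ?I n" "\<epsilon>' * \<sigma> n < \<bar>t\<bar>" for n t
    proof -
      obtain r where r: "r > 0" "ball t r \<subseteq> ?O n"
        using openE[OF opO[of n], of t] t(2) by (metis mem_Collect_eq)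
      have "((\<lambda>r. 0) has_vector_derivative u' n t) (at t within ?I n)"
      proof (rule has_vector_derivative_transform_within[OF u'(1)[rule_format, OF t(1)] r(1) t(1)])
        fix x assume "x \<in> ?I n" "dist x t < r"
        then have "x \<in> ?O n" using r(2) by (auto simp: dist_commute)
        then show "u n x = 0" using Suc.prems(2) \<open>x \<in> ?I n\<close> by blast
      qed
      moreover have "((\<lambda>r. 0) has_vector_derivative 0) (at t within ?I n)" by simp
      moreover have "-\<epsilon> * \<sigma> n < \<epsilon> * \<sigma> n"
        using mult_pos_pos[of \<epsilon> "\<sigma> n"] eps pos[of n] by simp
      ultimately show ?thesis
        using t(1) by (intro vector_derivative_unique_within_closed_interval[of "-\<epsilon> * \<sigma> n" "\<epsilon> * \<sigma> n" t, unfolded box_real])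
    qed
    \<comment> \<open>Since \<open>\<epsilon>' < \<epsilon>\<close>, the open interval and the open
      outer region cover the line; the extension agrees with \<open>u\<close> on the former and is
      zero on the latter.\<close>
    have "((\<lambda>t. if \<bar>t\<bar> \<le> \<epsilon> * \<sigma> n then u n t else 0) has_vector_derivative (if \<bar>t\<bar> \<le> \<epsilon> * \<sigma> n then u' n t else 0)) (at t)" for n t
    proof (cases "\<bar>t\<bar> < \<epsilon> * \<sigma> n")
      case True
      let ?J = "{-\<epsilon> * \<sigma> n<..<\<epsilon> * \<sigma> n}"
      have "t \<in> ?J" using True by auto
      then have "(u n has_vector_derivative u' n t) (at t within ?J)"
        by (intro has_vector_derivative_within_subset[OF u'(1)[rule_format]]) auto
      then have "(u n has_vector_derivative u' n t) (at t)"
        using at_within_open[OF \<open>t \<in> ?J\<close>] by (simp only: open_greaterThanLessThan)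
      then have "((\<lambda>t. if \<bar>t\<bar> \<le> \<epsilon> * \<sigma> n then u n t else 0) has_vector_derivative u' n t) (at t)"
        by (rule has_vector_derivative_transform_within_open[OF _ open_greaterThanLessThan \<open>t \<in> ?J\<close>]) auto
      then show ?thesis using True by simp
    next
      case False
      then have "t \<in> ?O n" using e[of n] by auto
      have "((\<lambda>t. if \<bar>t\<bar> \<le> \<epsilon> * \<sigma> n then u n t else 0) has_vector_derivative 0) (at t)"
      proof (rule has_vector_derivative_transform_within_open[OF _ opO \<open>t \<in> ?O n\<close>])
        show "((\<lambda>t. 0) has_vector_derivative 0) (at t)" by simp
        fix x assume x: "x \<in> ?O n"
        show "0 = (if \<bar>x\<bar> \<le> \<epsilon> * \<sigma> n then u n x else 0)"
          using Suc.prems(2)[of x n] x I[of x n] by simp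
      qed
      moreover have "(if \<bar>t\<bar> \<le> \<epsilon> * \<sigma> n then u' n t else 0) = 0"
        using z'[of t n] \<open>t \<in> ?O n\<close> I[of t n] by simp
      ultimately show ?thesis by simp
    qed
    moreover have "symbol \<sigma> (\<lambda>n. UNIV) k a c (\<lambda>n t. if \<bar>t\<bar> \<le> \<epsilon> * \<sigma> n then u' n t else 0)"
      using Suc.IH[OF u'(2)] z' by blast
    moreover have "wbounded \<sigma> (\<lambda>n. UNIV) a c (\<lambda>n t. if \<bar>t\<bar> \<le> \<epsilon> * \<sigma> n then u n t else 0)"
      using *[OF symbol_wbounded[OF Suc.prems(1)] Suc.prems(2)] by blast
    ultimately show ?case by (intro symbol_SucI)
  }
qed

section \<open>Composition with the exponential\<close>

text \<open>At \<open>q = 0\<close> the truncated \<open>q - 1\<close> is again 0, as it should be: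
  \<open>exp_tail 0\<close> is \<open>exp\<close>, its own derivative.\<close>

lemma exp_tail_deriv: "(exp_tail q has_field_derivative exp_tail (q - 1) z) (at z within S)"
proof (cases q)
  case 0
  then show ?thesis unfolding exp_tail_def[abs_def] by (auto intro!: derivative_eq_intros)
next
  case (Suc r)
  have *: "((\<lambda>z. z ^ Suc k / fact (Suc k)) has_field_derivative z ^ k / fact k) (at z within S)" for k and z :: complex
  proof -
    have "((\<lambda>z. z ^ Suc k / fact (Suc k)) has_field_derivative of_nat (Suc k) * z ^ k / fact (Suc k)) (at z within S)"
      using DERIV_power[OF DERIV_ident, where n = "Suc k"] by (intro DERIV_cdivide) simp
    then show ?thesis by (simp add: fact_Suc del: of_nat_Suc power_Suc)
  qed
  have "((\<lambda>z. exp z - (1 + (\<Sum>k<r. z ^ Suc k / fact (Suc k)))) has_field_derivative exp z - (0 + (\<Sum>k<r. z ^ k / fact k))) (at z within S)"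
    by (intro DERIV_diff DERIV_add DERIV_sum * DERIV_const) (auto intro!: derivative_eq_intros)
  then show ?thesis unfolding exp_tail_def[abs_def] Suc sum.lessThan_Suc_shift by (simp del: power_Suc)
qed

lemma exp_tail_bound: "norm (exp_tail q z) \<le> norm z ^ q * exp (norm z)"
proof (induction q arbitrary: z)
  case 0
  then show ?case by (simp add: exp_tail_def norm_exp_eq_Re complex_Re_le_cmod)
next
  case (Suc q)
  have "norm (exp_tail (Suc q) z - exp_tail (Suc q) 0) \<le> (norm z ^ q * exp (norm z)) * norm (z - 0)"
  proof (rule field_differentiable_bound[where S = "closed_segment 0 z" and f' = "exp_tail q"])
    fix w assume "w \<in> closed_segment 0 z"
    then have w: "norm w \<le> norm z" using segment_bound(1)[of w 0 z] by simp
    show "(exp_tail (Suc q) has_field_derivative exp_tail q w) (at w within closed_segment 0 z)"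
      using exp_tail_deriv[of "Suc q"] by simp
    have "norm (exp_tail q w) \<le> norm w ^ q * exp (norm w)" by (rule Suc)
    also have "\<dots> \<le> norm z ^ q * exp (norm z)"
      using w by (intro mult_mono power_mono) auto
    finally show "norm (exp_tail q w) \<le> norm z ^ q * exp (norm z)" .
  qed auto
  moreover have "exp_tail (Suc q) 0 = 0"
    unfolding exp_tail_def sum.lessThan_Suc_shift by simp
  ultimately show ?case by (simp add: mult_ac)
qed

text \<open>In the bound \<open>|u|^q exp |u|\<close> the power supplies \<open>q\<close> factors
  \<open>1/\<sigma>\<^sub>n\<close>, and the pointwise bound on \<open>u\<close> turns the
  exponential into \<open>exp (t\<^sup>2 / 4)\<close>. Differentiation replaces one of these factors
  by \<open>u'\<close>, which has scale 1 too, so the scale stays \<open>q\<close> at every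
  order.\<close>

lemma symbol_exp_tail:
  assumes pos: "\<delta> > 0" "\<And>n. \<sigma> n \<ge> \<delta>"
    and L: "symbol \<sigma> I k 1 0 u"
    and bound: "\<And>n t. t \<in> I n \<Longrightarrow> norm (u n t) \<le> t\<^sup>2 / 4"
  shows "symbol \<sigma> I k q (1/4) (\<lambda>n t. exp_tail q (u n t))"
proof -
  have pos': "\<sigma> n > 0" for n using pos(1) pos(2)[of n] by linarith
  obtain C K where C: "C \<ge> 0" "\<And>n t. t \<in> I n \<Longrightarrow> norm (u n t) \<le> C * (1 / \<sigma> n) ^ 1 * wt t ^ K * exp (0 * t\<^sup>2)"
    using symbol_wbounded[OF L] unfolding wbounded_def by blast
  have cont: "continuous_on (I n) (u n)" for n
    using symbol_wbounded[OF L] unfolding wbounded_def by blast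
  have wbounded: "wbounded \<sigma> I q (1/4) (\<lambda>n t. exp_tail q (u n t))" for q
  proof -
    have "norm (exp_tail q (u n t)) \<le> C ^ q * (1 / \<sigma> n) ^ q * wt t ^ (K * q) * exp (1/4 * t\<^sup>2)" if t: "t \<in> I n" for n t
    proof -
      have "norm (exp_tail q (u n t)) \<le> norm (u n t) ^ q * exp (norm (u n t))" by (rule exp_tail_bound)
      also have "\<dots> \<le> (C * (1 / \<sigma> n) * wt t ^ K) ^ q * exp (1/4 * t\<^sup>2)"
        using C(2)[OF t] bound[OF t] C(1) pos'[of n] by (intro mult_mono power_mono) auto
      finally show ?thesis by (simp add: power_mult_distrib power_mult power_divide)
    qed
    moreover have "continuous_on (I n) (\<lambda>t. exp_tail q (u n t))" for n
    proof -
      have "continuous_on UNIV (exp_tail q)"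
        using exp_tail_deriv by (meson DERIV_continuous continuous_on_eq_continuous_within)
      then show ?thesis using continuous_on_compose2[OF _ cont] by blast
    qed
    moreover have "C ^ q \<ge> 0" using C(1) by simp
    ultimately show ?thesis unfolding wbounded_def by blast
  qed
  show ?thesis using L
  proof (induction k arbitrary: q)
    case (Suc k)
    then obtain u' where u': "\<And>n t. t\<in>I n \<Longrightarrow> (u n has_vector_derivative u' n t) (at t within I n)" "symbol \<sigma> I k 1 0 u'"
      by auto
    have IH: "symbol \<sigma> I k r (1/4) (\<lambda>n t. exp_tail r (u n t))" for r
      using Suc.IH Suc.prems symbol_SucD by blast
    have "symbol \<sigma> I k (q - 1 + 1) (1/4 + 0) (\<lambda>n t. exp_tail (q - 1) (u n t) * u' n t)"
      by (intro symbol_mult pos' IH u')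
    \<comment> \<open>For \<open>q = 0\<close> the product has scale 1 instead of 0, and the lower
      bound \<open>\<delta>\<close> on \<open>\<sigma>\<close> is used to weaken it.\<close>
    then have "symbol \<sigma> I k q (1/4 + 0) (\<lambda>n t. exp_tail (q - 1) (u n t) * u' n t)"
      by (rule symbol_weaken_scale[OF pos, rotated]) simp
    moreover have "((\<lambda>t. exp_tail q (u n t)) has_vector_derivative exp_tail (q - 1) (u n t) * u' n t) (at t within I n)" if "t \<in> I n" for n t
      using field_vector_diff_chain_within[OF u'(1)[OF that] exp_tail_deriv, of q] by (simp add: o_def mult.commute)
    ultimately show ?case using wbounded by (intro symbol_SucI) auto
  qed (use wbounded in simp)
qed

section \<open>Algebra of polynomial families\<close>

lemma poly_family_weaken:
  assumes "\<delta> > 0" "\<And>n. \<sigma> n \<ge> \<delta>" "b \<le> a"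
  shows "poly_family \<sigma> a u \<Longrightarrow> poly_family \<sigma> b u"
proof (induction rule: poly_family.induct)
  case (monom C d i)
  have "norm (d n) \<le> (C * (1 / \<delta>) ^ (a - b)) * (1 / \<sigma> n) ^ b" for n
    using monom(2)[of n] mult_left_mono[OF pow_inv_le[OF assms(1,2,3)] monom(1), of n] by (simp add: mult_ac)
  then show ?case using monom(1) assms(1) by (intro poly_family.monom[where C = "C * (1 / \<delta>) ^ (a - b)"]) auto
qed (rule poly_family.add)

lemma poly_family_mult:
  assumes pos: "\<And>n. \<sigma> n > 0"
  shows "poly_family \<sigma> a u \<Longrightarrow> poly_family \<sigma> b v \<Longrightarrow> poly_family \<sigma> (a + b) (\<lambda>n t. u n t * v n t)"
proof (induction rule: poly_family.induct)
  case (monom C d i)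
  note m = monom
  show ?case using m(3)
  proof (induction rule: poly_family.induct)
    case (monom D e j)
    have "norm (d n * e n) \<le> (C * D) * (1 / \<sigma> n) ^ (a + b)" for n
      using mult_mono[OF m(2)[of n] monom(2)[of n]] m(1) monom(1) pos[of n]
      by (simp add: norm_mult power_add mult_ac)
    then have "poly_family \<sigma> (a + b) (\<lambda>n t. (d n * e n) * of_real t ^ (i + j))"
      using m(1) monom(1) by (intro poly_family.monom[where C = "C * D"]) auto
    then show ?case by (simp add: power_add mult_ac)
  next
    case (add u v)
    then show ?case using poly_family.add by (simp add: distrib_left)
  qed
next
  case (add u v')
  then show ?case using poly_family.add by (simp add: distrib_right)
qed

lemma poly_family_const: "poly_family \<sigma> 0 (\<lambda>n t. z)"
  using poly_family.monom[of "norm z" "\<lambda>n. z" \<sigma> 0 0] by simp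

lemma poly_family_zero: "poly_family \<sigma> a (\<lambda>n t. 0)"
  using poly_family.monom[of 0 "\<lambda>n. 0" \<sigma> a 0] by simp

lemma poly_family_cmult:
  assumes "\<And>n. \<sigma> n > 0" "poly_family \<sigma> a u"
  shows "poly_family \<sigma> a (\<lambda>n t. z * u n t)"
  using poly_family_mult[OF assms(1) poly_family_const assms(2)] by simp

lemma poly_family_sum: "(\<And>i. i \<in> A \<Longrightarrow> poly_family \<sigma> a (u i)) \<Longrightarrow> poly_family \<sigma> a (\<lambda>n t. \<Sum>i\<in>A. u i n t)"
proof (induction A rule: infinite_finite_induct)
  case (insert x F)
  then show ?case by (simp add: poly_family.add)
qed (auto intro: poly_family_zero)

lemma poly_family_power:
  assumes "\<And>n. \<sigma> n > 0" "poly_family \<sigma> a u"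
  shows "poly_family \<sigma> (q * a) (\<lambda>n t. u n t ^ q)"
proof (induction q)
  case 0
  show ?case using poly_family_const by simp
next
  case (Suc q)
  show ?case using poly_family_mult[OF assms(1) assms(2) Suc] by simp
qed

lemma symbol_poly_family:
  assumes "\<And>n. \<sigma> n > 0" "poly_family \<sigma> a u"
  shows "symbol \<sigma> I k a 0 u"
  using assms(2)
proof (induction rule: poly_family.induct)
  case (monom C d i)
  have "symbol \<sigma> I k (a + i * 0) (0 + 0) (\<lambda>n t. d n * of_real t ^ i)"
    using monom by (intro symbol_mult assms(1) symbol_const symbol_power symbol_of_real)
  then show ?case by simp
qed (intro symbol_add assms)

section \<open>Fourier integrals and inversion\<close>

lemma one_plus_power_le: "wt t ^ K \<le> 2 ^ K * (1 + \<bar>t\<bar> ^ K)" for t :: real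
proof (cases "\<bar>t\<bar> \<le> 1")
  case True
  then have "wt t ^ K \<le> 2 ^ K" by (intro power_mono) auto
  also have "\<dots> \<le> 2 ^ K * (1 + \<bar>t\<bar> ^ K)" by simp
  finally show ?thesis .
next
  case False
  then have "wt t ^ K \<le> (2 * \<bar>t\<bar>) ^ K" by (intro power_mono) auto
  also have "\<dots> \<le> 2 ^ K * (1 + \<bar>t\<bar> ^ K)" by (simp add: power_mult_distrib)
  finally show ?thesis .
qed

lemma integrable_poly_gauss:
  fixes c :: real
  assumes "c < 0"
  shows "integrable lborel (\<lambda>t. wt t ^ K * exp (c * t\<^sup>2))"
proof -
  define s where "s = 1 / sqrt (-2 * c)"
  have s: "s > 0" using assms by (simp add: s_def)
  have s2: "2 * s\<^sup>2 = -1 / c" using assms by (simp add: s_def power_divide field_simps)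
  have nd: "normal_density 0 s t = (1 / sqrt (2 * pi * s\<^sup>2)) * exp (c * t\<^sup>2)" for t
    unfolding normal_density_def s2 by (simp add: field_simps)
  have "integrable lborel (\<lambda>t. exp (c * t\<^sup>2) * \<bar>t\<bar> ^ k)" for k
  proof -
    have "integrable lborel (\<lambda>t. sqrt (2 * pi * s\<^sup>2) * (normal_density 0 s t * \<bar>t\<bar> ^ k))"
      using integrable_normal_moment_abs[OF s, of 0 k] by simp
    moreover have "sqrt (2 * pi * s\<^sup>2) * (normal_density 0 s t * \<bar>t\<bar> ^ k) = exp (c * t\<^sup>2) * \<bar>t\<bar> ^ k" for t
      unfolding nd using s by simp
    ultimately show ?thesis by simp
  qed
  from this[of 0] this[of K] have "integrable lborel (\<lambda>t. 2 ^ K * (exp (c * t\<^sup>2) + exp (c * t\<^sup>2) * \<bar>t\<bar> ^ K))"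
    by simp
  then show ?thesis
  proof (rule Bochner_Integration.integrable_bound)
    show "AE t in lborel. norm (wt t ^ K * exp (c * t\<^sup>2)) \<le> norm (2 ^ K * (exp (c * t\<^sup>2) + exp (c * t\<^sup>2) * \<bar>t\<bar> ^ K))"
    proof (rule AE_I2)
      fix t
      have "wt t ^ K * exp (c * t\<^sup>2) \<le> (2 ^ K * (1 + \<bar>t\<bar> ^ K)) * exp (c * t\<^sup>2)"
        by (intro mult_right_mono one_plus_power_le) auto
      moreover have "0 \<le> exp (c * t\<^sup>2) + exp (c * t\<^sup>2) * \<bar>t\<bar> ^ K" by (intro add_nonneg_nonneg) auto
      ultimately show "norm (wt t ^ K * exp (c * t\<^sup>2)) \<le> norm (2 ^ K * (exp (c * t\<^sup>2) + exp (c * t\<^sup>2) * \<bar>t\<bar> ^ K))"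
        by (simp add: algebra_simps abs_mult)
    qed
  qed simp
qed

lemma poly_gauss_tendsto_0:
  fixes c :: real
  assumes "c < 0"
  shows "((\<lambda>t. wt t ^ K * exp (c * t\<^sup>2)) \<longlongrightarrow> 0) at_top"
    and "((\<lambda>t. wt t ^ K * exp (c * t\<^sup>2)) \<longlongrightarrow> 0) at_bot"
proof -
  have "((\<lambda>t. (1 + t) ^ K * exp (c * t\<^sup>2)) \<longlongrightarrow> 0) at_top" using assms by real_asymp
  moreover have "\<forall>\<^sub>F t in at_top. (1 + t) ^ K * exp (c * t\<^sup>2) = wt t ^ K * exp (c * t\<^sup>2)"
    using eventually_ge_at_top[of 0] by eventually_elim auto
  ultimately show *: "((\<lambda>t. wt t ^ K * exp (c * t\<^sup>2)) \<longlongrightarrow> 0) at_top"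
    by (rule Lim_transform_eventually)
  show "((\<lambda>t. wt t ^ K * exp (c * t\<^sup>2)) \<longlongrightarrow> 0) at_bot"
    unfolding at_bot_mirror filterlim_filtermap using * by simp
qed

text \<open>The kernel is \<open>exp (- i t x)\<close> without a normalizing constant, so inversion
  formulas carry the factor \<open>1 / (2 * pi)\<close>.\<close>

definition fourier :: "(real \<Rightarrow> complex) \<Rightarrow> real \<Rightarrow> complex" where
  "fourier v x = (LINT t|lborel. iexp (- (t * x)) * v t)"

lemma fourier_integrable:
  assumes "integrable lborel v"
  shows "integrable lborel (\<lambda>t. iexp (- (t * x)) * v t)"
proof (rule Bochner_Integration.integrable_bound[OF assms])
  have [measurable]: "v \<in> borel_measurable borel" using assms by auto
  show "(\<lambda>t. iexp (- (t * x)) * v t) \<in> borel_measurable lborel" by measurable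
qed (simp add: norm_mult del: of_real_mult of_real_minus)

lemma fourier_add:
  assumes "integrable lborel u" "integrable lborel v"
  shows "fourier (\<lambda>t. u t + v t) x = fourier u x + fourier v x"
  unfolding fourier_def distrib_left
  by (intro Bochner_Integration.integral_add fourier_integrable assms)

lemma fourier_cmult: "fourier (\<lambda>t. z * u t) x = z * fourier u x"
  unfolding fourier_def by (simp add: mult.left_commute[of _ z])

lemma norm_fourier_le: "norm (fourier v x) \<le> (LINT t|lborel. norm (v t))"
proof -
  have "norm (fourier v x) \<le> (LINT t|lborel. norm (iexp (- (t * x)) * v t))"
    unfolding fourier_def by (rule integral_norm_bound)
  then show ?thesis by (simp add: norm_mult del: of_real_mult of_real_minus)
qed

text \<open>The analogue of \<open>wbounded\<close> for a single function, without a scale; for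
  \<open>c < 0\<close> it yields integrability and vanishing boundary terms.\<close>

definition gauss_bounded :: "real \<Rightarrow> (real \<Rightarrow> complex) \<Rightarrow> bool" where
  "gauss_bounded c v \<longleftrightarrow> continuous_on UNIV v \<and> (\<exists>D\<ge>0. \<exists>K. \<forall>t. norm (v t) \<le> D * wt t ^ K * exp (c * t\<^sup>2))"

lemma integrable_gauss_bounded:
  assumes "gauss_bounded c v" "c < 0"
  shows "integrable lborel v"
proof -
  obtain D K where D: "D \<ge> 0" "\<And>t. norm (v t) \<le> D * wt t ^ K * exp (c * t\<^sup>2)"
    using assms unfolding gauss_bounded_def by blast
  have "integrable lborel (\<lambda>t. D * (wt t ^ K * exp (c * t\<^sup>2)))"
    using integrable_poly_gauss[OF assms(2)] by simp
  then show ?thesis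
  proof (rule Bochner_Integration.integrable_bound)
    show "v \<in> borel_measurable lborel"
      using assms unfolding gauss_bounded_def by (auto intro: borel_measurable_continuous_onI)
    show "AE t in lborel. norm (v t) \<le> norm (D * (wt t ^ K * exp (c * t\<^sup>2)))"
      using D by (intro AE_I2) (auto simp: abs_mult mult_ac)
  qed
qed

text \<open>Integration by parts: the derivative of \<open>exp (- i t x) v(t)\<close> integrates to
  0 over the line because Gaussian decay kills the boundary terms.\<close>

lemma fourier_deriv:
  assumes v: "gauss_bounded c v" and v': "gauss_bounded c v'" and c: "c < 0"
    and deriv: "\<And>t. (v has_vector_derivative v' t) (at t)"
  shows "fourier v' x = \<i> * of_real x * fourier v x"
proof -
  define F where "F = (\<lambda>t. iexp (- (t * x)) * v t)"
  define f where "f = (\<lambda>t. iexp (- (t * x)) * v' t + - (\<i> * of_real x) * (iexp (- (t * x)) * v t))"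
  have iv: "integrable lborel v" "integrable lborel v'" using integrable_gauss_bounded assms by auto
  have int: "integrable lborel f"
    unfolding f_def by (intro Bochner_Integration.integrable_add integrable_mult_right fourier_integrable iv)
  have cont: "continuous_on UNIV v" "continuous_on UNIV v'" using v v' unfolding gauss_bounded_def by auto
  have "(LBINT t=-\<infinity>..\<infinity>. f t) = 0 - 0"
  proof (rule interval_integral_FTC_integrable[where F = F])
    fix t
    have "((\<lambda>t. iexp (- (t * x))) has_vector_derivative (iexp (- (t * x)) * (- (\<i> * of_real x)))) (at t)"
      by (auto intro!: derivative_eq_intros has_vector_derivative_real_field simp: field_simps)
    then show "(F has_vector_derivative f t) (at t)"
      unfolding F_def f_def using has_vector_derivative_mult[OF _ deriv[of t], of "\<lambda>t. iexp (- (t * x))" "(iexp (- (t * x)) * (- (\<i> * of_real x)))"]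
      by (simp add: algebra_simps)
    have "continuous_on UNIV f" unfolding f_def by (intro continuous_intros cont)
    then show "isCont f t" by (simp add: continuous_on_eq_continuous_at)
  next
    show "set_integrable lborel (einterval (- \<infinity>) \<infinity>) f"
      using int unfolding set_integrable_def by simp
  next
    obtain D K where D: "D \<ge> 0" "\<And>t. norm (v t) \<le> D * wt t ^ K * exp (c * t\<^sup>2)"
      using v unfolding gauss_bounded_def by blast
    have F: "norm (F t) \<le> D * (wt t ^ K * exp (c * t\<^sup>2))" for t
      using D(2)[of t] by (simp add: F_def norm_mult mult_ac del: of_real_mult of_real_minus)
    have "(F \<longlongrightarrow> 0) at_top"
      by (rule Lim_null_comparison[OF always_eventually[OF allI[OF F]] tendsto_mult_right_zero[OF poly_gauss_tendsto_0(1)[OF c]]])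
    moreover have "(F \<longlongrightarrow> 0) at_bot"
      by (rule Lim_null_comparison[OF always_eventually[OF allI[OF F]] tendsto_mult_right_zero[OF poly_gauss_tendsto_0(2)[OF c]]])
    ultimately show "((F \<circ> real_of_ereal) \<longlongrightarrow> 0) (at_right (- \<infinity>))" "((F \<circ> real_of_ereal) \<longlongrightarrow> 0) (at_left \<infinity>)"
      by (simp_all add: ereal_tendsto_simps)
  qed simp
  then have "(LINT t|lborel. f t) = 0"
    by (simp add: interval_lebesgue_integral_def set_lebesgue_integral_def)
  moreover have "(LINT t|lborel. f t) = fourier v' x + - (\<i> * of_real x) * fourier v x"
    unfolding f_def fourier_def
    by (subst Bochner_Integration.integral_add) (intro integrable_mult_right fourier_integrable iv | simp)+
  ultimately show ?thesis by (simp add: algebra_simps eq_neg_iff_add_eq_0)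
qed

lemma wbounded_gauss_bounded: "wbounded \<sigma> (\<lambda>n. UNIV) a c u \<Longrightarrow> (\<And>n. \<sigma> n > 0) \<Longrightarrow> gauss_bounded c (u n)"
  unfolding wbounded_def gauss_bounded_def
  by (elim conjE exE, intro conjI) (simp, metis UNIV_I less_imp_le mult_nonneg_nonneg zero_le_divide_1_iff zero_le_power)

text \<open>Each factor \<open>|x|\<close> is exchanged for one derivative of \<open>u\<close>, and
  the last derivative is bounded by its integral norm. Differentiation does not change the scale, so
  the power of \<open>1/\<sigma>\<^sub>n\<close> survives.\<close>

lemma fourier_symbol:
  assumes pos: "\<And>n. \<sigma> n > 0" and c: "c < 0"
  shows "symbol \<sigma> (\<lambda>n. UNIV) k a c u \<Longrightarrow>
    \<exists>C\<ge>0. \<forall>n x. \<bar>x\<bar> ^ k * norm (fourier (u n) x) \<le> C * (1 / \<sigma> n) ^ a"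
proof (induction k arbitrary: u)
  case 0
  then obtain C K where C: "C \<ge> 0" "\<And>n t. norm (u n t) \<le> C * (1 / \<sigma> n) ^ a * wt t ^ K * exp (c * t\<^sup>2)"
    unfolding symbol.simps wbounded_def by blast
  define J where "J = (LINT t|lborel. wt t ^ K * exp (c * t\<^sup>2))"
  have "norm (fourier (u n) x) \<le> (C * J) * (1 / \<sigma> n) ^ a" for n x
  proof -
    have "norm (fourier (u n) x) \<le> (LINT t|lborel. norm (u n t))" by (rule norm_fourier_le)
    also have "\<dots> \<le> (LINT t|lborel. C * (1 / \<sigma> n) ^ a * (wt t ^ K * exp (c * t\<^sup>2)))"
    proof (rule integral_mono)
      show "integrable lborel (\<lambda>t. norm (u n t))"
        using integrable_gauss_bounded[OF wbounded_gauss_bounded[OF symbol_wbounded[OF 0] pos] c] by simp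
      show "integrable lborel (\<lambda>t. C * (1 / \<sigma> n) ^ a * (wt t ^ K * exp (c * t\<^sup>2)))"
        by (intro integrable_mult_right integrable_poly_gauss c)
    qed (use C(2) in \<open>simp add: mult_ac\<close>)
    also have "\<dots> = (C * J) * (1 / \<sigma> n) ^ a"
      unfolding J_def by (subst integral_mult_right_zero) (simp only: mult_ac)
    finally show ?thesis .
  qed
  moreover have "C * J \<ge> 0" using C(1) by (auto simp: J_def intro!: mult_nonneg_nonneg)
  ultimately show ?case by auto
next
  case (Suc k)
  then obtain u' where u': "\<And>n t. (u n has_vector_derivative u' n t) (at t)" "symbol \<sigma> (\<lambda>n. UNIV) k a c u'"
    by auto
  have F: "norm (fourier (u' n) x) = \<bar>x\<bar> * norm (fourier (u n) x)" for n x
    using fourier_deriv[OF wbounded_gauss_bounded[OF symbol_wbounded[OF Suc.prems] pos] wbounded_gauss_bounded[OF symbol_wbounded[OF u'(2)] pos] c u'(1)]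
    by (simp add: norm_mult)
  show ?case using Suc.IH[OF u'(2)] unfolding F by (simp add: mult_ac)
qed

lemma fourier_gauss: "fourier (\<lambda>t. of_real (gexp t)) x = of_real (sqrt (2 * pi) * gexp x)"
proof -
  have "char \<N> (- x) = (LINT t|lborel. std_normal_density t *\<^sub>R iexp (- x * t))"
    unfolding char_def by (subst integral_density) (auto simp: normal_density_nonneg)
  also have "\<dots> = (LINT t|lborel. of_real (1 / sqrt (2 * pi)) * (iexp (- (t * x)) * of_real (gexp t)))"
    unfolding std_normal_density_def
    by (intro Bochner_Integration.integral_cong refl) (simp add: scaleR_conv_of_real mult_ac)
  also have "\<dots> = of_real (1 / sqrt (2 * pi)) * fourier (\<lambda>t. of_real (gexp t)) x"
    unfolding fourier_def by simp
  finally have "of_real (1 / sqrt (2 * pi)) * fourier (\<lambda>t. of_real (gexp t)) x = of_real (gexp x)"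
    by (simp add: char_std_normal_distribution)
  then show ?thesis by (simp add: field_simps)
qed

lemma gauss_bounded_monom: "gauss_bounded (-1/2) (\<lambda>t. of_real t ^ k * of_real (gexp t))"
proof -
  have "\<bar>t\<bar> ^ k \<le> wt t ^ k" for t :: real by (intro power_mono) auto
  then have "norm (of_real t ^ k * of_real (gexp t) :: complex) \<le> 1 * wt t ^ k * exp (-1/2 * t\<^sup>2)" for t
    by (simp add: norm_mult norm_power)
  moreover have "continuous_on UNIV (\<lambda>t. of_real t ^ k * of_real (gexp t) :: complex)"
    by (intro continuous_intros) auto
  ultimately show ?thesis unfolding gauss_bounded_def by (intro conjI exI[of _ 1] exI[of _ k]) auto
qed

text \<open>The Hermite recurrence, obtained by transforming the derivative
  \<open>k t^(k-1) G - t^(k+1) G\<close> of \<open>t^k G\<close> with \<open>G = gexp\<close>. At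
  \<open>k = 0\<close> the truncated index is harmless since its factor is 0.\<close>

lemma fourier_monom_Suc:
  fixes x :: real
  defines "J \<equiv> \<lambda>k. fourier (\<lambda>t. of_real t ^ k * of_real (gexp t)) x"
  shows "J (Suc k) = of_nat k * J (k - 1) - \<i> * of_real x * J k"
proof -
  let ?m = "\<lambda>k t. of_real t ^ k * of_real (gexp t) :: complex"
  let ?m' = "\<lambda>t. of_nat k * ?m (k - 1) t + (-1) * ?m (Suc k) t"
  have int: "integrable lborel (?m j)" for j using integrable_gauss_bounded[OF gauss_bounded_monom] by simp
  have "gauss_bounded (-1/2) ?m'"
  proof -
    have "\<bar>t\<bar> ^ k \<le> wt t ^ Suc k" "\<bar>t\<bar> ^ (k - 1) \<le> wt t ^ Suc k" "\<bar>t\<bar> ^ Suc k \<le> wt t ^ Suc k" for t :: real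
      by (rule order_trans[OF power_mono power_increasing]; simp)+
    note * = this
    have "norm (?m' t) \<le> (of_nat k + 1) * wt t ^ Suc k * exp (-1/2 * t\<^sup>2)" for t
    proof -
      have "norm (?m' t) \<le> of_nat k * (\<bar>t\<bar> ^ (k - 1) * gexp t) + \<bar>t\<bar> ^ Suc k * gexp t"
        by (rule order_trans[OF norm_triangle_ineq]) (simp add: norm_mult norm_power)
      also have "\<dots> \<le> of_nat k * (wt t ^ Suc k * gexp t) + wt t ^ Suc k * gexp t"
        using * by (intro add_mono mult_left_mono mult_right_mono) auto
      finally show ?thesis by (simp add: algebra_simps)
    qed
    moreover have "continuous_on UNIV ?m'" by (intro continuous_intros) auto
    ultimately show ?thesis unfolding gauss_bounded_def by (intro conjI exI[of _ "of_nat k + 1"] exI[of _ "Suc k"]) auto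
  qed
  moreover have "(?m k has_vector_derivative ?m' t) (at t)" for t
  proof -
    have 1: "((\<lambda>t. of_real t ^ k :: complex) has_vector_derivative of_nat k * of_real t ^ (k - 1)) (at t)"
      using DERIV_power[OF DERIV_ident, where n = k] by (intro has_vector_derivative_real_field) simp
    have 2: "((\<lambda>t. of_real (gexp t) :: complex) has_vector_derivative of_real (- t * gexp t)) (at t)"
      by (intro has_vector_derivative_of_real) (auto intro!: derivative_eq_intros simp flip: has_real_derivative_iff_has_vector_derivative)
    show ?thesis
      using has_vector_derivative_mult[OF 1 2] by (simp add: algebra_simps)
  qed
  ultimately have "fourier ?m' x = \<i> * of_real x * J k"
    unfolding J_def by (intro fourier_deriv[OF gauss_bounded_monom]) auto
  moreover have "fourier ?m' x = fourier (\<lambda>t. of_nat k * ?m (k - 1) t) x + fourier (\<lambda>t. (-1) * ?m (Suc k) t) x"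
    by (intro fourier_add integrable_mult_right int)
  then have "fourier ?m' x = of_nat k * J (k - 1) + (-1) * J (Suc k)"
    unfolding fourier_cmult J_def .
  ultimately show ?thesis by (simp add: algebra_simps)
qed

text \<open>The recurrence reaches back two steps, hence the strong induction. What matters is that
  the full factor \<open>gexp x\<close> is kept and not merely polynomial decay: it makes such
  corrections small relative to the normal density.\<close>

lemma fourier_monom_bound:
  "\<exists>C\<ge>0. \<forall>x. norm (fourier (\<lambda>t. of_real t ^ k * of_real (gexp t)) x) \<le> C * wt x ^ k * gexp x"
proof (induction k rule: less_induct)
  case (less k)
  let ?J = "\<lambda>k x. fourier (\<lambda>t. of_real t ^ k * of_real (gexp t)) x"
  show ?case
  proof (cases k)
    case 0
    then show ?thesis using fourier_gauss by (intro exI[of _ "sqrt (2 * pi)"]) (simp add: norm_mult)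
  next
    case (Suc j)
    obtain C where C: "C \<ge> 0" "\<And>x. norm (?J j x) \<le> C * wt x ^ j * gexp x"
      using less.IH[of j] Suc by auto
    obtain D where D: "D \<ge> 0" "\<And>x. norm (?J (j - 1) x) \<le> D * wt x ^ (j - 1) * gexp x"
      using less.IH[of "j - 1"] unfolding Suc less_Suc_eq_le by (meson diff_le_self)
    have "norm (?J k x) \<le> (of_nat j * D + C) * wt x ^ k * gexp x" for x
    proof -
      have "norm (?J k x) \<le> of_nat j * norm (?J (j - 1) x) + \<bar>x\<bar> * norm (?J j x)"
        unfolding Suc fourier_monom_Suc by (rule order_trans[OF norm_triangle_ineq4]) (simp add: norm_mult)
      also have "\<dots> \<le> of_nat j * (D * wt x ^ (j - 1) * gexp x) + wt x * (C * wt x ^ j * gexp x)"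
        using C D by (intro add_mono mult_mono) auto
      also have "\<dots> \<le> of_nat j * (D * wt x ^ k * gexp x) + wt x * (C * wt x ^ j * gexp x)"
        using D(1) Suc by (intro add_mono mult_left_mono mult_right_mono power_increasing) auto
      finally show ?thesis by (simp add: Suc algebra_simps)
    qed
    moreover have "of_nat j * D + C \<ge> 0" using C D by simp
    ultimately show ?thesis by blast
  qed
qed

text \<open>Only the coefficients depend on \<open>n\<close>, so the constants of finitely many
  fixed monomials give a bound uniform in \<open>n\<close>.\<close>

lemma fourier_poly_family:
  assumes pos: "\<And>n. \<sigma> n > 0" and "poly_family \<sigma> a u"
  shows "(\<forall>n. integrable lborel (\<lambda>t. u n t * of_real (gexp t))) \<and>
    (\<exists>C\<ge>0. \<exists>K. \<forall>n x. norm (fourier (\<lambda>t. u n t * of_real (gexp t)) x) \<le>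
      C * (1 / \<sigma> n) ^ a * wt x ^ K * gexp x)"
  using assms(2)
proof (induction rule: poly_family.induct)
  case (monom C d i)
  obtain D where D: "D \<ge> 0" "\<And>x. norm (fourier (\<lambda>t. of_real t ^ i * of_real (gexp t)) x) \<le> D * wt x ^ i * gexp x"
    using fourier_monom_bound by blast
  have "norm (fourier (\<lambda>t. d n * of_real t ^ i * of_real (gexp t)) x) \<le> (C * D) * (1 / \<sigma> n) ^ a * wt x ^ i * gexp x" for n x
  proof -
    have "norm (fourier (\<lambda>t. d n * of_real t ^ i * of_real (gexp t)) x) = norm (d n) * norm (fourier (\<lambda>t. of_real t ^ i * of_real (gexp t)) x)"
      unfolding mult.assoc fourier_cmult norm_mult ..
    also have "\<dots> \<le> (C * (1 / \<sigma> n) ^ a) * (D * wt x ^ i * gexp x)"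
      using monom pos[of n] D by (intro mult_mono) auto
    finally show ?thesis by (simp add: mult_ac)
  qed
  moreover have "integrable lborel (\<lambda>t. d n * of_real t ^ i * of_real (gexp t))" for n
    using integrable_gauss_bounded[OF gauss_bounded_monom[of i]] by (simp add: mult.assoc)
  moreover have "C * D \<ge> 0" using monom D by simp
  ultimately show ?case by blast
next
  case (add u v)
  obtain C K where C: "C \<ge> 0" "\<And>n x. norm (fourier (\<lambda>t. u n t * of_real (gexp t)) x) \<le> C * (1 / \<sigma> n) ^ a * wt x ^ K * gexp x"
    using add.IH(1) by blast
  obtain D L where D: "D \<ge> 0" "\<And>n x. norm (fourier (\<lambda>t. v n t * of_real (gexp t)) x) \<le> D * (1 / \<sigma> n) ^ a * wt x ^ L * gexp x"
    using add.IH(2) by blast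
  have int: "integrable lborel (\<lambda>t. u n t * of_real (gexp t))" "integrable lborel (\<lambda>t. v n t * of_real (gexp t))" for n
    using add.IH by auto
  have "norm (fourier (\<lambda>t. (u n t + v n t) * of_real (gexp t)) x) \<le> (C + D) * (1 / \<sigma> n) ^ a * wt x ^ max K L * gexp x" for n x
  proof -
    have "norm (fourier (\<lambda>t. (u n t + v n t) * of_real (gexp t)) x) \<le> C * (1 / \<sigma> n) ^ a * wt x ^ K * gexp x + D * (1 / \<sigma> n) ^ a * wt x ^ L * gexp x"
      unfolding distrib_right fourier_add[OF int] by (intro order_trans[OF norm_triangle_ineq] add_mono C D)
    also have "\<dots> \<le> C * (1 / \<sigma> n) ^ a * wt x ^ max K L * gexp x + D * (1 / \<sigma> n) ^ a * wt x ^ max K L * gexp x"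
      using C(1) D(1) pos[of n] by (intro add_mono mult_right_mono mult_left_mono power_increasing) auto
    finally show ?thesis by (simp add: algebra_simps)
  qed
  moreover have "integrable lborel (\<lambda>t. (u n t + v n t) * of_real (gexp t))" for n
    unfolding distrib_right using int by simp
  moreover have "C + D \<ge> 0" using C D by simp
  ultimately show ?case by blast
qed

section \<open>Inversion: integrable characteristic functions and continuous densities\<close>

lemma integrable_indicator_Icc: "integrable lborel (indicat_real {a..b})" for a b :: real
  by (intro integrable_real_indicator) (auto simp: emeasure_lborel_Icc_eq)

lemma continuous_fourier:
  assumes "integrable lborel v"
  shows "continuous_on UNIV (fourier v)"
proof -
  have [measurable]: "v \<in> borel_measurable borel" using assms by auto
  have "isCont (fourier v) x" for x
    unfolding continuous_at_sequentially
  proof safe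
    fix X assume X: "X \<longlonglongrightarrow> x"
    show "(fourier v \<circ> X) \<longlonglongrightarrow> fourier v x"
      unfolding comp_def fourier_def
      by (rule integral_dominated_convergence[where w="\<lambda>t. norm (v t)"])
        (use assms in \<open>auto intro!: tendsto_intros X AE_I2 simp: norm_mult simp del: of_real_mult of_real_minus\<close>)
  qed
  then show ?thesis by (simp add: continuous_on_eq_continuous_at)
qed

text \<open>The right-hand side is the kernel of Levy's inversion formula; in the form of an
  integral over \<open>{a..b}\<close> it lends itself to Fubini.\<close>

lemma iexp_diff_quotient:
  assumes "a \<le> b" "t \<noteq> 0"
  shows "(LINT y|lborel. indicator {a..b} y *\<^sub>R iexp (- (t * y))) = (iexp (- (t * a)) - iexp (- (t * b))) / (\<i> * of_real t)"
proof -
  have "(LINT y|lborel. indicator {a..b} y *\<^sub>R iexp (- (t * y))) = (- iexp (- (t * b)) / (\<i> * of_real t)) - (- iexp (- (t * a)) / (\<i> * of_real t))"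
  proof (rule integral_FTC_Icc[OF assms(1), unfolded set_lebesgue_integral_def])
    fix y
    show "((\<lambda>y. - iexp (- (t * y)) / (\<i> * of_real t)) has_vector_derivative iexp (- (t * y))) (at y within {a..b})"
      using assms(2) by (auto intro!: derivative_eq_intros has_vector_derivative_real_field simp: field_simps)
  qed (intro continuous_intros)
  then show ?thesis by (simp add: diff_divide_distrib)
qed

context real_distribution
begin

text \<open>Levy's formula is a limit of integrals over \<open>[-T, T]\<close>, valid when the end
  points are no atoms. Integrability of the characteristic function turns the limit into an integral
  over the line, and Fubini then moves the integral over \<open>{a..b}\<close> to the
  outside.\<close>

lemma inversion_no_atoms:
  assumes int: "integrable lborel (char M)" and ab: "a \<le> b" "measure M {a} = 0" "measure M {b} = 0"
  shows "complex_of_real (measure M {a<..b}) = (LINT y|lborel. indicator {a..b} y *\<^sub>R (1 / (2 * pi) * fourier (char M) y))"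
proof -
  let ?F = "\<lambda>t. (iexp (- (t * a)) - iexp (- (t * b))) / (\<i> * of_real t)"
  define G where "G t = (LINT y|lborel. indicator {a..b} y *\<^sub>R iexp (- (t * y)))" for t
  have meas[measurable]: "char M \<in> borel_measurable borel" by simp
  have prod: "integrable (lborel \<Otimes>\<^sub>M lborel) (\<lambda>(y, t). indicator {a..b} y *\<^sub>R (iexp (- (t * y)) * char M t))"
  proof (rule lborel_pair.Fubini_integrable)
    show "(\<lambda>(y, t). indicator {a..b} y *\<^sub>R (iexp (- (t * y)) * char M t)) \<in> borel_measurable (lborel \<Otimes>\<^sub>M lborel)"
      by measurable
    have "integrable lborel (\<lambda>y. (LINT t|lborel. norm (char M t)) * indicator {a..b} y :: real)"
      by (intro integrable_mult_right integrable_indicator_Icc)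
    then show "integrable lborel (\<lambda>y. LINT t|lborel. norm (case (y, t) of (y, t) \<Rightarrow> indicator {a..b} y *\<^sub>R (iexp (- (t * y)) * char M t)))"
      by (simp add: norm_mult mult.commute del: of_real_mult of_real_minus)
    show "AE y in lborel. integrable lborel (\<lambda>t. case (y, t) of (y, t) \<Rightarrow> indicator {a..b} y *\<^sub>R (iexp (- (t * y)) * char M t))"
      using fourier_integrable[OF int] by (intro AE_I2) simp
  qed
  have fub: "(LINT t|lborel. G t * char M t) = (LINT y|lborel. indicator {a..b} y *\<^sub>R fourier (char M) y)"
  proof -
    have "(LINT t|lborel. G t * char M t) = (LINT t|lborel. LINT y|lborel. indicator {a..b} y *\<^sub>R (iexp (- (t * y)) * char M t))"
      unfolding G_def by (simp flip: integral_mult_left_zero)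
    also have "\<dots> = (LINT y|lborel. LINT t|lborel. indicator {a..b} y *\<^sub>R (iexp (- (t * y)) * char M t))"
      by (rule lborel_pair.Fubini_integral[OF prod])
    finally show ?thesis unfolding fourier_def by simp
  qed
  have normG: "norm (G t) \<le> b - a" for t
  proof -
    have "norm (G t) \<le> (LINT y|lborel. norm (indicator {a..b} y *\<^sub>R iexp (- (t * y))))"
      unfolding G_def by (rule integral_norm_bound)
    also have "\<dots> = b - a" using ab(1) by (simp del: of_real_mult of_real_minus)
    finally show ?thesis .
  qed
  have measG[measurable]: "G \<in> borel_measurable borel" unfolding G_def by measurable
  have intG: "integrable lborel (\<lambda>t. G t * char M t)"
  proof (rule Bochner_Integration.integrable_bound)
    show "integrable lborel (\<lambda>t. (b - a) * norm (char M t))" using int by simp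
    show "AE t in lborel. norm (G t * char M t) \<le> norm ((b - a) * norm (char M t))"
      using normG ab(1) by (intro AE_I2) (auto simp: norm_mult abs_mult intro!: mult_right_mono)
  qed simp
  have "(\<lambda>T. LINT t|lborel. indicator {- real T..real T} t *\<^sub>R (G t * char M t)) \<longlonglongrightarrow> (LINT t|lborel. G t * char M t)"
  proof (rule integral_dominated_convergence[where w = "\<lambda>t. norm (G t * char M t)"])
    show "AE t in lborel. (\<lambda>T. indicator {- real T..real T} t *\<^sub>R (G t * char M t)) \<longlonglongrightarrow> G t * char M t"
    proof (rule AE_I2)
      fix t :: real
      have "\<forall>\<^sub>F T in sequentially. indicator {- real T..real T} t *\<^sub>R (G t * char M t) = G t * char M t"
        using eventually_ge_at_top[of "nat \<lceil>\<bar>t\<bar>\<rceil>"] by eventually_elim (auto simp: indicator_def; linarith)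
      then show "(\<lambda>T. indicator {- real T..real T} t *\<^sub>R (G t * char M t)) \<longlonglongrightarrow> G t * char M t"
        by (rule tendsto_eventually)
    qed
  qed (use intG in \<open>auto simp: indicator_def\<close>)
  moreover have "(CLBINT t=-T..T. ?F t * char M t) = (LINT t|lborel. indicator {- real T..real T} t *\<^sub>R (G t * char M t))" for T :: nat
  proof -
    have "(CLBINT t=-T..T. ?F t * char M t) = (LINT t|lborel. indicator {- real T..real T} t *\<^sub>R (?F t * char M t))"
      using interval_integral_Icc[of "- real T" "real T" "\<lambda>t. ?F t * char M t"] by (simp add: set_lebesgue_integral_def)
    \<comment> \<open>The integrands may differ only at \<open>t = 0\<close>, where the quotient
      degenerates.\<close>
    also have "\<dots> = (LINT t|lborel. indicator {- real T..real T} t *\<^sub>R (G t * char M t))"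
      using iexp_diff_quotient[OF ab(1)] by (intro integral_cong_AE) (auto intro!: AE_I[of _ _ "{0}"] simp: G_def)
    finally show ?thesis .
  qed
  ultimately have "(\<lambda>T. 1 / (2 * pi) * (CLBINT t=-T..T. ?F t * char M t)) \<longlonglongrightarrow> 1 / (2 * pi) * (LINT t|lborel. G t * char M t)"
    by (intro tendsto_mult tendsto_const) simp
  from LIMSEQ_unique[OF this] Levy_Inversion[OF ab]
  have "complex_of_real (measure M {a<..b}) = 1 / (2 * pi) * (LINT t|lborel. G t * char M t)" by simp
  also have "\<dots> = (LINT y|lborel. (1 / (2 * pi)) * (indicator {a..b} y *\<^sub>R fourier (char M) y))"
    unfolding fub by (rule integral_mult_right_zero[symmetric])
  also have "\<dots> = (LINT y|lborel. indicator {a..b} y *\<^sub>R (1 / (2 * pi) * fourier (char M) y))"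
    by (intro Bochner_Integration.integral_cong refl) (simp add: scaleR_conv_of_real)
  finally show ?thesis .
qed

text \<open>Atoms are countable, so \<open>x\<close> lies in arbitrarily short intervals whose end
  points carry no mass; by inversion the mass of such an interval is at most a fixed multiple of its
  length.\<close>

lemma atom_free:
  assumes int: "integrable lborel (char M)"
  shows "measure M {x} = 0"
proof -
  define D where "D = (LINT t|lborel. norm (char M t))"
  have D: "D \<ge> 0" unfolding D_def by simp
  have count: "countable {x. measure M {x} \<noteq> 0}" by (rule countable_support)
  have "measure M {x} \<le> e" if e: "e > 0" for e
  proof -
    define h where "h = e / (D + 1)"
    have h: "h > 0" using e D by (simp add: h_def)
    obtain a where a: "measure M {a} = 0" "x - h < a" "a < x"
      using open_minus_countable[OF count, of "{x - h<..<x}"] h by auto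
    obtain b where b: "measure M {b} = 0" "x < b" "b < x + h"
      using open_minus_countable[OF count, of "{x<..<x + h}"] h by auto
    have "measure M {x} \<le> measure M {a<..b}" using a b by (intro finite_measure_mono) auto
    also have "\<dots> = norm (LINT y|lborel. indicator {a..b} y *\<^sub>R (1 / (2 * pi) * fourier (char M) y))"
      using inversion_no_atoms[OF int _ a(1) b(1)] a(3) b(2) by (metis less_imp_le less_trans measure_nonneg norm_of_real abs_of_nonneg)
    also have "\<dots> \<le> (LINT y|lborel. norm (indicator {a..b} y *\<^sub>R (1 / (2 * pi) * fourier (char M) y)))"
      by (rule integral_norm_bound)
    also have "\<dots> \<le> (LINT y|lborel. (1 / (2 * pi) * D) * indicator {a..b} y)"
    proof (rule integral_mono)
      show "integrable lborel (\<lambda>y. norm (indicator {a..b} y *\<^sub>R (1 / (2 * pi) * fourier (char M) y)))"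
        by (intro integrable_norm borel_integrable_compact[unfolded set_integrable_def] continuous_intros continuous_on_subset[OF continuous_fourier[OF int]]) auto
      fix y
      show "norm (indicator {a..b} y *\<^sub>R (1 / (2 * pi) * fourier (char M) y)) \<le> (1 / (2 * pi) * D) * indicator {a..b} y"
        using norm_fourier_le[of "char M" y] by (auto simp: indicator_def norm_mult norm_divide D_def field_simps)
    qed (intro integrable_mult_right integrable_indicator_Icc)
    also have "\<dots> = (1 / (2 * pi) * D) * (b - a)" using a b by simp
    also have "\<dots> \<le> (1 / (2 * pi) * D) * (2 * h)" using a b D by (intro mult_left_mono) auto
    also have "\<dots> \<le> D * h"
      using mult_left_mono[of h "pi * h" D] D h pi_gt3 by (simp add: field_simps)
    also have "\<dots> \<le> e" using D e by (simp add: h_def field_simps)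
    finally show ?thesis .
  qed
  then have "measure M {x} \<le> 0" by (meson dense_ge)
  then show ?thesis using measure_nonneg[of M "{x}"] by linarith
qed

text \<open>Having a continuous version of the density matters later, where an almost everywhere
  statement about it has to hold at every point.\<close>

theorem density_char_inversion:
  assumes int: "integrable lborel (char M)"
  defines "f \<equiv> \<lambda>y. Re (1 / (2 * pi) * fourier (char M) y)"
  shows "M = density lborel f" and "f y \<ge> 0" and "continuous_on UNIV f"
proof -
  show cont: "continuous_on UNIV f"
    unfolding f_def by (intro continuous_intros continuous_fourier int)
  have eq: "measure M {a<..b} = (LINT y|lborel. indicator {a..b} y * f y)" if "a \<le> b" for a b
  proof -
    have i: "integrable lborel (\<lambda>y. indicator {a..b} y *\<^sub>R (1 / (2 * pi) * fourier (char M) y))"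
      by (intro borel_integrable_compact[unfolded set_integrable_def] continuous_intros continuous_on_subset[OF continuous_fourier[OF int]]) auto
    have "measure M {a<..b} = Re (LINT y|lborel. indicator {a..b} y *\<^sub>R (1 / (2 * pi) * fourier (char M) y))"
      using inversion_no_atoms[OF int that atom_free[OF int] atom_free[OF int]] by (metis Re_complex_of_real)
    then show ?thesis unfolding f_def integral_Re[OF i, symmetric] by (simp add: scaleR_conv_of_real)
  qed
  have ifi: "integrable lborel (\<lambda>y. indicator {a..b} y * f y)" for a b
    using borel_integrable_compact[of "{a..b}" f] continuous_on_subset[OF cont] by (simp add: set_integrable_def)
  \<comment> \<open>By continuity a negative value would persist on an interval, which would then
    have negative mass.\<close>
  show nonneg: "f y \<ge> 0" for y
  proof (rule ccontr)
    assume "\<not> f y \<ge> 0"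
    then have neg: "f y < 0" by simp
    have "open {z. f z < f y / 2}" by (intro open_Collect_less cont continuous_intros)
    moreover have "y \<in> {z. f z < f y / 2}" using neg by simp
    ultimately obtain e where e: "e > 0" "cball y e \<subseteq> {z. f z < f y / 2}"
      by (meson open_contains_cball)
    have "measure M {y<..y + e} = (LINT z|lborel. indicator {y..y + e} z * f z)" using e by (intro eq) auto
    also have "\<dots> \<le> (LINT z|lborel. (f y / 2) * indicator {y..y + e} z)"
    proof (rule integral_mono[OF ifi])
      fix z show "indicator {y..y + e} z * f z \<le> (f y / 2) * indicator {y..y + e} z"
        using subsetD[OF e(2), of z] by (auto simp: indicator_def dist_real_def)
    qed (intro integrable_mult_right integrable_indicator_Icc)
    also have "\<dots> = (f y / 2) * e" using e by simp
    also have "\<dots> < 0" using neg e by (simp add: mult_neg_pos)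
    finally show False using measure_nonneg[of M] by (meson not_le)
  qed
  have [measurable]: "f \<in> borel_measurable borel" using cont by (rule borel_measurable_continuous_onI)
  \<comment> \<open>Half-lines determine the measure and are increasing unions of bounded intervals,
    to which the inversion formula applies.\<close>
  show "M = density lborel f"
  proof (rule measure_eqI_lessThan)
    fix x
    have 1: "emeasure M {x<..x + real n} = emeasure (density lborel f) {x<..x + real n}" for n
    proof -
      have "emeasure (density lborel f) {x<..x + real n} = (\<integral>\<^sup>+y. ennreal (f y) * indicator {x<..x + real n} y \<partial>lborel)"
        by (subst emeasure_density) auto
      also have "\<dots> = (\<integral>\<^sup>+y. ennreal (indicator {x..x + real n} y * f y) \<partial>lborel)"
        by (intro nn_integral_cong_AE AE_I[of _ _ "{x}"]) (auto simp: indicator_def split: if_splits)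
      also have "\<dots> = ennreal (LINT y|lborel. indicator {x..x + real n} y * f y)"
        using nonneg by (intro nn_integral_eq_integral ifi AE_I2) auto
      finally show ?thesis using eq[of x "x + real n"] by (simp add: emeasure_eq_measure)
    qed
    have 2: "(\<Union>n::nat. {x<..x + real n}) = {x<..}"
    proof (auto, goal_cases)
      case (1 y)
      then show ?case using real_arch_simple[of "y - x"] by (auto simp: algebra_simps)
    qed
    have 3: "incseq (\<lambda>n::nat. {x<..x + real n})" by (auto simp: incseq_def)
    have "emeasure M {x<..} = (SUP n. emeasure M {x<..x + real n})"
      using SUP_emeasure_incseq[of "\<lambda>n::nat. {x<..x + real n}" M] 2 3 by (simp add: image_subset_iff)
    also have "\<dots> = emeasure (density lborel f) {x<..}"
      unfolding 1 using SUP_emeasure_incseq[of "\<lambda>n::nat. {x<..x + real n}" "density lborel f"] 2 3 by (simp add: image_subset_iff)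
    finally show "emeasure M {x<..} = emeasure (density lborel f) {x<..}" .
    show "emeasure M {x<..} < \<infinity>" by (simp add: emeasure_eq_measure)
  qed auto
qed

end

section \<open>A band-limited smoothing law\<close>

lemma char_pair_add:
  assumes "prob_space M" "prob_space N" and [measurable]: "X \<in> borel_measurable M" "Y \<in> borel_measurable N"
  shows "char (distr (M \<Otimes>\<^sub>M N) borel (\<lambda>z. X (fst z) + Y (snd z))) t = char (distr M borel X) t * char (distr N borel Y) t"
proof -
  interpret M: prob_space M by fact
  interpret N: prob_space N by fact
  interpret pair_prob_space M N ..
  have int: "integrable (M \<Otimes>\<^sub>M N) (\<lambda>z. iexp (t * (X (fst z) + Y (snd z))))"
    by (rule integrable_iexp) auto
  have "char (distr (M \<Otimes>\<^sub>M N) borel (\<lambda>z. X (fst z) + Y (snd z))) t = (LINT z|(M \<Otimes>\<^sub>M N). iexp (t * (X (fst z) + Y (snd z))))"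
    unfolding char_def by (subst integral_distr) auto
  also have "\<dots> = (LINT x|M. LINT y|N. iexp (t * (X x + Y y)))"
    using integral_fst'[OF int] by simp
  also have "\<dots> = (LINT x|M. LINT y|N. iexp (t * X x) * iexp (t * Y y))"
    by (simp add: exp_add distrib_left)
  also have "\<dots> = (LINT x|M. iexp (t * X x)) * (LINT y|N. iexp (t * Y y))"
    by simp
  also have "\<dots> = char (distr M borel X) t * char (distr N borel Y) t"
    unfolding char_def by (simp add: integral_distr)
  finally show ?thesis .
qed

lemma uniform_law:
  defines "U \<equiv> density lborel (\<lambda>x::real. ennreal (indicator {-1..1} x / 2))"
  shows "real_distribution U" and "AE x in U. \<bar>x\<bar> \<le> 1" and "char U t = of_real (sinc t)"
proof -
  have "emeasure U UNIV = (\<integral>\<^sup>+x. ennreal (indicator {-1..1::real} x / 2) \<partial>lborel)"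
    unfolding U_def by (subst emeasure_density) auto
  also have "\<dots> = ennreal (integral\<^sup>L lborel (\<lambda>x::real. indicator {-1..1} x / 2))"
    using integrable_indicator_Icc[of "-1" 1] by (intro nn_integral_eq_integral) auto
  finally have "emeasure U UNIV = 1" by simp
  then have "prob_space U" by (intro prob_spaceI) (simp add: U_def)
  then show "real_distribution U" unfolding real_distribution_def real_distribution_axioms_def U_def by simp
  show "AE x in U. \<bar>x\<bar> \<le> 1"
    unfolding U_def by (subst AE_density) (auto simp: indicator_def)
  have eq: "(1 / 2) * (LINT y|lborel. indicator {-1..1} y *\<^sub>R iexp (- (- t * y))) = char U t"
  proof -
    have "char U t = (LINT x|lborel. (indicator {-1..1} x / 2) *\<^sub>R iexp (t * x))"
      unfolding char_def U_def by (subst integral_density) auto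
    also have "\<dots> = (LINT x|lborel. (1/2) * (indicator {-1..1} x *\<^sub>R iexp (- (- t * x))))"
      by (intro Bochner_Integration.integral_cong refl) (simp add: scaleR_conv_of_real)
    also have "\<dots> = (1/2) * (LINT x|lborel. indicator {-1..1} x *\<^sub>R iexp (- (- t * x)))"
      by (rule integral_mult_right_zero)
    finally show ?thesis ..
  qed
  show "char U t = of_real (sinc t)"
  proof (cases "t = 0")
    case True
    then show ?thesis using real_distribution.char_zero[OF \<open>real_distribution U\<close>] by simp
  next
    case False
    have euler: "iexp (- t) = of_real (cos t) - \<i> * of_real (sin t)" "iexp t = of_real (cos t) + \<i> * of_real (sin t)"
      by (simp_all add: complex_eq_iff Re_exp Im_exp)
    have "(iexp (- t) - iexp t) / (\<i> * of_real (- t)) = 2 * of_real (sin t / t)"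
      unfolding euler using False by (simp add: field_simps)
    moreover have "(LINT y|lborel. indicator {-1..1} y *\<^sub>R iexp (- (- t * y))) = (iexp (- t) - iexp t) / (\<i> * of_real (- t))"
      using iexp_diff_quotient[of "-1" 1 "-t"] False by simp
    ultimately show ?thesis
      unfolding eq[symmetric] using False by simp
  qed
qed

text \<open>This is the law of a sum of \<open>n\<close> independent uniform variables on
  \<open>[-1, 1]\<close>: characteristic functions multiply and ranges add.\<close>

lemma sinc_power_law:
  "\<exists>\<nu>. real_distribution \<nu> \<and> (\<forall>t. char \<nu> t = of_real (sinc t ^ n)) \<and> (AE x in \<nu>. \<bar>x\<bar> \<le> real n)"
proof (induction n)
  case 0
  have "real_distribution (return borel 0)"
    unfolding real_distribution_def real_distribution_axioms_def by (simp add: prob_space_return)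
  moreover have "char (return borel 0) t = 1" for t
    unfolding char_def by (subst integral_return) auto
  moreover have "AE x in return borel (0::real). \<bar>x\<bar> \<le> 0" by (subst AE_return) auto
  ultimately show ?case by (intro exI[of _ "return borel 0"]) auto
next
  case (Suc n)
  then obtain \<nu> where \<nu>: "real_distribution \<nu>" "\<And>t. char \<nu> t = of_real (sinc t ^ n)" "AE x in \<nu>. \<bar>x\<bar> \<le> real n"
    by blast
  define U where "U = density lborel (\<lambda>x::real. ennreal (indicator {-1..1} x / 2))"
  note U = uniform_law[folded U_def]
  interpret N: real_distribution \<nu> by fact
  interpret U: real_distribution U by fact
  interpret pair_prob_space \<nu> U ..
  define \<mu> where "\<mu> = distr (\<nu> \<Otimes>\<^sub>M U) borel (\<lambda>z. fst z + snd z)"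
  have [measurable_cong]: "sets \<nu> = sets borel" "sets U = sets borel" by auto
  have "prob_space \<mu>" unfolding \<mu>_def by (intro prob_space_distr) measurable
  then have "real_distribution \<mu>"
    unfolding real_distribution_def real_distribution_axioms_def by (simp add: \<mu>_def)
  moreover have "char \<mu> t = of_real (sinc t ^ Suc n)" for t
  proof -
    have "char \<mu> t = char (distr \<nu> borel (\<lambda>x. x)) t * char (distr U borel (\<lambda>x. x)) t"
      unfolding \<mu>_def by (intro char_pair_add N.prob_space_axioms U.prob_space_axioms) measurable
    moreover have "distr \<nu> borel (\<lambda>x. x) = \<nu>" "distr U borel (\<lambda>x. x) = U"
      by (auto intro!: distr_id2)
    ultimately show ?thesis using \<nu>(2) U(3) by (simp add: mult.commute)
  qed
  moreover have "AE x in \<mu>. \<bar>x\<bar> \<le> real (Suc n)"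
  proof -
    have "AE z in \<nu> \<Otimes>\<^sub>M U. \<bar>fst z + snd z\<bar> \<le> real (Suc n)"
    proof (rule AE_pair_measure)
      show "AE x in \<nu>. AE y in U. \<bar>fst (x, y) + snd (x, y)\<bar> \<le> real (Suc n)"
        using \<nu>(3)
      proof eventually_elim
        case (elim x)
        show ?case using U(2) by eventually_elim (use elim in auto)
      qed
    qed measurable
    then show ?thesis unfolding \<mu>_def by (subst AE_distr_iff) auto
  qed
  ultimately show ?case by blast
qed

lemma sinc_abs_le_1: "\<bar>sinc x\<bar> \<le> 1"
  using abs_sin_x_le_abs_x[of x] by (auto simp: field_simps)

lemma sinc_times_le_1: "\<bar>x * sinc x\<bar> \<le> 1"
  by auto

text \<open>Both \<open>|sinc x|\<close> and \<open>|x sinc x|\<close> are at most 1, so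
  \<open>n\<close> factors can absorb up to \<open>n\<close> powers of \<open>|x|\<close>. Absorbing
  \<open>j\<close> and \<open>j + 2\<close> powers gives two bounds which add up to the majorant
  \<open>2 / (1 + x\<^sup>2)\<close>.\<close>

lemma sinc_power_moment:
  assumes "j + 2 \<le> n"
  shows "integrable lborel (\<lambda>x. \<bar>x\<bar> ^ j * sinc x ^ n)"
proof (rule Bochner_Integration.integrable_bound)
  show "integrable lborel (\<lambda>x::real. 2 * inverse (1 + x\<^sup>2))"
    using integrable_inverse_1_plus_square by (simp add: set_integrable_def)
  have *: "\<bar>x\<bar> ^ i * \<bar>sinc x\<bar> ^ n \<le> 1" if "i \<le> n" for i and x :: real
  proof -
    have "\<bar>x\<bar> ^ i * \<bar>sinc x\<bar> ^ n = \<bar>x * sinc x\<bar> ^ i * \<bar>sinc x\<bar> ^ (n - i)"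
      using that by (simp add: abs_mult power_mult_distrib flip: power_add)
    also have "\<dots> \<le> 1 * 1"
      using sinc_times_le_1[of x] sinc_abs_le_1[of x] by (intro mult_mono power_le_one zero_le_power) auto
    finally show ?thesis by simp
  qed
  show "AE x in lborel. norm (\<bar>x\<bar> ^ j * sinc x ^ n) \<le> norm (2 * inverse (1 + x\<^sup>2))"
  proof (rule AE_I2)
    fix x :: real
    define A where "A = \<bar>x\<bar> ^ j * \<bar>sinc x\<bar> ^ n"
    have "A \<le> 1" using *[of j x] assms unfolding A_def by linarith
    moreover have "\<bar>x\<bar> ^ (j + 2) = x\<^sup>2 * \<bar>x\<bar> ^ j" by (simp add: power_add power2_eq_square)
    then have "x\<^sup>2 * A \<le> 1" using *[of "j + 2" x] assms unfolding A_def by (simp only: mult.assoc)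
    ultimately have "A * (1 + x\<^sup>2) \<le> 2" by (simp add: algebra_simps)
    moreover have "1 + x\<^sup>2 > 0" by (simp add: add_pos_nonneg)
    ultimately have "A \<le> 2 / (1 + x\<^sup>2)" by (simp only: pos_le_divide_eq)
    moreover have "norm (\<bar>x\<bar> ^ j * sinc x ^ n) = A" unfolding A_def real_norm_def abs_mult power_abs abs_idempotent ..
    ultimately show "norm (\<bar>x\<bar> ^ j * sinc x ^ n) \<le> norm (2 * inverse (1 + x\<^sup>2))"
      by (simp add: divide_inverse)
  qed
qed measurable

text \<open>
  \<open>sinc\<^sup>N\<close> is the characteristic function of a law on \<open>[-N, N]\<close>, so by inversion the law with
  density proportional to \<open>sinc\<^sup>N\<close> has a characteristic function vanishing outside \<open>[-N, N]\<close>.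
\<close>

lemma band_limited_law:
  fixes k :: nat
  shows "\<exists>\<zeta> R. real_distribution \<zeta> \<and> R > 0 \<and> (\<forall>j\<le>k. integrable \<zeta> (\<lambda>x. \<bar>x\<bar> ^ j)) \<and>
     (\<forall>t. \<bar>t\<bar> > R \<longrightarrow> char \<zeta> t = 0)"
proof -
  \<comment> \<open>Even, so that \<open>sinc^N\<close> is nonnegative and can serve as a density;
    at least \<open>k + 2\<close>, so that moments up to order \<open>k\<close> are finite.\<close>
  define N where "N = 2 * (k + 1)"
  define h where "h x = sinc x ^ N" for x
  have hnn: "h x \<ge> 0" for x unfolding h_def N_def by (simp only: zero_le_even_power' power_mult power2_eq_square) (simp add: power_mult)
  have "0 + 2 \<le> N" by (simp add: N_def)
  from sinc_power_moment[OF this] have hint: "integrable lborel h" by (simp add: h_def[abs_def])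
  have [measurable]: "h \<in> borel_measurable borel" unfolding h_def by measurable
  obtain \<nu> where \<nu>: "real_distribution \<nu>" "\<And>t. char \<nu> t = of_real (h t)" "AE x in \<nu>. \<bar>x\<bar> \<le> real N"
    using sinc_power_law[of N] unfolding h_def by blast
  interpret N: real_distribution \<nu> by fact
  have ch: "char \<nu> = (\<lambda>t. of_real (h t))" using \<nu>(2) by auto
  have cint: "integrable lborel (char \<nu>)" unfolding ch using hint by simp
  define b where "b y = Re (1 / (2 * pi) * fourier (char \<nu>) y)" for y
  note inv = N.density_char_inversion[OF cint, folded b_def]
  have [measurable]: "b \<in> borel_measurable borel" using inv(3) by (rule borel_measurable_continuous_onI)
  \<comment> \<open>The law \<open>\<nu>\<close> lives on \<open>[-N, N]\<close>, so its density
    vanishes almost everywhere outside; continuity of \<open>b\<close> removes the exceptional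
    set.\<close>
  have b0: "b y = 0" if y: "\<bar>y\<bar> > real N" for y
  proof (rule ccontr)
    assume "b y \<noteq> 0"
    have op: "open {z. b z \<noteq> 0 \<and> real N < \<bar>z\<bar>}"
      by (intro open_Collect_conj open_Collect_neq open_Collect_less inv continuous_intros)
    obtain e where e: "e > 0" "cball y e \<subseteq> {z. b z \<noteq> 0 \<and> real N < \<bar>z\<bar>}"
      using op y \<open>b y \<noteq> 0\<close> unfolding open_contains_cball by blast
    have "AE x in density lborel b. \<bar>x\<bar> \<le> real N" by (subst inv(1)[symmetric]) (rule \<nu>(3))
    then have "AE x in lborel. 0 < ennreal (b x) \<longrightarrow> \<bar>x\<bar> \<le> real N" by (subst (asm) AE_density) auto
    then have "AE x in lborel. \<not> x \<in> {y..y + e}"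
    proof eventually_elim
      case (elim x)
      show ?case
      proof
        assume "x \<in> {y..y + e}"
        then have "x \<in> cball y e" by (auto simp: dist_real_def)
        then have "b x \<noteq> 0" "real N < \<bar>x\<bar>" using e(2) by auto
        then show False using elim inv(2)[of x] by (auto simp: less_le)
      qed
    qed
    then have "emeasure lborel {x\<in>space lborel. x \<in> {y..y + e}} = 0" by (rule emeasure_eq_0_AE)
    moreover have "{x\<in>space lborel. x \<in> {y..y + e}} = {y..y + e}" by auto
    ultimately show False using e(1) by simp
  qed
  \<comment> \<open>As \<open>h\<close> is even, the transform is real, so \<open>b\<close>, which
    was defined through the real part, determines it.\<close>
  have real: "fourier (char \<nu>) y = of_real (2 * pi * b y)" for y
  proof -
    have hneg: "h (- t) = h t" for t by (simp add: h_def)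
    have "cnj (fourier (char \<nu>) y) = (LINT t|lborel. cnj (iexp (- (t * y)) * of_real (h t)))"
      unfolding fourier_def ch by (rule Bochner_Integration.integral_cnj[symmetric])
    also have "\<dots> = (LINT t|lborel. iexp (t * y) * of_real (h t))"
      by (intro Bochner_Integration.integral_cong refl) (simp add: exp_cnj)
    also have "\<dots> = (LINT t|lborel. iexp (- (t * y)) * of_real (h t))"
      by (subst lborel_integral_real_affine[of "-1" _ 0]) (simp_all add: hneg)
    also have "\<dots> = fourier (char \<nu>) y" unfolding fourier_def ch ..
    finally have "Im (fourier (char \<nu>) y) = 0" by (simp add: complex_eq_iff)
    moreover have "Re (fourier (char \<nu>) y) = 2 * pi * b y"
    proof -
      have "Re (complex_of_real (1 / (2 * pi)) * z) = Re z / (2 * pi)" for z by simp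
      then have "b y = Re (fourier (char \<nu>) y) / (2 * pi)" unfolding b_def .
      then show ?thesis by (simp only: nonzero_eq_divide_eq) (simp add: field_simps)
    qed
    ultimately show ?thesis by (intro complex_eqI) (simp_all only: Re_complex_of_real Im_complex_of_real)
  qed
  define c where "c = (LINT x|lborel. h x)"
  \<comment> \<open>If \<open>h\<close> had integral 0, its transform would vanish, and with it the
    density \<open>b\<close> of the probability law \<open>\<nu>\<close>.\<close>
  have "c > 0"
  proof (rule ccontr)
    assume "\<not> c > 0"
    moreover have "(LINT t|lborel. norm (char \<nu> t)) = c" by (simp add: ch c_def hnn)
    ultimately have "norm (fourier (char \<nu>) y) \<le> 0" for y
      using norm_fourier_le[of "char \<nu>" y] by linarith
    then have "b y = 0" for y using real[of y] by auto
    moreover have "emeasure \<nu> UNIV = emeasure (density lborel (\<lambda>x. ennreal (b x))) UNIV"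
      by (rule arg_cong[OF inv(1)])
    ultimately have "emeasure \<nu> UNIV = 0" by (simp add: emeasure_density)
    then show False using N.emeasure_space_1 by simp
  qed
  define \<zeta> where "\<zeta> = density lborel (\<lambda>x. ennreal (h x / c))"
  have "emeasure \<zeta> UNIV = (\<integral>\<^sup>+x. ennreal (h x / c) \<partial>lborel)"
    unfolding \<zeta>_def by (subst emeasure_density) auto
  also have "\<dots> = ennreal (LINT x|lborel. h x / c)"
    using hint hnn \<open>c > 0\<close> by (intro nn_integral_eq_integral) auto
  finally have "emeasure \<zeta> UNIV = 1" using \<open>c > 0\<close> by (simp add: c_def[symmetric])
  then have "prob_space \<zeta>" by (intro prob_spaceI) (simp add: \<zeta>_def)
  then have "real_distribution \<zeta>" unfolding real_distribution_def real_distribution_axioms_def \<zeta>_def by simp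
  moreover have "integrable \<zeta> (\<lambda>x. \<bar>x\<bar> ^ j)" if "j \<le> k" for j
  proof -
    have "integrable lborel (\<lambda>x. (1 / c) * (\<bar>x\<bar> ^ j * h x))"
    proof -
      have "j + 2 \<le> N" using that by (simp add: N_def)
      from sinc_power_moment[OF this] show ?thesis by (simp add: h_def)
    qed
    then show ?thesis
      unfolding \<zeta>_def using hnn \<open>c > 0\<close> by (subst integrable_density) (auto simp: mult_ac)
  qed
  moreover have "char \<zeta> t = 0" if "\<bar>t\<bar> > real N" for t
  proof -
    have "char \<zeta> t = (LINT x|lborel. (h x / c) *\<^sub>R iexp (t * x))"
      unfolding char_def \<zeta>_def using hnn \<open>c > 0\<close> by (subst integral_density) auto
    also have "\<dots> = (LINT x|lborel. of_real (1 / c) * (iexp (- (x * (- t))) * of_real (h x)))"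
      by (intro Bochner_Integration.integral_cong refl) (simp add: scaleR_conv_of_real mult_ac)
    also have "\<dots> = of_real (1 / c) * fourier (char \<nu>) (- t)"
      unfolding fourier_def ch by (rule integral_mult_right_zero)
    finally show ?thesis using b0[of "-t"] that real[of "- t"] by simp
  qed
  moreover have "real N > 0" by (simp add: N_def)
  ultimately show ?thesis by blast
qed

text \<open>Stretching the variable by \<open>R / \<epsilon>\<close> compresses the support of the
  characteristic function from \<open>R\<close> to \<open>\<epsilon>\<close>.\<close>

lemma band_limited_law_scaled:
  fixes k :: nat and \<epsilon> :: real
  assumes "\<epsilon> > 0"
  shows "\<exists>\<zeta>. real_distribution \<zeta> \<and> (\<forall>j\<le>k. integrable \<zeta> (\<lambda>x. \<bar>x\<bar> ^ j)) \<and>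
     (\<forall>t. \<bar>t\<bar> > \<epsilon> \<longrightarrow> char \<zeta> t = 0)"
proof -
  obtain \<zeta> R where z: "real_distribution \<zeta>" "R > 0" "\<And>j. j \<le> k \<Longrightarrow> integrable \<zeta> (\<lambda>x. \<bar>x\<bar> ^ j)"
     "\<And>t. \<bar>t\<bar> > R \<Longrightarrow> char \<zeta> t = 0"
    using band_limited_law[of k] by blast
  interpret Z: real_distribution \<zeta> by fact
  define r where "r = R / \<epsilon>"
  have r: "r > 0" using z(2) assms by (simp add: r_def)
  define \<eta> where "\<eta> = distr \<zeta> borel (\<lambda>x. r * x)"
  have [measurable]: "(\<lambda>x. r * x) \<in> borel_measurable \<zeta>" by measurable
  have "real_distribution \<eta>" unfolding \<eta>_def by (intro Z.real_distribution_distr) measurable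
  moreover have "integrable \<eta> (\<lambda>x. \<bar>x\<bar> ^ j)" if "j \<le> k" for j
  proof -
    have "integrable \<zeta> (\<lambda>x. r ^ j * \<bar>x\<bar> ^ j)" using z(3)[OF that] by simp
    then show ?thesis unfolding \<eta>_def using r by (subst integrable_distr_eq) (auto simp: abs_mult power_mult_distrib)
  qed
  moreover have "char \<eta> t = 0" if "\<bar>t\<bar> > \<epsilon>" for t
  proof -
    have "char \<eta> t = char \<zeta> (r * t)"
      unfolding char_def \<eta>_def by (subst integral_distr) (auto simp: mult_ac)
    moreover have "\<bar>r * t\<bar> > R"
      using that r assms z(2) by (simp add: abs_mult r_def field_simps)
    ultimately show ?thesis using z(4) by simp
  qed
  ultimately show ?thesis by blast
qed

section \<open>Derivatives of characteristic functions\<close>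

text \<open>The integral that results from differentiating \<open>char \<zeta>\<close> formally
  \<open>i\<close> times under the integral sign; it is the \<open>i\<close>-th derivative once
  enough moments exist.\<close>

definition char_deriv :: "real measure \<Rightarrow> nat \<Rightarrow> real \<Rightarrow> complex" where
  "char_deriv \<zeta> i t = (LINT x|\<zeta>. (\<i> * of_real x) ^ i * iexp (t * x))"

lemma char_deriv_0: "char_deriv \<zeta> 0 = char \<zeta>"
  by (auto simp: char_deriv_def char_def)

context real_distribution
begin

lemma char_deriv_integrable:
  assumes "integrable M (\<lambda>x. \<bar>x\<bar> ^ i)"
  shows "integrable M (\<lambda>x. (\<i> * of_real x) ^ i * iexp (t * x))"
  by (rule Bochner_Integration.integrable_bound[OF assms])
    (auto simp: norm_mult norm_power simp del: of_real_mult)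

lemma norm_char_deriv_le: "norm (char_deriv M i t) \<le> (LINT x|M. \<bar>x\<bar> ^ i)"
proof -
  have "norm (char_deriv M i t) \<le> (LINT x|M. norm ((\<i> * of_real x) ^ i * iexp (t * x)))"
    unfolding char_deriv_def by (rule integral_norm_bound)
  then show ?thesis by (simp add: norm_mult norm_power del: of_real_mult)
qed

text \<open>Two estimates of the same remainder \<open>R\<close> are combined:
  \<open>2 |x|^(i+1)\<close> uses only the available moments and serves as the dominating function,
  while \<open>|x|^(i+2) |h|\<close> may fail to be integrable but gives pointwise
  convergence.\<close>

lemma char_deriv_has_derivative:
  assumes "integrable M (\<lambda>x. \<bar>x\<bar> ^ i)" "integrable M (\<lambda>x. \<bar>x\<bar> ^ Suc i)"
  shows "(char_deriv M i has_vector_derivative char_deriv M (Suc i) t) (at t)"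
proof -
  define R where "R h x = \<bar>x\<bar> ^ i * (norm (iexp (h * x) - (1 + \<i> * of_real (h * x))) / \<bar>h\<bar>)" for h x :: real
  have [measurable]: "R h \<in> borel_measurable M" for h unfolding R_def by measurable
  have R1: "R h x \<le> 2 * \<bar>x\<bar> ^ Suc i" and R2: "R h x \<le> \<bar>x\<bar> ^ i * x\<^sup>2 * \<bar>h\<bar>" and R0: "0 \<le> R h x"
    if h: "h \<noteq> 0" for h x
  proof -
    have S1: "(\<Sum>k\<le>1. (\<i> * of_real (h * x)) ^ k / fact k) = 1 + \<i> * of_real (h * x)" by simp
    have "norm (iexp (h * x) - (1 + \<i> * of_real (h * x))) \<le> 2 * \<bar>h * x\<bar> ^ 1 / fact 1"
      using iexp_approx2[of "h * x" 1] unfolding S1 .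
    then have "norm (iexp (h * x) - (1 + \<i> * of_real (h * x))) / \<bar>h\<bar> \<le> (2 * \<bar>x\<bar> * \<bar>h\<bar>) / \<bar>h\<bar>"
      by (intro divide_right_mono) (simp_all add: abs_mult mult_ac)
    also have "\<dots> = 2 * \<bar>x\<bar>" using h by (intro nonzero_mult_div_cancel_right) simp
    finally have "R h x \<le> \<bar>x\<bar> ^ i * (2 * \<bar>x\<bar>)" unfolding R_def by (intro mult_left_mono) simp_all
    then show "R h x \<le> 2 * \<bar>x\<bar> ^ Suc i" by (simp only: power_Suc mult_ac)
    have "norm (iexp (h * x) - (1 + \<i> * of_real (h * x))) \<le> \<bar>h * x\<bar> ^ Suc 1 / fact (Suc 1)"
      using iexp_approx1[of "h * x" 1] unfolding S1 .
    also have "\<dots> = x\<^sup>2 * h\<^sup>2 / 2" by (simp add: power2_eq_square)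
    also have "\<dots> \<le> x\<^sup>2 * h\<^sup>2" by simp
    also have "\<dots> = x\<^sup>2 * \<bar>h\<bar> * \<bar>h\<bar>" by (simp add: power2_eq_square mult.assoc)
    finally have "norm (iexp (h * x) - (1 + \<i> * of_real (h * x))) / \<bar>h\<bar> \<le> (x\<^sup>2 * \<bar>h\<bar> * \<bar>h\<bar>) / \<bar>h\<bar>"
      by (intro divide_right_mono) simp_all
    also have "\<dots> = x\<^sup>2 * \<bar>h\<bar>" using h by (intro nonzero_mult_div_cancel_right) simp
    finally have "R h x \<le> \<bar>x\<bar> ^ i * (x\<^sup>2 * \<bar>h\<bar>)" unfolding R_def by (intro mult_left_mono) simp_all
    then show "R h x \<le> \<bar>x\<bar> ^ i * x\<^sup>2 * \<bar>h\<bar>" by (simp only: mult_ac)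
    show "0 \<le> R h x" by (simp add: R_def)
  qed
  have bound: "norm (char_deriv M i (t + h) - char_deriv M i t - h *\<^sub>R char_deriv M (Suc i) t) / \<bar>h\<bar> \<le> (LINT x|M. R h x)"
    if h: "h \<noteq> 0" for h
  proof -
    let ?g = "\<lambda>x. (\<i> * of_real x) ^ i * iexp (t * x) * (iexp (h * x) - (1 + \<i> * of_real (h * x)))"
    have "char_deriv M i (t + h) - char_deriv M i t - h *\<^sub>R char_deriv M (Suc i) t =
      (LINT x|M. (\<i> * of_real x) ^ i * iexp ((t + h) * x) - (\<i> * of_real x) ^ i * iexp (t * x) - h *\<^sub>R ((\<i> * of_real x) ^ Suc i * iexp (t * x)))"
      unfolding char_deriv_def
      by (simp only: Bochner_Integration.integral_diff char_deriv_integrable assms integral_scaleR_right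
          Bochner_Integration.integrable_diff integrable_scaleR_right)
    also have "\<dots> = (LINT x|M. ?g x)"
    proof (intro Bochner_Integration.integral_cong refl)
      fix x
      have ring: "p * (E * H) - p * E - z * (a * p * E) = p * E * (H - (1 + a * z))" for p E H z a :: complex
        by (simp add: algebra_simps)
      have "iexp ((t + h) * x) = iexp (t * x) * iexp (h * x)"
        by (simp only: distrib_right distrib_left of_real_add exp_add)
      moreover have e: "\<i> * of_real (h * x) = \<i> * of_real x * of_real h" by (simp only: of_real_mult mult_ac)
      ultimately have "iexp ((t + h) * x) = iexp (t * x) * exp (\<i> * of_real x * of_real h)" by (simp only:)
      then show "(\<i> * of_real x) ^ i * iexp ((t + h) * x) - (\<i> * of_real x) ^ i * iexp (t * x) - h *\<^sub>R ((\<i> * of_real x) ^ Suc i * iexp (t * x)) = ?g x"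
        unfolding scaleR_conv_of_real power_Suc e by (simp only: ring)
    qed
    finally have eq: "char_deriv M i (t + h) - char_deriv M i t - h *\<^sub>R char_deriv M (Suc i) t = (LINT x|M. ?g x)" .
    have "norm (LINT x|M. ?g x) \<le> (LINT x|M. norm (?g x))" by (rule integral_norm_bound)
    then have "norm (char_deriv M i (t + h) - char_deriv M i t - h *\<^sub>R char_deriv M (Suc i) t) / \<bar>h\<bar> \<le> (LINT x|M. norm (?g x)) / \<bar>h\<bar>"
      unfolding eq by (intro divide_right_mono) simp_all
    also have "(LINT x|M. norm (?g x)) / \<bar>h\<bar> = (LINT x|M. norm (?g x) / \<bar>h\<bar>)" by simp
    also have "\<dots> = (LINT x|M. R h x)"
      unfolding R_def norm_mult norm_power norm_exp_i_times norm_ii norm_of_real mult_1 mult_1_right times_divide_eq_right ..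
    finally show ?thesis .
  qed
  have lim: "((\<lambda>h. LINT x|M. R h x) \<longlongrightarrow> 0) (at 0)"
    unfolding tendsto_at_iff_sequentially comp_def
  proof (intro allI impI)
    fix X :: "nat \<Rightarrow> real" assume X: "\<forall>k. X k \<in> UNIV - {0}" "X \<longlonglongrightarrow> 0"
    have "(\<lambda>k. LINT x|M. R (X k) x) \<longlonglongrightarrow> (LINT x|M. 0)"
    proof (rule integral_dominated_convergence[where w = "\<lambda>x. 2 * \<bar>x\<bar> ^ Suc i"])
      show "integrable M (\<lambda>x. 2 * \<bar>x\<bar> ^ Suc i)" by (intro integrable_mult_right assms)
      show "AE x in M. (\<lambda>k. R (X k) x) \<longlonglongrightarrow> 0"
      proof (rule AE_I2)
        fix x
        have "(\<lambda>k. \<bar>x\<bar> ^ i * x\<^sup>2 * \<bar>X k\<bar>) \<longlonglongrightarrow> \<bar>x\<bar> ^ i * x\<^sup>2 * \<bar>0\<bar>" by (intro tendsto_intros X)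
        then have "(\<lambda>k. \<bar>x\<bar> ^ i * x\<^sup>2 * \<bar>X k\<bar>) \<longlonglongrightarrow> 0" by simp
        then show "(\<lambda>k. R (X k) x) \<longlonglongrightarrow> 0"
          by (rule Lim_null_comparison[rotated]) (use X R2 R0 in \<open>auto intro!: always_eventually\<close>)
      qed
      show "AE x in M. norm (R (X k) x) \<le> 2 * \<bar>x\<bar> ^ Suc i" for k
        using X R1[of "X k"] R0[of "X k"] by (intro AE_I2) auto
    qed simp_all
    then show "(\<lambda>k. LINT x|M. R (X k) x) \<longlonglongrightarrow> 0" by simp
  qed
  show ?thesis
    unfolding has_vector_derivative_def has_derivative_at
  proof
    show "bounded_linear (\<lambda>h. h *\<^sub>R char_deriv M (Suc i) t)" by (intro bounded_linear_scaleR_left)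
    have ev: "\<forall>\<^sub>F h in at 0. norm (norm (char_deriv M i (t + h) - char_deriv M i t - h *\<^sub>R char_deriv M (Suc i) t) / norm h) \<le> (LINT x|M. R h x)"
      unfolding eventually_at_filter
    proof (intro always_eventually allI impI)
      fix h :: real assume "h \<noteq> 0"
      from bound[OF this] show "norm (norm (char_deriv M i (t + h) - char_deriv M i t - h *\<^sub>R char_deriv M (Suc i) t) / norm h) \<le> (LINT x|M. R h x)"
        unfolding real_norm_def abs_divide abs_norm_cancel abs_idempotent .
    qed
    show "(\<lambda>h. norm (char_deriv M i (t + h) - char_deriv M i t - h *\<^sub>R char_deriv M (Suc i) t) / norm h) \<midarrow>0\<rightarrow> 0"
      by (rule Lim_null_comparison[OF ev lim])
  qed
qed

end

section \<open>Monotone transport to the normal law\<close>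

text \<open>Continuity of both distribution functions and strict monotonicity of
  \<open>cdf \<nu>\<close> make the latter a bijection onto the open unit interval, so the quantile
  function of \<open>\<nu>\<close> is a true inverse.\<close>

locale quantile_transform = mu: real_distribution \<mu> + nu: real_distribution \<nu> for \<mu> \<nu> +
  assumes mu_atom_free: "measure \<mu> {x} = 0"
    and nu_atom_free: "measure \<nu> {x} = 0"
    and nu_strict: "x < y \<Longrightarrow> cdf \<nu> x < cdf \<nu> y"
begin

text \<open>The value 0 is a placeholder where \<open>cdf \<mu>\<close> is 0 or 1;
  \<open>AE_interior\<close> shows that such points form a null set.\<close>

definition quantile_map :: "real \<Rightarrow> real" where
  "quantile_map y = (if 0 < cdf \<mu> y \<and> cdf \<mu> y < 1 then (THE z. cdf \<nu> z = cdf \<mu> y) else 0)"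

lemma cdf_continuous: "continuous_on UNIV (cdf \<mu>)" "continuous_on UNIV (cdf \<nu>)"
  using mu.isCont_cdf nu.isCont_cdf mu_atom_free nu_atom_free
  by (auto simp: continuous_on_eq_continuous_at)

lemma real_distribution_level:
  assumes "real_distribution \<rho>" "continuous_on UNIV (cdf \<rho>)" "0 < u" "u < 1"
  shows "\<exists>z. cdf \<rho> z = u"
proof -
  interpret real_distribution \<rho> by fact
  have "eventually (\<lambda>x. cdf \<rho> x < u) at_bot"
    using cdf_lim_at_bot \<open>0 < u\<close> by (rule order_tendstoD)
  then obtain a where a: "cdf \<rho> a < u" unfolding eventually_at_bot_linorder by auto
  have "eventually (\<lambda>x. cdf \<rho> x > u) at_top"
    using cdf_lim_at_top_prob \<open>u < 1\<close> by (rule order_tendstoD)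
  then obtain b where b: "cdf \<rho> b > u" unfolding eventually_at_top_linorder by auto
  have "a \<le> b" using a b cdf_nondecreasing[of b a] by linarith
  then show ?thesis
    using IVT'[of "cdf \<rho>" a u b] a b assms(2) continuous_on_subset by fastforce
qed

lemma nu_le_iff: "cdf \<nu> x \<le> cdf \<nu> y \<longleftrightarrow> x \<le> y"
  using nu_strict[of y x] nu.cdf_nondecreasing[of x y] by (meson not_le)

lemma nu_inj: "cdf \<nu> x = cdf \<nu> y \<longleftrightarrow> x = y"
  using nu_le_iff by (metis antisym order_refl)

lemma nu_bounds: "0 < cdf \<nu> x" "cdf \<nu> x < 1"
  using nu_strict[of "x - 1" x] nu_strict[of x "x + 1"] nu.cdf_nonneg[of "x - 1"] nu.cdf_bounded_prob[of "x + 1"]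
  by auto

lemma quantile_map_eqI:
  assumes "cdf \<nu> z = cdf \<mu> y"
  shows "quantile_map y = z"
proof -
  have "0 < cdf \<mu> y" "cdf \<mu> y < 1" using nu_bounds[of z] assms by auto
  moreover have "(THE z. cdf \<nu> z = cdf \<mu> y) = z"
    using assms nu_inj by (intro the_equality) metis+
  ultimately show ?thesis by (simp add: quantile_map_def)
qed

lemma cdf_quantile_map:
  assumes "0 < cdf \<mu> y" "cdf \<mu> y < 1"
  shows "cdf \<nu> (quantile_map y) = cdf \<mu> y"
  using real_distribution_level[OF nu.real_distribution_axioms cdf_continuous(2) assms] quantile_map_eqI by metis

text \<open>Reduces sublevel sets of the map to those of \<open>cdf \<mu>\<close>, from which both
  its measurability and its law follow.\<close>

lemma quantile_map_le_iff:
  "quantile_map y \<le> a \<longleftrightarrow> (if 0 < cdf \<mu> y \<and> cdf \<mu> y < 1 then cdf \<mu> y \<le> cdf \<nu> a else 0 \<le> a)"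
  using cdf_quantile_map[of y] nu_le_iff[of "quantile_map y" a] by (auto simp: quantile_map_def)

lemma cdf_mu_measurable[measurable]: "cdf \<mu> \<in> borel_measurable borel"
  using cdf_continuous(1) by (rule borel_measurable_continuous_onI)

lemma quantile_map_measurable[measurable]: "quantile_map \<in> borel_measurable borel"
  unfolding borel_measurable_iff_le quantile_map_le_iff by measurable

text \<open>By continuity and monotonicity of \<open>cdf \<mu>\<close> the sublevel set is a closed
  half-line, and the level \<open>u\<close> is attained at its end point. This is the probability
  integral transform.\<close>

lemma measure_sublevel:
  assumes "0 < u" "u < 1"
  shows "measure \<mu> {y. cdf \<mu> y \<le> u} = u"
proof -
  let ?S = "{y. cdf \<mu> y \<le> u}"
  obtain y0 where y0: "cdf \<mu> y0 = u"
    using real_distribution_level[OF mu.real_distribution_axioms cdf_continuous(1) assms] by blast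
  have "eventually (\<lambda>x. cdf \<mu> x > u) at_top"
    using mu.cdf_lim_at_top_prob \<open>u < 1\<close> by (rule order_tendstoD)
  then obtain b where b: "cdf \<mu> b > u" unfolding eventually_at_top_linorder by auto
  have le_b: "x \<le> b" if "x \<in> ?S" for x
    using that b mu.cdf_nondecreasing[of b x] by (simp; linarith)
  then have bdd: "bdd_above ?S" by (intro bdd_aboveI)
  have cl: "closed ?S" by (intro closed_Collect_le cdf_continuous continuous_intros)
  have ne: "?S \<noteq> {}" using y0 by auto
  define y1 where "y1 = Sup ?S"
  have y1: "y1 \<in> ?S" unfolding y1_def by (rule closed_contains_Sup[OF ne bdd cl])
  have "y0 \<le> y1" unfolding y1_def using y0 bdd by (intro cSup_upper) auto
  then have "cdf \<mu> y1 = u" using y1 y0 mu.cdf_nondecreasing[of y0 y1] by simp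
  moreover have "?S = {..y1}"
  proof (intro set_eqI iffI)
    fix x assume "x \<in> ?S" then show "x \<in> {..y1}" unfolding y1_def using bdd by (auto intro: cSup_upper)
  next
    fix x assume "x \<in> {..y1}" then show "x \<in> ?S" using y1 mu.cdf_nondecreasing[of x y1] by auto
  qed
  ultimately show ?thesis by (simp add: cdf_def2)
qed

text \<open>The set where \<open>cdf \<mu>\<close> is at most 0 lies in each sublevel set of a level
  \<open>u > 0\<close>, so its mass is below every such \<open>u\<close>; the upper end is
  symmetric.\<close>

lemma AE_interior: "AE y in \<mu>. 0 < cdf \<mu> y \<and> cdf \<mu> y < 1"
proof -
  have "measure \<mu> {y. cdf \<mu> y \<le> 0} \<le> u" if "0 < u" "u < 1" for u
  proof -
    have "measure \<mu> {y. cdf \<mu> y \<le> 0} \<le> measure \<mu> {y. cdf \<mu> y \<le> u}"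
      using that by (intro mu.finite_measure_mono) auto
    then show ?thesis using measure_sublevel[OF that] by simp
  qed
  then have "measure \<mu> {y. cdf \<mu> y \<le> 0} \<le> 0" by (intro dense_ge_bounded[of 0 1]) auto
  then have 0: "measure \<mu> {y. cdf \<mu> y \<le> 0} = 0" using measure_nonneg[of \<mu>] by (metis antisym)
  have "measure \<mu> {y. 1 \<le> cdf \<mu> y} \<le> 1 - u" if "0 < u" "u < 1" for u
  proof -
    have "measure \<mu> {y. 1 \<le> cdf \<mu> y} \<le> measure \<mu> (UNIV - {y. cdf \<mu> y \<le> u})"
      using that by (intro mu.finite_measure_mono) auto
    also have "\<dots> = 1 - measure \<mu> {y. cdf \<mu> y \<le> u}"
      using mu.prob_compl[of "{y. cdf \<mu> y \<le> u}"] by simp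
    finally show ?thesis using measure_sublevel[OF that] by simp
  qed
  from this[of "1 - u" for u] have "measure \<mu> {y. 1 \<le> cdf \<mu> y} \<le> u" if "0 < u" "u < 1" for u
    using that by simp
  then have "measure \<mu> {y. 1 \<le> cdf \<mu> y} \<le> 0" by (intro dense_ge_bounded[of 0 1]) auto
  then have 1: "measure \<mu> {y. 1 \<le> cdf \<mu> y} = 0" using measure_nonneg[of \<mu>] by (metis antisym)
  have "AE y in \<mu>. \<not> cdf \<mu> y \<le> 0"
    using 0 by (intro AE_I[of _ _ "{y. cdf \<mu> y \<le> 0}"]) (auto simp: mu.emeasure_eq_measure)
  moreover have "AE y in \<mu>. \<not> 1 \<le> cdf \<mu> y"
    using 1 by (intro AE_I[of _ _ "{y. 1 \<le> cdf \<mu> y}"]) (auto simp: mu.emeasure_eq_measure)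
  ultimately show ?thesis by eventually_elim auto
qed

lemma distr_quantile_map: "distr \<mu> borel quantile_map = \<nu>"
proof (rule cdf_unique)
  show "real_distribution (distr \<mu> borel quantile_map)"
    by (intro mu.real_distribution_distr) measurable
  show "cdf (distr \<mu> borel quantile_map) = cdf \<nu>"
  proof
    fix a
    have "cdf (distr \<mu> borel quantile_map) a = measure \<mu> {y. quantile_map y \<le> a}"
      unfolding cdf_def2 by (subst measure_distr) (auto simp: vimage_def)
    also have "\<dots> = measure \<mu> {y. cdf \<mu> y \<le> cdf \<nu> a}"
    proof (intro mu.finite_measure_eq_AE)
      show "AE y in \<mu>. y \<in> {y. quantile_map y \<le> a} \<longleftrightarrow> y \<in> {y. cdf \<mu> y \<le> cdf \<nu> a}"
        using AE_interior by eventually_elim (simp add: quantile_map_le_iff)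
    qed auto
    also have "\<dots> = cdf \<nu> a" using nu_bounds by (rule measure_sublevel)
    finally show "cdf (distr \<mu> borel quantile_map) a = cdf \<nu> a" .
  qed
  show "real_distribution \<nu>" by (rule nu.real_distribution_axioms)
qed

text \<open>Strict monotonicity of \<open>cdf \<nu>\<close> converts a gap between the distribution
  functions into a displacement. The hypotheses also force \<open>cdf \<mu> y\<close> into the open
  unit interval, so the placeholder value never interferes.\<close>

lemma quantile_map_close:
  assumes "\<bar>cdf \<mu> y - cdf \<nu> y\<bar> \<le> cdf \<nu> (y + h) - cdf \<nu> y"
    and "\<bar>cdf \<mu> y - cdf \<nu> y\<bar> \<le> cdf \<nu> y - cdf \<nu> (y - h)"
  shows "\<bar>quantile_map y - y\<bar> \<le> h"
proof -
  have b: "cdf \<nu> (y - h) \<le> cdf \<mu> y" "cdf \<mu> y \<le> cdf \<nu> (y + h)" using assms by auto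
  then have "0 < cdf \<mu> y" "cdf \<mu> y < 1" using nu_bounds[of "y - h"] nu_bounds[of "y + h"] by auto
  then have "cdf \<nu> (quantile_map y) = cdf \<mu> y" by (rule cdf_quantile_map)
  then have "y - h \<le> quantile_map y" "quantile_map y \<le> y + h"
    using b nu_le_iff[of "y - h" "quantile_map y"] nu_le_iff[of "quantile_map y" "y + h"] by auto
  then show ?thesis by linarith
qed

end


section \<open>Gaussian tails and increments of the normal distribution function\<close>

lemma gauss_pos: "gauss y > 0"
  by (simp add: std_normal_density_def)

lemma gauss_le_exp: "gauss y \<le> gexp y"
proof -
  have "1 / sqrt (2 * pi) \<le> 1" using pi_gt3 by (simp add: real_le_rsqrt)
  then have "1 / sqrt (2 * pi) * gexp y \<le> 1 * gexp y" by (intro mult_right_mono) auto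
  then show ?thesis by (simp add: std_normal_density_def)
qed

lemma gauss_le_1: "gauss y \<le> 1"
  using gauss_le_exp[of y] by (rule order_trans) simp

lemma nn_integral_poly_gauss_finite:
  assumes "c < 0"
  shows "(\<integral>\<^sup>+y. ennreal (wt y ^ K * exp (c * y\<^sup>2)) \<partial>lborel) < \<infinity>"
  using integrable_poly_gauss[OF assms, of K]
  by (subst nn_integral_eq_integral) (auto intro!: mult_nonneg_nonneg)

lemma nn_integral_powr_tail_finite:
  assumes "a > 1"
  shows "(\<integral>\<^sup>+y. ennreal (wt y powr (- a)) \<partial>lborel) < \<infinity>"
proof -
  let ?F = "\<lambda>y::real. - ((1 + y) powr (1 - a) / (a - 1))"
  have half: "(\<integral>\<^sup>+y. ennreal (wt y powr (- a)) * indicator {0..} y \<partial>lborel) = 0 - ?F 0"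
  proof -
    have "(\<integral>\<^sup>+y. ennreal (wt y powr (- a)) * indicator {0..} y \<partial>lborel) =
      (\<integral>\<^sup>+y. ennreal ((1 + y) powr (- a)) * indicator {0..} y \<partial>lborel)"
      by (intro nn_integral_cong) (auto simp: indicator_def)
    also have "\<dots> = 0 - ?F 0"
    proof (rule nn_integral_FTC_atLeast)
      fix x :: real assume "0 \<le> x"
      then have "DERIV (\<lambda>y. (1 + y) powr (1 - a)) x :> (1 - a) * (1 + x) powr (1 - a - of_nat 1) * 1"
        by (intro DERIV_fun_powr) (auto intro!: derivative_eq_intros)
      then have "DERIV ?F x :> - ((1 - a) * (1 + x) powr (1 - a - of_nat 1) * 1 / (a - 1))"
        by (intro DERIV_minus DERIV_cdivide)
      moreover have "- ((1 - a) * (1 + x) powr (1 - a - of_nat 1) * 1 / (a - 1)) = (1 + x) powr (- a)"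
        using assms by (simp add: field_simps)
      ultimately show "DERIV ?F x :> (1 + x) powr (- a)" by simp
      show "0 \<le> (1 + x) powr (- a)" by simp
    next
      show "(?F \<longlongrightarrow> 0) at_top" using assms by real_asymp
    qed measurable
    finally show ?thesis .
  qed
  have "(\<integral>\<^sup>+y. ennreal (wt y powr (- a)) \<partial>lborel) \<le>
    (\<integral>\<^sup>+y. ennreal (wt y powr (- a)) * indicator {0..} y + ennreal (wt y powr (- a)) * indicator {..0} y \<partial>lborel)"
    by (intro nn_integral_mono) (auto simp: indicator_def)
  also have "\<dots> = (\<integral>\<^sup>+y. ennreal (wt y powr (- a)) * indicator {0..} y \<partial>lborel) +
    (\<integral>\<^sup>+y. ennreal (wt y powr (- a)) * indicator {..0} y \<partial>lborel)"
    by (rule nn_integral_add) auto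
  also have "(\<integral>\<^sup>+y. ennreal (wt y powr (- a)) * indicator {..0} y \<partial>lborel) =
    (\<integral>\<^sup>+y. ennreal (wt y powr (- a)) * indicator {0..} y \<partial>lborel)"
    by (subst nn_integral_real_affine[of _ "-1" 0]) (auto intro!: nn_integral_cong simp: indicator_def)
  finally show ?thesis by (rule le_less_trans) (simp add: half less_top[symmetric])
qed

text \<open>After a shift by \<open>y\<close>, the inequalities
  \<open>(y + v)\<^sup>2 \<ge> y\<^sup>2 + v\<^sup>2\<close> and
  \<open>wt (y + v) \<le> wt y * wt v\<close> for \<open>y, v \<ge> 0\<close> factor the integrand,
  so that \<open>A\<close> is a Gaussian moment independent of \<open>y\<close>.\<close>

lemma gauss_upper_tail:
  "\<exists>A\<ge>0. \<forall>y\<ge>0. (\<integral>\<^sup>+u. ennreal (wt u ^ K * gauss u) * indicator {y..} u \<partial>lborel) \<le> ennreal (A * wt y ^ K * gauss y)"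
proof -
  define A where "A = enn2real (\<integral>\<^sup>+v. ennreal (wt v ^ K * exp (- (1/2) * v\<^sup>2)) \<partial>lborel)"
  have A: "(\<integral>\<^sup>+v. ennreal (wt v ^ K * exp (- (1/2) * v\<^sup>2)) \<partial>lborel) = ennreal A"
    unfolding A_def using nn_integral_poly_gauss_finite[of "- (1/2)" K] by simp
  have A0: "A \<ge> 0" by (simp add: A_def)
  have "(\<integral>\<^sup>+u. ennreal (wt u ^ K * gauss u) * indicator {y..} u \<partial>lborel) \<le> ennreal (A * wt y ^ K * gauss y)" if y: "y \<ge> 0" for y
  proof -
    have "(\<integral>\<^sup>+u. ennreal (wt u ^ K * gauss u) * indicator {y..} u \<partial>lborel) =
      (\<integral>\<^sup>+v. ennreal ((1 + \<bar>y + v\<bar>) ^ K * gauss (y + v)) * indicator {y..} (y + v) \<partial>lborel)"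
      by (subst nn_integral_real_affine[of _ 1 y]) auto
    also have "\<dots> \<le> (\<integral>\<^sup>+v. ennreal (wt y ^ K * gauss y) * ennreal (wt v ^ K * exp (- (1/2) * v\<^sup>2)) \<partial>lborel)"
    proof (intro nn_integral_mono)
      fix v
      show "ennreal ((1 + \<bar>y + v\<bar>) ^ K * gauss (y + v)) * indicator {y..} (y + v) \<le> ennreal (wt y ^ K * gauss y) * ennreal (wt v ^ K * exp (- (1/2) * v\<^sup>2))"
      proof (cases "v \<ge> 0")
        case True
        have "1 + \<bar>y + v\<bar> \<le> wt y * wt v" using y True by (simp add: algebra_simps)
        then have 1: "(1 + \<bar>y + v\<bar>) ^ K \<le> wt y ^ K * wt v ^ K"
          unfolding power_mult_distrib[symmetric] by (intro power_mono) auto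
        have "- (y + v)\<^sup>2 / 2 \<le> - y\<^sup>2 / 2 + - (1/2) * v\<^sup>2"
          using y True by (simp add: power2_sum)
        then have "exp (- (y + v)\<^sup>2 / 2) \<le> gexp y * exp (- (1/2) * v\<^sup>2)"
          by (simp only: exp_add[symmetric] exp_le_cancel_iff)
        then have "1 / sqrt (2 * pi) * exp (- (y + v)\<^sup>2 / 2) \<le> 1 / sqrt (2 * pi) * (gexp y * exp (- (1/2) * v\<^sup>2))"
          by (intro mult_left_mono) auto
        then have 2: "gauss (y + v) \<le> gauss y * exp (- (1/2) * v\<^sup>2)"
          unfolding std_normal_density_def by (simp only: mult.assoc)
        have "(1 + \<bar>y + v\<bar>) ^ K * gauss (y + v) \<le> (wt y ^ K * wt v ^ K) * (gauss y * exp (- (1/2) * v\<^sup>2))"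
          using 1 2 by (intro mult_mono) (auto simp: less_imp_le[OF gauss_pos] intro!: mult_nonneg_nonneg)
        then have "ennreal ((1 + \<bar>y + v\<bar>) ^ K * gauss (y + v)) \<le> ennreal ((wt y ^ K * gauss y) * (wt v ^ K * exp (- (1/2) * v\<^sup>2)))"
          by (intro ennreal_leI) (simp only: mult_ac)
        also have "\<dots> = ennreal (wt y ^ K * gauss y) * ennreal (wt v ^ K * exp (- (1/2) * v\<^sup>2))"
          by (intro ennreal_mult) (auto simp: less_imp_le[OF gauss_pos] intro!: mult_nonneg_nonneg)
        finally show ?thesis using True by simp
      qed simp
    qed
    also have "\<dots> = ennreal (wt y ^ K * gauss y) * ennreal A"
      unfolding A[symmetric] by (rule nn_integral_cmult) auto
    also have "\<dots> = ennreal (A * wt y ^ K * gauss y)"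
      using A0 by (subst ennreal_mult[symmetric]) (auto simp: less_imp_le[OF gauss_pos] mult_ac intro!: mult_nonneg_nonneg)
    finally show ?thesis .
  qed
  then show ?thesis using A0 by blast
qed

lemma gauss_lower_tail:
  assumes "(\<integral>\<^sup>+u. ennreal (wt u ^ K * gauss u) * indicator {- y..} u \<partial>lborel) \<le> ennreal (A * wt (- y) ^ K * gauss (- y))"
  shows "(\<integral>\<^sup>+u. ennreal (wt u ^ K * gauss u) * indicator {..y} u \<partial>lborel) \<le> ennreal (A * wt y ^ K * gauss y)"
proof -
  have "(\<integral>\<^sup>+u. ennreal (wt u ^ K * gauss u) * indicator {..y} u \<partial>lborel) =
    (\<integral>\<^sup>+u. ennreal (wt u ^ K * gauss u) * indicator {- y..} u \<partial>lborel)"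
    by (subst nn_integral_real_affine[of _ "-1" 0]) (auto intro!: nn_integral_cong simp: indicator_def std_normal_density_def)
  then show ?thesis using assms by (simp add: std_normal_density_def)
qed

lemma measure_diff_bound:
  assumes "real_distribution \<mu>" "real_distribution \<nu>"
    and mu: "\<mu> = dens f" and nu: "\<nu> = dens g"
    and [measurable]: "f \<in> borel_measurable borel" "g \<in> borel_measurable borel" "d \<in> borel_measurable borel"
    and nonneg: "\<And>y. 0 \<le> f y" "\<And>y. 0 \<le> g y" "\<And>y. 0 \<le> d y"
    and close: "\<And>y. \<bar>f y - g y\<bar> \<le> d y"
    and [measurable]: "S \<in> sets borel" and b: "\<beta> \<ge> 0" "(\<integral>\<^sup>+y. ennreal (d y) * indicator S y \<partial>lborel) \<le> ennreal \<beta>"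
  shows "\<bar>measure \<mu> S - measure \<nu> S\<bar> \<le> \<beta>"
proof -
  interpret mu: real_distribution \<mu> by fact
  interpret nu: real_distribution \<nu> by fact
  have *: "emeasure (dens f) S \<le> emeasure (dens g) S + ennreal \<beta>"
    if [measurable]: "f \<in> borel_measurable borel" "g \<in> borel_measurable borel" and nn: "\<And>y. 0 \<le> f y" "\<And>y. 0 \<le> g y"
      and c: "\<And>y. \<bar>f y - g y\<bar> \<le> d y" for f g
  proof -
    have "emeasure (dens f) S = (\<integral>\<^sup>+y. ennreal (f y) * indicator S y \<partial>lborel)"
      by (subst emeasure_density) auto
    also have "\<dots> \<le> (\<integral>\<^sup>+y. ennreal (g y) * indicator S y + ennreal (d y) * indicator S y \<partial>lborel)"
    proof (intro nn_integral_mono)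
      fix y
      have "f y \<le> g y + d y" using c[of y] by linarith
      then have "ennreal (f y) \<le> ennreal (g y) + ennreal (d y)"
        using nn(2)[of y] nonneg(3)[of y] by (simp add: ennreal_leI flip: ennreal_plus)
      then show "ennreal (f y) * indicator S y \<le> ennreal (g y) * indicator S y + ennreal (d y) * indicator S y"
        by (auto simp: indicator_def)
    qed
    also have "\<dots> = (\<integral>\<^sup>+y. ennreal (g y) * indicator S y \<partial>lborel) + (\<integral>\<^sup>+y. ennreal (d y) * indicator S y \<partial>lborel)"
      by (rule nn_integral_add) auto
    also have "(\<integral>\<^sup>+y. ennreal (g y) * indicator S y \<partial>lborel) = emeasure (dens g) S"
      by (subst emeasure_density) auto
    finally show ?thesis using b(2) by (meson add_left_mono order_trans)
  qed
  have "emeasure \<mu> S \<le> emeasure \<nu> S + ennreal \<beta>"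
    unfolding mu nu by (intro * nonneg close) measurable
  then have 1: "measure \<mu> S \<le> measure \<nu> S + \<beta>"
    using b(1) by (simp add: mu.emeasure_eq_measure nu.emeasure_eq_measure flip: ennreal_plus)
  have "emeasure \<nu> S \<le> emeasure \<mu> S + ennreal \<beta>"
    unfolding mu nu using close by (intro * nonneg) (auto simp: abs_minus_commute)
  then have 2: "measure \<nu> S \<le> measure \<mu> S + \<beta>"
    using b(1) by (simp add: mu.emeasure_eq_measure nu.emeasure_eq_measure flip: ennreal_plus)
  show ?thesis using 1 2 by linarith
qed

text \<open>The condition \<open>wt y * h \<le> 1\<close> bounds both \<open>|y| h\<close> and
  \<open>h\<close> by 1, so \<open>u\<^sup>2\<close> exceeds \<open>y\<^sup>2\<close> by at most 3
  when \<open>|u - y| \<le> h\<close>; this is the origin of \<open>exp (- 3 / 2)\<close>.\<close>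

lemma std_normal_cdf_increment:
  assumes h: "0 \<le> h" "wt y * h \<le> 1"
  shows "exp (- 3 / 2) * gauss y * h \<le> \<Phi> (y + h) - \<Phi> y"
    and "exp (- 3 / 2) * gauss y * h \<le> \<Phi> y - \<Phi> (y - h)"
proof -
  interpret N: real_distribution \<N> by (rule real_dist_normal_dist)
  have "h \<le> wt y * h" using h(1) by (simp add: algebra_simps)
  then have h1: "h \<le> 1" using h(2) by linarith
  have yh: "\<bar>y\<bar> * h \<le> 1" using h by (simp add: algebra_simps)
  have lower: "exp (- 3 / 2) * gauss y \<le> gauss u" if u: "\<bar>u - y\<bar> \<le> h" for u
  proof -
    have "u\<^sup>2 = y\<^sup>2 + 2 * (y * (u - y)) + (u - y)\<^sup>2" by (simp add: power2_eq_square algebra_simps)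
    moreover have "y * (u - y) \<le> 1"
    proof -
      have "y * (u - y) \<le> \<bar>y\<bar> * \<bar>u - y\<bar>" by (metis abs_ge_self abs_mult)
      also have "\<dots> \<le> \<bar>y\<bar> * h" using u by (intro mult_left_mono) auto
      finally show ?thesis using yh by linarith
    qed
    moreover have "(u - y)\<^sup>2 \<le> 1"
      using u h1 abs_square_le_1[of "u - y"] by auto
    ultimately have "- 3 / 2 + - y\<^sup>2 / 2 \<le> - u\<^sup>2 / 2" by simp
    then have "exp (- 3 / 2) * gexp y \<le> gexp u"
      by (simp only: exp_add[symmetric] exp_le_cancel_iff)
    then have "1 / sqrt (2 * pi) * (exp (- 3 / 2) * gexp y) \<le> 1 / sqrt (2 * pi) * gexp u"
      by (intro mult_left_mono) auto
    then show ?thesis unfolding std_normal_density_def by (simp only: mult_ac)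
  qed
  have *: "exp (- 3 / 2) * gauss y * h \<le> \<Phi> b - \<Phi> a"
    if ab: "b = a + h" "\<And>u. a < u \<Longrightarrow> u \<le> b \<Longrightarrow> \<bar>u - y\<bar> \<le> h" for a b
  proof (cases "h = 0")
    case False
    then have "a < b" using ab h(1) by simp
    have "ennreal (exp (- 3 / 2) * gauss y * h) = (\<integral>\<^sup>+u. ennreal (exp (- 3 / 2) * gauss y) * indicator {a<..b} u \<partial>lborel)"
      using ab h(1) gauss_pos[of y] by (simp add: nn_integral_cmult_indicator ennreal_mult less_imp_le)
    also have "\<dots> \<le> (\<integral>\<^sup>+u. ennreal (gauss u) * indicator {a<..b} u \<partial>lborel)"
      using lower ab(2) by (intro nn_integral_mono) (auto simp: indicator_def intro!: ennreal_leI)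
    also have "\<dots> = emeasure \<N> {a<..b}"
      by (subst emeasure_density) auto
    also have "\<dots> = ennreal (\<Phi> b - \<Phi> a)"
      using N.cdf_diff_eq[OF \<open>a < b\<close>] by (simp add: N.emeasure_eq_measure)
    finally show ?thesis
      using N.cdf_nondecreasing[of a b] \<open>a < b\<close> by (subst (asm) ennreal_le_iff) auto
  qed (use ab in simp)
  show "exp (- 3 / 2) * gauss y * h \<le> \<Phi> (y + h) - \<Phi> y"
    by (rule *) auto
  show "exp (- 3 / 2) * gauss y * h \<le> \<Phi> y - \<Phi> (y - h)"
    by (rule *) auto
qed

lemma density_atom_free:
  fixes f :: "real \<Rightarrow> real"
  assumes "f \<in> borel_measurable borel"
  shows "measure (dens f) {x} = 0"
proof -
  have "emeasure (dens f) {x} = (\<integral>\<^sup>+y. ennreal (f y) * indicator {x} y \<partial>lborel)"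
    using assms by (subst emeasure_density) auto
  also have "\<dots> = (\<integral>\<^sup>+y. 0 \<partial>(lborel :: real measure))"
  proof (rule nn_integral_cong_AE)
    show "AE y in lborel. ennreal (f y) * indicator {x} y = 0"
      using AE_lborel_singleton[of x] by eventually_elim (simp add: indicator_def)
  qed
  finally show ?thesis by (simp add: measure_def)
qed

lemma quantile_transform_std_normal:
  fixes f :: "real \<Rightarrow> real"
  assumes "prob_space (dens f)" and "f \<in> borel_measurable borel"
  shows "quantile_transform (dens f) \<N>"
proof -
  interpret N: real_distribution \<N> by (rule real_dist_normal_dist)
  have "real_distribution (dens f)"
    unfolding real_distribution_def real_distribution_axioms_def using assms by simp
  then show ?thesis
  proof (rule quantile_transform.intro[OF _ real_dist_normal_dist], unfold_locales)
    show "measure (dens f) {x} = 0" for x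
      using assms(2) by (rule density_atom_free)
    show "measure \<N> {x} = 0" for x
      by (rule density_atom_free) simp
    fix x y :: real assume "x < y"
    \<comment> \<open>The step is shortened to \<open>1 / wt x\<close> so that the increment bound
      applies; any positive increment proves strictness.\<close>
    define h where "h = min (y - x) (1 / wt x)"
    have "h > 0" using \<open>x < y\<close> by (simp add: h_def add_pos_nonneg)
    moreover have "wt x * h \<le> 1"
    proof -
      have "wt x * h \<le> wt x * (1 / wt x)" unfolding h_def by (intro mult_left_mono) auto
      also have "\<dots> = 1" by simp
      finally show ?thesis .
    qed
    moreover have "exp (- 3 / 2) * gauss x * h > 0" using gauss_pos[of x] \<open>h > 0\<close> by simp
    ultimately have "\<Phi> x < \<Phi> (x + h)"
      using std_normal_cdf_increment(1)[of h x] by linarith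
    also have "\<dots> \<le> \<Phi> y"
      by (intro N.cdf_nondecreasing) (simp add: h_def)
    finally show "\<Phi> x < \<Phi> y" .
  qed
qed

section \<open>Pointwise cost of the transport map\<close>

lemma powr_add_le:
  fixes x y p :: real
  assumes "x \<ge> 0" "y \<ge> 0" "p \<ge> 0"
  shows "(x + y) powr p \<le> 2 powr p * (x powr p + y powr p)"
proof -
  have "(x + y) powr p \<le> (2 * max x y) powr p" using assms by (intro powr_mono2) auto
  also have "\<dots> = 2 powr p * max x y powr p" using assms by (simp add: powr_mult)
  also have "\<dots> \<le> 2 powr p * (x powr p + y powr p)" by (intro mult_left_mono) (auto simp: max_def)
  finally show ?thesis .
qed

lemma powr_le_scaled:
  fixes s S a b :: real
  assumes "0 < s" "s \<le> S" "a \<le> b"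
  shows "s powr b \<le> S powr (b - a) * s powr a"
proof -
  have "s powr b = s powr (b - a) * s powr a" by (simp flip: powr_add)
  also have "\<dots> \<le> S powr (b - a) * s powr a" using assms by (intro mult_right_mono powr_mono2) auto
  finally show ?thesis .
qed

lemma powr_le_power_ceiling:
  fixes w p :: real
  assumes "w \<ge> 1" "p \<ge> 0"
  shows "w powr p \<le> w ^ nat \<lceil>p\<rceil>"
proof -
  have "w powr p \<le> w powr real (nat \<lceil>p\<rceil>)" using assms by (intro powr_mono) (auto; linarith)
  also have "\<dots> = w ^ nat \<lceil>p\<rceil>" using assms by (intro powr_realpow) auto
  finally show ?thesis .
qed

text \<open>Above the level \<open>L\<close> the factor \<open>(b / L) powr r\<close> is at least 1.
  The truncation lets a high moment of \<open>b\<close> enter with a small coefficient.\<close>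

lemma powr_truncate_le:
  fixes b L p r :: real
  assumes "b \<ge> 0" "L > 0" "p \<ge> 0" "r \<ge> 0"
  shows "b powr p \<le> L powr p + L powr (- r) * b powr (p + r)"
proof (cases "b \<le> L")
  case True
  then have "b powr p \<le> L powr p" using assms by (intro powr_mono2) auto
  then show ?thesis by (simp add: add_increasing2)
next
  case False
  then have "1 \<le> (b / L) powr r" using assms by (intro ge_one_powr_ge_zero) auto
  then have "b powr p * 1 \<le> b powr p * (b / L) powr r" by (intro mult_left_mono) auto
  also have "\<dots> = L powr (- r) * b powr (p + r)"
    using assms False by (simp add: powr_divide powr_minus powr_add field_simps)
  finally show ?thesis by (simp add: add_increasing)
qed

lemma power_powr_commute: "w > 0 \<Longrightarrow> (w ^ n) powr q = (w powr q) ^ n" for w q :: real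
  by (induction n) (simp_all add: powr_mult)

text \<open>
  Here \<open>w = 1 + |y|\<close>, \<open>a = |y|\<close>, \<open>b = |T y|\<close>, \<open>D = |T y - y|\<close>, and \<open>g\<close>, \<open>f\<close> are the normal and
  the given density at \<open>y\<close>. Where the guaranteed displacement \<open>h\<close> satisfies \<open>w h > 1\<close> nothing is
  known about \<open>T\<close>; there a Markov-type factor \<open>1 \<le> (2 w X)\<^sup>q + (2 w Y)\<^sup>\<theta>\<close> with \<open>h = X + Y\<close> gains
  \<open>s\<^sup>q\<close>. The exponent \<open>\<theta> < 1\<close> keeps \<open>g\<^sup>1\<^sup>-\<^sup>\<theta>\<close> integrable; this is where \<open>p < m - 1\<close> is used.
\<close>

lemma transport_pointwise:
  fixes p q B C1 S :: real and m K :: nat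
  assumes p: "1 \<le> p" "p < q" and q: "q < real m - 1" and B: "B \<ge> 0" and C1: "C1 \<ge> 0" and S: "S > 0"
  defines "\<theta> \<equiv> q / (real m - 1)" and "r \<equiv> p * p / (q - p)"
  shows "\<exists>C\<ge>0. \<exists>n. \<forall>s w g f a b D. 0 < s \<longrightarrow> s \<le> S \<longrightarrow> 1 \<le> w \<longrightarrow> 0 < g \<longrightarrow> g \<le> 1 \<longrightarrow> 0 \<le> f \<longrightarrow>
    f \<le> C1 * (w ^ K * g + s ^ (m - 1) * w powr (- real m)) \<longrightarrow> 0 \<le> a \<longrightarrow> a \<le> w \<longrightarrow> 0 \<le> b \<longrightarrow> 0 \<le> D \<longrightarrow> D \<le> b + a \<longrightarrow>
    (w * (B * (s * w ^ K + s ^ (m - 1) / g)) \<le> 1 \<longrightarrow> D \<le> B * (s * w ^ K + s ^ (m - 1) / g)) \<longrightarrow>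
    D powr p * f \<le> C * s powr p * (w ^ n * g powr (1 - \<theta>) + w powr (p - real m)) + 2 powr p * s powr p * b powr (p + r) * f"
proof -
  define k where "k = real m - 1"
  have k: "q < k" "k > 0" using p q by (auto simp: k_def)
  have \<theta>: "0 < \<theta>" "\<theta> < 1" "k * \<theta> = q" using k p by (auto simp: \<theta>_def k_def[symmetric])
  have r: "r \<ge> 0" using p by (auto simp: r_def)
  define P where "P = nat \<lceil>p\<rceil>"
  define Q where "Q = nat \<lceil>q\<rceil>"
  define n where "n = K * P + K + P + (K + 1) * Q + 1"
  \<comment> \<open>\<open>Cg\<close> collects the constants of the region
    \<open>w * h \<le> 1\<close>, where the displacement is controlled, and \<open>Cb\<close> those
    of its complement.\<close>
  define Cg where "Cg = C1 * (2 powr p * (B powr p + B powr \<theta> * S powr (q - p)) + S powr (k - p))"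
  define Cb where "Cb = C1 * (((2 * B) powr q + (2 * B) powr \<theta>) + S powr (k - q))"
  define C where "C = Cg + 2 powr p * (Cb + Cb * S powr (q - p))"
  have nn: "Cg \<ge> 0" "Cb \<ge> 0" using C1 by (auto simp: Cg_def Cb_def intro!: mult_nonneg_nonneg add_nonneg_nonneg)
  have "C \<ge> 0" using nn by (auto simp: C_def)
  moreover have "D powr p * f \<le> C * s powr p * (w ^ n * g powr (1 - \<theta>) + w powr (p - real m)) + 2 powr p * s powr p * b powr (p + r) * f"
    if s: "0 < s" "s \<le> S" and w: "1 \<le> w" and g: "0 < g" "g \<le> 1" and f: "0 \<le> f" "f \<le> C1 * (w ^ K * g + s ^ (m - 1) * w powr (- real m))"
      and a: "0 \<le> a" "a \<le> w" and b: "0 \<le> b" and D: "0 \<le> D" "D \<le> b + a"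
      and good: "w * (B * (s * w ^ K + s ^ (m - 1) / g)) \<le> 1 \<longrightarrow> D \<le> B * (s * w ^ K + s ^ (m - 1) / g)"
    for s w g f a b D
  proof -
    define E where "E = w ^ n * g powr (1 - \<theta>) + w powr (p - real m)"
    have E1: "w ^ n * g powr (1 - \<theta>) \<le> E" and E2: "w powr (p - real m) \<le> E" and E0: "E \<ge> 0"
      using w by (auto simp: E_def)
    have "real (m - 1) = k" using k(2) by (simp add: k_def of_nat_diff)
    then have sk: "s ^ (m - 1) = s powr k" using powr_realpow[OF s(1), of "m - 1"] by simp
    define X where "X = B * s * w ^ K"
    define Y where "Y = B * s powr k / g"
    define h where "h = B * (s * w ^ K + s ^ (m - 1) / g)"
    have hXY: "h = X + Y" unfolding h_def X_def Y_def sk by (simp add: algebra_simps)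
    have X: "X \<ge> 0" and Y: "Y \<ge> 0" using B s w g by (auto simp: X_def Y_def)
    have wpow: "w ^ i \<le> w ^ j" if "i \<le> j" for i j using w that by (rule power_increasing[rotated])
    have gth: "g \<le> g powr (1 - \<theta>)"
      using powr_mono'[of "1 - \<theta>" 1 g] g \<theta> by simp
    have gneg: "g powr (- \<theta>) * g = g powr (1 - \<theta>)"
      using g powr_add[of g "- \<theta>" 1] by simp
    have poly: "w ^ i * g \<le> E" "w ^ i * g powr (1 - \<theta>) \<le> E" if "i \<le> n" for i
    proof -
      have "w ^ i * g powr (1 - \<theta>) \<le> w ^ n * g powr (1 - \<theta>)" by (intro mult_right_mono wpow that) auto
      then show 2: "w ^ i * g powr (1 - \<theta>) \<le> E" using E1 by linarith
      have "w ^ i * g \<le> w ^ i * g powr (1 - \<theta>)" using w by (intro mult_left_mono gth) auto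
      then show "w ^ i * g \<le> E" using 2 by linarith
    qed
    have wP: "w powr p \<le> w ^ P" unfolding P_def using w p by (intro powr_le_power_ceiling) auto
    \<comment> \<open>Since \<open>(m - 1) * \<theta> = q\<close>, the power \<open>\<theta>\<close>
      turns \<open>s^(m-1) / g\<close> into \<open>s powr q * g powr (- \<theta>)\<close>; the
      factor \<open>g\<close> in the bound for \<open>f\<close> then leaves the integrable
      \<open>g powr (1 - \<theta>)\<close>.\<close>
    have Yth: "(c * Y) powr \<theta> = (c * B) powr \<theta> * s powr q * g powr (- \<theta>)" if "c \<ge> 0" for c
    proof -
      have "(c * Y) powr \<theta> = (c * B * s powr k * (1 / g)) powr \<theta>" by (simp add: Y_def mult.assoc)
      also have "\<dots> = (c * B * s powr k) powr \<theta> * (1 / g) powr \<theta>"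
        by (rule powr_mult)
      also have "(c * B * s powr k) powr \<theta> = (c * B) powr \<theta> * (s powr k) powr \<theta>"
        by (rule powr_mult)
      also have "(s powr k) powr \<theta> = s powr q" by (simp add: powr_powr \<theta>(3))
      also have "(1 / g) powr \<theta> = g powr (- \<theta>)"
        using g by (simp add: powr_divide powr_minus field_simps)
      finally show ?thesis .
    qed
    show ?thesis unfolding E_def[symmetric]
    proof (cases "w * h \<le> 1")
      case True
      have Dh: "D \<le> h" using good True unfolding h_def by blast
      have "1 * h \<le> w * h" using w X Y hXY by (intro mult_right_mono) auto
      then have h1: "h \<le> 1" using True by linarith
      have h0: "h \<ge> 0" using hXY X Y by simp
      have Y1: "Y \<le> 1" using h1 hXY X by linarith
      have Xp: "X powr p * (w ^ K * g) \<le> B powr p * s powr p * E"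
      proof -
        have "(w ^ K) powr p = (w powr p) ^ K" using w by (intro power_powr_commute) simp
        also have "\<dots> \<le> (w ^ P) ^ K" using wP by (intro power_mono) auto
        finally have 1: "(w ^ K) powr p \<le> w ^ (P * K)" by (simp add: power_mult)
        have "X powr p * (w ^ K * g) = B powr p * s powr p * ((w ^ K) powr p * (w ^ K * g))"
          unfolding X_def using B s w by (simp add: powr_mult mult_ac)
        also have "\<dots> \<le> B powr p * s powr p * (w ^ (P * K) * (w ^ K * g))"
          using 1 w g by (intro mult_left_mono mult_right_mono) auto
        also have "w ^ (P * K) * (w ^ K * g) = w ^ (P * K + K) * g" by (simp add: power_add)
        also have "B powr p * s powr p * (w ^ (P * K + K) * g) \<le> B powr p * s powr p * E"
          by (intro mult_left_mono poly) (auto simp: n_def)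
        finally show ?thesis .
      qed
      have Yp: "Y powr p * (w ^ K * g) \<le> B powr \<theta> * S powr (q - p) * s powr p * E"
      proof -
        \<comment> \<open>\<open>Y \<le> 1\<close> permits lowering the exponent from
          \<open>p\<close> to \<open>\<theta>\<close>; with exponent \<open>p\<close> the product
          with \<open>g\<close> would be \<open>g powr (1 - p)\<close>, which is not
          integrable.\<close>
        have "Y powr p \<le> Y powr \<theta>" using powr_mono'[of \<theta> p Y] Y Y1 \<theta> p by simp
        then have "Y powr p * (w ^ K * g) \<le> (B powr \<theta> * s powr q * g powr (- \<theta>)) * (w ^ K * g)"
          using Yth[of 1] w g by (intro mult_right_mono) auto
        also have "\<dots> = B powr \<theta> * s powr q * (w ^ K * g powr (1 - \<theta>))"
          unfolding gneg[symmetric] by (simp add: mult_ac)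
        also have "\<dots> \<le> B powr \<theta> * s powr q * E"
          by (intro mult_left_mono poly) (auto simp: n_def)
        also have "\<dots> \<le> B powr \<theta> * (S powr (q - p) * s powr p) * E"
          using powr_le_scaled[OF s, of p q] p E0 by (intro mult_left_mono mult_right_mono) auto
        finally show ?thesis by (simp add: mult_ac)
      qed
      have "D powr p * f \<le> h powr p * f" using Dh D f p by (intro mult_right_mono powr_mono2) auto
      also have "\<dots> \<le> h powr p * (C1 * (w ^ K * g + s ^ (m - 1) * w powr (- real m)))"
        using f by (intro mult_left_mono) auto
      also have "\<dots> = C1 * (h powr p * (w ^ K * g) + h powr p * (s powr k * w powr (- real m)))"
        unfolding sk by (simp add: algebra_simps)
      also have "\<dots> \<le> C1 * (2 powr p * (B powr p * s powr p * E + B powr \<theta> * S powr (q - p) * s powr p * E) + S powr (k - p) * s powr p * E)"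
      proof (intro mult_left_mono add_mono C1)
        have "h powr p * (w ^ K * g) \<le> (2 powr p * (X powr p + Y powr p)) * (w ^ K * g)"
          unfolding hXY using X Y p w g by (intro mult_right_mono powr_add_le) auto
        also have "\<dots> = 2 powr p * (X powr p * (w ^ K * g) + Y powr p * (w ^ K * g))" by (simp add: algebra_simps)
        also have "\<dots> \<le> 2 powr p * (B powr p * s powr p * E + B powr \<theta> * S powr (q - p) * s powr p * E)"
          by (intro mult_left_mono add_mono Xp Yp) auto
        finally show "h powr p * (w ^ K * g) \<le> 2 powr p * (B powr p * s powr p * E + B powr \<theta> * S powr (q - p) * s powr p * E)" .
        have "h powr p \<le> 1" using h0 h1 p by (intro powr_le1) auto
        then have "h powr p * (s powr k * w powr (- real m)) \<le> 1 * (s powr k * w powr (- real m))"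
          by (intro mult_right_mono) auto
        also have "\<dots> \<le> (S powr (k - p) * s powr p) * w powr (p - real m)"
          unfolding mult_1 using powr_le_scaled[OF s, of p k] k p w by (intro mult_mono) (auto intro!: powr_mono)
        also have "\<dots> \<le> (S powr (k - p) * s powr p) * E" by (intro mult_left_mono E2) auto
        finally show "h powr p * (s powr k * w powr (- real m)) \<le> S powr (k - p) * s powr p * E" .
      qed
      also have "\<dots> = Cg * s powr p * E" by (simp add: Cg_def algebra_simps)
      also have "\<dots> \<le> C * s powr p * E"
        using nn E0 by (intro mult_right_mono) (auto simp: C_def)
      also have "\<dots> \<le> C * s powr p * E + 2 powr p * s powr p * b powr (p + r) * f"
        using f by simp
      finally show "D powr p * f \<le> C * s powr p * E + 2 powr p * s powr p * b powr (p + r) * f" .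
    next
      case False
      define \<beta> where "\<beta> = (2 * w * X) powr q + (2 * w * Y) powr \<theta>"
      have \<beta>1: "1 \<le> \<beta>"
      proof -
        have "1 < w * X + w * Y" using False hXY by (simp add: algebra_simps)
        then consider "1 \<le> 2 * w * X" | "1 \<le> 2 * w * Y" by linarith
        then show ?thesis
        proof cases
          case 1
          then have "1 \<le> (2 * w * X) powr q" using p by (intro ge_one_powr_ge_zero) auto
          then show ?thesis unfolding \<beta>_def by (simp add: add_increasing2)
        next
          case 2
          then have "1 \<le> (2 * w * Y) powr \<theta>" using \<theta> by (intro ge_one_powr_ge_zero) auto
          then show ?thesis unfolding \<beta>_def by (simp add: add_increasing)
        qed
      qed
      have wf: "w powr p * f \<le> Cb * s powr q * E"
      proof -
        have wQ: "w powr q \<le> w ^ Q" unfolding Q_def using w p by (intro powr_le_power_ceiling) auto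
        have 1: "(2 * w * X) powr q * (w powr p * (w ^ K * g)) \<le> (2 * B) powr q * s powr q * E"
        proof -
          have "(w ^ (K + 1)) powr q = (w powr q) ^ (K + 1)"
            using w by (intro power_powr_commute) simp
          also have "\<dots> \<le> (w ^ Q) ^ (K + 1)" using wQ by (intro power_mono) auto
          finally have 2: "(w ^ (K + 1)) powr q \<le> w ^ (Q * (K + 1))" by (simp only: power_mult)
          have "(2 * w * X) powr q = ((2 * B) * s * w ^ (K + 1)) powr q" by (simp add: X_def mult_ac)
          also have "\<dots> = (2 * B) powr q * s powr q * (w ^ (K + 1)) powr q"
            using B s w by (simp only: powr_mult)
          finally have "(2 * w * X) powr q * (w powr p * (w ^ K * g)) = (2 * B) powr q * s powr q * ((w ^ (K + 1)) powr q * (w powr p * (w ^ K * g)))"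
            by (simp only: mult_ac)
          also have "\<dots> \<le> (2 * B) powr q * s powr q * (w ^ (Q * (K + 1)) * (w ^ P * (w ^ K * g)))"
            using 2 wP w g by (intro mult_left_mono mult_mono) auto
          also have "w ^ (Q * (K + 1)) * (w ^ P * (w ^ K * g)) = w ^ (Q * (K + 1) + P + K) * g"
            by (simp only: power_add mult.assoc)
          also have "(2 * B) powr q * s powr q * (w ^ (Q * (K + 1) + P + K) * g) \<le> (2 * B) powr q * s powr q * E"
            by (intro mult_left_mono poly) (auto simp: n_def mult.commute)
          finally show ?thesis .
        qed
        have 3: "(2 * w * Y) powr \<theta> * (w powr p * (w ^ K * g)) \<le> (2 * B) powr \<theta> * s powr q * E"
        proof -
          have "w powr \<theta> \<le> w powr 1" using w \<theta> by (intro powr_mono) auto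
          then have w\<theta>: "w powr \<theta> \<le> w" using w by simp
          have "(2 * w * Y) powr \<theta> * (w powr p * (w ^ K * g)) = (2 * w * B) powr \<theta> * s powr q * (w powr p * w ^ K * (g powr (- \<theta>) * g))"
            using Yth[of "2 * w"] w by (simp add: mult_ac)
          also have "(2 * w * B) powr \<theta> = (2 * B) powr \<theta> * w powr \<theta>"
            using B w by (simp add: powr_mult)
          also have "(2 * B) powr \<theta> * w powr \<theta> * s powr q * (w powr p * w ^ K * (g powr (- \<theta>) * g)) =
            (2 * B) powr \<theta> * s powr q * (w powr \<theta> * (w powr p * w ^ K) * g powr (1 - \<theta>))"
            unfolding gneg by (simp add: mult_ac)
          also have "\<dots> \<le> (2 * B) powr \<theta> * s powr q * (w * (w ^ P * w ^ K) * g powr (1 - \<theta>))"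
            using wP w\<theta> w by (intro mult_left_mono mult_right_mono mult_mono) auto
          also have "w * (w ^ P * w ^ K) = w ^ (1 + P + K)" by (simp add: power_add)
          also have "(2 * B) powr \<theta> * s powr q * (w ^ (1 + P + K) * g powr (1 - \<theta>)) \<le> (2 * B) powr \<theta> * s powr q * E"
            by (intro mult_left_mono poly) (auto simp: n_def)
          finally show ?thesis .
        qed
        have 4: "s powr k * w powr (p - real m) \<le> S powr (k - q) * s powr q * E"
          using powr_le_scaled[OF s, of q k] k E2 E0 by (intro mult_mono) auto
        have "w powr p * f \<le> w powr p * (C1 * (w ^ K * g + s ^ (m - 1) * w powr (- real m)))"
          using f by (intro mult_left_mono) auto
        also have "\<dots> = C1 * (1 * (w powr p * (w ^ K * g)) + s powr k * w powr (p - real m))"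
          unfolding sk using w by (simp add: powr_diff powr_minus field_simps)
        \<comment> \<open>The factor \<open>\<beta>\<close> is spent on the Gaussian part only; the
          other term already carries \<open>s^(m-1)\<close>, and \<open>q < m - 1\<close>.\<close>
        also have "\<dots> \<le> C1 * (\<beta> * (w powr p * (w ^ K * g)) + s powr k * w powr (p - real m))"
          using C1 \<beta>1 w g by (intro mult_left_mono add_mono mult_right_mono) auto
        also have "\<dots> = C1 * ((2 * w * X) powr q * (w powr p * (w ^ K * g)) + (2 * w * Y) powr \<theta> * (w powr p * (w ^ K * g)) + s powr k * w powr (p - real m))"
          by (simp add: \<beta>_def algebra_simps)
        also have "\<dots> \<le> C1 * ((2 * B) powr q * s powr q * E + (2 * B) powr \<theta> * s powr q * E + S powr (k - q) * s powr q * E)"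
          by (intro mult_left_mono add_mono 1 3 4 C1)
        finally show ?thesis by (simp add: Cb_def algebra_simps)
      qed
      have fw: "f \<le> w powr p * f"
        using mult_right_mono[of 1 "w powr p" f] f w p by (simp add: ge_one_powr_ge_zero)
      \<comment> \<open>The level is chosen so that \<open>L powr p = s powr (p - q)\<close>, which
        the gain \<open>s powr q\<close> brings down to \<open>s powr p\<close>. Requiring
        \<open>L powr (- r) = s powr p\<close> as well is what fixes
        \<open>r = p * p / (q - p)\<close>.\<close>
      define L where "L = s powr (- (q - p) / p)"
      have L: "L > 0" using s by (simp add: L_def)
      have Lp: "L powr p = s powr (p - q)" using p by (simp add: L_def powr_powr)
      have "(- d / p) * (- (p * p / d)) = p" if "d \<noteq> 0" for d
        using that p by simp
      from this[of "q - p"] have "(- (q - p) / p) * (- (p * p / (q - p))) = p" using p by linarith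
      then have Lr: "L powr (- r) = s powr p" by (simp only: L_def r_def powr_powr)
      have "D powr p * f \<le> (b + a) powr p * f" using D f p by (intro mult_right_mono powr_mono2) auto
      also have "\<dots> \<le> (2 powr p * (b powr p + a powr p)) * f"
        using a b p f by (intro mult_right_mono powr_add_le) auto
      also have "\<dots> \<le> (2 powr p * ((s powr (p - q) + s powr p * b powr (p + r)) + w powr p)) * f"
      proof (intro mult_right_mono mult_left_mono add_mono f)
        show "b powr p \<le> s powr (p - q) + s powr p * b powr (p + r)"
          using powr_truncate_le[OF b L, of p r] p r unfolding Lp Lr by simp
        show "a powr p \<le> w powr p" using a p by (intro powr_mono2) auto
      qed auto
      also have "\<dots> = 2 powr p * (s powr (p - q) * f + w powr p * f) + 2 powr p * s powr p * b powr (p + r) * f"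
        by (simp add: algebra_simps)
      also have "\<dots> \<le> 2 powr p * (s powr (p - q) * (Cb * s powr q * E) + Cb * s powr q * E) + 2 powr p * s powr p * b powr (p + r) * f"
        using wf fw by (intro add_mono mult_left_mono order_refl) auto
      also have "s powr (p - q) * (Cb * s powr q * E) = Cb * s powr p * E"
        using s powr_add[of s "p - q" q] by (simp add: mult_ac)
      also have "2 powr p * (Cb * s powr p * E + Cb * s powr q * E) + 2 powr p * s powr p * b powr (p + r) * f \<le>
        2 powr p * (Cb * s powr p * E + Cb * (S powr (q - p) * s powr p) * E) + 2 powr p * s powr p * b powr (p + r) * f"
        using powr_le_scaled[OF s, of p q] p nn E0 by (intro add_mono mult_left_mono mult_right_mono order_refl) auto
      also have "\<dots> = (C - Cg) * s powr p * E + 2 powr p * s powr p * b powr (p + r) * f"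
        by (simp add: C_def algebra_simps)
      also have "\<dots> \<le> C * s powr p * E + 2 powr p * s powr p * b powr (p + r) * f"
        using nn E0 by (intro add_mono mult_right_mono order_refl) auto
      finally show "D powr p * f \<le> C * s powr p * E + 2 powr p * s powr p * b powr (p + r) * f" .
    qed
  qed
  ultimately show ?thesis by blast
qed

lemma ennreal_finite_bound:
  assumes "x < (\<infinity>::ennreal)"
  obtains c where "c \<ge> 0" "x = ennreal c"
  using assms by (cases x) auto

text \<open>Tail integrals of the density error bound the gap between the distribution functions;
  dividing by the normal density at \<open>y\<close> gives the displacement bound, and
  \<open>transport_pointwise\<close> is then integrated. The constant depends on \<open>f\<close>
  only through the parameters of \<open>near_normal\<close>, which is what makes it uniform in
  \<open>n\<close> later.\<close>

theorem transport_to_std_normal: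
  fixes p S C0 :: real and m K :: nat
  assumes p: "1 \<le> p" "p < real m - 1" and C0: "C0 \<ge> 0" and S: "S > 0"
  shows "\<exists>C\<ge>0. \<forall>s f. 0 < s \<longrightarrow> s \<le> S \<longrightarrow> f \<in> borel_measurable borel \<longrightarrow> (\<forall>y. 0 \<le> f y) \<longrightarrow>
    prob_space (dens f) \<longrightarrow>
    near_normal C0 K m s f \<longrightarrow>
    (\<integral>\<^sup>+y. ennreal (\<bar>y\<bar> powr p) \<partial>dens f) \<le> ennreal C \<and>
    (\<exists>T\<in>borel_measurable borel. distr (dens f) borel T = \<N> \<and>
      (\<integral>\<^sup>+y. ennreal (\<bar>T y - y\<bar> powr p) \<partial>dens f) \<le> ennreal (C * s powr p))"
proof -
  \<comment> \<open>The room between \<open>p\<close> and \<open>m - 1\<close> is spent on the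
    region where the displacement bound is void.\<close>
  obtain q where q: "p < q" "q < real m - 1" using p(2) dense by blast
  define \<theta> where "\<theta> = q / (real m - 1)"
  define r where "r = p * p / (q - p)"
  have \<theta>: "\<theta> < 1" using q p by (simp add: \<theta>_def)
  have m1: "1 < real m" "1 < real m - p" using p by linarith+
  obtain A where A: "A \<ge> 0" "\<And>y. y \<ge> 0 \<Longrightarrow> (\<integral>\<^sup>+u. ennreal (wt u ^ K * gauss u) * indicator {y..} u \<partial>lborel) \<le> ennreal (A * wt y ^ K * gauss y)"
    using gauss_upper_tail[of K] by blast
  obtain Dm where Dm: "Dm \<ge> 0" "(\<integral>\<^sup>+y. ennreal (wt y powr (- real m)) \<partial>lborel) = ennreal Dm"
    using ennreal_finite_bound[OF nn_integral_powr_tail_finite[OF m1(1)]] by metis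
  obtain Dp where Dp: "Dp \<ge> 0" "(\<integral>\<^sup>+y. ennreal (wt y powr (p - real m)) \<partial>lborel) = ennreal Dp"
    using ennreal_finite_bound[OF nn_integral_powr_tail_finite[OF m1(2)]] by (metis minus_diff_eq)
  \<comment> \<open>\<open>exp (3 / 2)\<close> cancels the constant of
    \<open>std_normal_cdf_increment\<close>, and \<open>C0 * (A + Dm)\<close> dominates both
    constants in the gap between the distribution functions.\<close>
  define B where "B = exp (3 / 2) * (C0 * (A + Dm))"
  have B: "B \<ge> 0" using C0 A Dm by (simp add: B_def)
  define C1 where "C1 = 1 + C0 * (S + 1)"
  have C1: "C1 \<ge> 1" using C0 S by (simp add: C1_def)
  obtain C n where C: "C \<ge> 0" and pw: "\<And>s w g f a b D. 0 < s \<Longrightarrow> s \<le> S \<Longrightarrow> 1 \<le> w \<Longrightarrow> 0 < g \<Longrightarrow> g \<le> 1 \<Longrightarrow> 0 \<le> f \<Longrightarrow>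
    f \<le> C1 * (w ^ K * g + s ^ (m - 1) * w powr (- real m)) \<Longrightarrow> 0 \<le> a \<Longrightarrow> a \<le> w \<Longrightarrow> 0 \<le> b \<Longrightarrow> 0 \<le> D \<Longrightarrow> D \<le> b + a \<Longrightarrow>
    (w * (B * (s * w ^ K + s ^ (m - 1) / g)) \<le> 1 \<longrightarrow> D \<le> B * (s * w ^ K + s ^ (m - 1) / g)) \<Longrightarrow>
    D powr p * f \<le> C * s powr p * (w ^ n * g powr (1 - \<theta>) + w powr (p - real m)) + 2 powr p * s powr p * b powr (p + r) * f"
    using transport_pointwise[OF p(1) q B order_trans[OF zero_le_one C1] S, of K] unfolding \<theta>_def r_def by metis
  have fin: "(\<integral>\<^sup>+y. ennreal (wt y ^ i * exp (- ((1 - \<theta>) / 2) * y\<^sup>2)) \<partial>lborel) < \<infinity>" for i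
    using \<theta> by (intro nn_integral_poly_gauss_finite) simp
  obtain G where G: "G \<ge> 0" "(\<integral>\<^sup>+y. ennreal (wt y ^ n * exp (- ((1 - \<theta>) / 2) * y\<^sup>2)) \<partial>lborel) = ennreal G"
    using ennreal_finite_bound[OF fin] by metis
  define P where "P = nat \<lceil>p\<rceil>"
  define R where "R = nat \<lceil>p + r\<rceil>"
  have r0: "r \<ge> 0" using p q by (simp add: r_def)
  have finP: "(\<integral>\<^sup>+y. ennreal (wt y ^ i * exp (- (1 / 2) * y\<^sup>2)) \<partial>lborel) < \<infinity>" for i
    by (intro nn_integral_poly_gauss_finite) simp
  obtain GP where GP: "GP \<ge> 0" "(\<integral>\<^sup>+y. ennreal (wt y ^ (P + K) * exp (- (1 / 2) * y\<^sup>2)) \<partial>lborel) = ennreal GP"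
    using ennreal_finite_bound[OF finP] by metis
  obtain GR where GR: "GR \<ge> 0" "(\<integral>\<^sup>+y. ennreal (wt y ^ R * exp (- (1 / 2) * y\<^sup>2)) \<partial>lborel) = ennreal GR"
    using ennreal_finite_bound[OF finP] by metis
  have JR: "(\<integral>\<^sup>+y. ennreal (\<bar>y\<bar> powr (p + r)) \<partial>\<N>) \<le> ennreal GR"
  proof -
    have "(\<integral>\<^sup>+y. ennreal (\<bar>y\<bar> powr (p + r)) \<partial>\<N>) = (\<integral>\<^sup>+y. ennreal (gauss y) * ennreal (\<bar>y\<bar> powr (p + r)) \<partial>lborel)"
      by (rule nn_integral_density) auto
    also have "\<dots> \<le> (\<integral>\<^sup>+y. ennreal (wt y ^ R * exp (- (1 / 2) * y\<^sup>2)) \<partial>lborel)"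
    proof (intro nn_integral_mono)
      fix y
      have "\<bar>y\<bar> powr (p + r) \<le> wt y powr (p + r)" using p r0 by (intro powr_mono2) auto
      also have "\<dots> \<le> wt y ^ R" unfolding R_def using p r0 by (intro powr_le_power_ceiling) auto
      finally have "gauss y * \<bar>y\<bar> powr (p + r) \<le> gexp y * wt y ^ R"
        using gauss_le_exp[of y] by (intro mult_mono) auto
      then show "ennreal (gauss y) * ennreal (\<bar>y\<bar> powr (p + r)) \<le> ennreal (wt y ^ R * exp (- (1 / 2) * y\<^sup>2))"
        by (subst ennreal_mult[symmetric]) (auto intro!: ennreal_leI simp: mult.commute)
    qed
    finally show ?thesis unfolding GR .
  qed
  define CM where "CM = C1 * (GP + S ^ (m - 1) * Dp)"
  define CT where "CT = C * (G + Dp) + 2 powr p * GR"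
  have nn: "CM \<ge> 0" "CT \<ge> 0"
    using C C1 GP G GR Dp S by (auto simp: CM_def CT_def intro!: add_nonneg_nonneg mult_nonneg_nonneg)
  have main: "(\<integral>\<^sup>+y. ennreal (\<bar>y\<bar> powr p) \<partial>dens f) \<le> ennreal CM \<and>
    (\<exists>T\<in>borel_measurable borel. distr (dens f) borel T = \<N> \<and>
      (\<integral>\<^sup>+y. ennreal (\<bar>T y - y\<bar> powr p) \<partial>dens f) \<le> ennreal (CT * s powr p))"
    if s: "0 < s" "s \<le> S" and f[measurable]: "f \<in> borel_measurable borel" and f0: "\<And>y. 0 \<le> f y"
      and prob: "prob_space (dens f)"
      and close: "\<And>y. \<bar>f y - gauss y\<bar> \<le> C0 * (s * wt y ^ K * gauss y + s ^ (m - 1) * wt y powr (- real m))"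
    for s f
  proof -
    define \<mu> where "\<mu> = dens f"
    interpret quantile_transform \<mu> \<N>
      unfolding \<mu>_def by (rule quantile_transform_std_normal[OF prob f])
    have f_le: "f y \<le> C1 * (wt y ^ K * gauss y + s ^ (m - 1) * wt y powr (- real m))" for y
    proof -
      let ?g = "wt y ^ K * gauss y" and ?t = "s ^ (m - 1) * wt y powr (- real m)"
      have "1 * gauss y \<le> ?g" using gauss_pos[of y] by (intro mult_right_mono one_le_power) auto
      moreover have "f y \<le> gauss y + C0 * (s * ?g + ?t)"
        using close[of y] by (simp add: abs_le_iff algebra_simps)
      moreover have "C0 * (s * ?g + ?t) \<le> C0 * (S + 1) * ?g + C0 * (S + 1) * ?t"
      proof -
        have 0: "?g \<ge> 0" "?t \<ge> 0" using gauss_pos[of y] s by (auto intro!: mult_nonneg_nonneg simp: less_imp_le)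
        have "s * ?g + ?t \<le> (S + 1) * ?g + (S + 1) * ?t"
          using 0 s S mult_right_mono[of s "S + 1" ?g] mult_right_mono[of 1 "S + 1" ?t] by linarith
        from mult_left_mono[OF this C0] show ?thesis by (simp add: algebra_simps)
      qed
      moreover have "?t \<ge> 0" using s by simp
      ultimately have "f y \<le> ?g + C0 * (S + 1) * ?g + (C0 * (S + 1) * ?t + ?t)" by linarith
      then show ?thesis by (simp add: C1_def algebra_simps)
    qed
    define d where "d y = C0 * (s * wt y ^ K * gauss y + s ^ (m - 1) * wt y powr (- real m))" for y
    have d0: "d y \<ge> 0" for y
      unfolding d_def using C0 s gauss_pos[of y] by (intro mult_nonneg_nonneg add_nonneg_nonneg) (auto simp: less_imp_le)
    have [measurable]: "d \<in> borel_measurable borel" unfolding d_def by measurable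
    define \<beta> where "\<beta> y = C0 * (s * (A * wt y ^ K * gauss y) + s ^ (m - 1) * Dm)" for y
    have \<beta>0: "\<beta> y \<ge> 0" for y
      unfolding \<beta>_def using C0 s A Dm gauss_pos[of y] by (intro mult_nonneg_nonneg add_nonneg_nonneg) (auto simp: less_imp_le)
    have tail: "(\<integral>\<^sup>+u. ennreal (d u) * indicator U u \<partial>lborel) \<le> ennreal (\<beta> y)"
      if [measurable]: "U \<in> sets borel" and U: "(\<integral>\<^sup>+u. ennreal (wt u ^ K * gauss u) * indicator U u \<partial>lborel) \<le> ennreal (A * wt y ^ K * gauss y)" for U y
    proof -
      have "(\<integral>\<^sup>+u. ennreal (d u) * indicator U u \<partial>lborel) \<le>
        (\<integral>\<^sup>+u. ennreal (C0 * s) * (ennreal (wt u ^ K * gauss u) * indicator U u) + ennreal (C0 * s ^ (m - 1)) * ennreal (wt u powr (- real m)) \<partial>lborel)"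
      proof (intro nn_integral_mono)
        fix u
        have "ennreal (d u) = ennreal ((C0 * s) * (wt u ^ K * gauss u)) + ennreal ((C0 * s ^ (m - 1)) * wt u powr (- real m))"
          unfolding d_def using C0 s gauss_pos[of u]
          by (subst ennreal_plus[symmetric]) (auto simp: less_imp_le algebra_simps intro!: mult_nonneg_nonneg)
        also have "\<dots> = ennreal (C0 * s) * ennreal (wt u ^ K * gauss u) + ennreal (C0 * s ^ (m - 1)) * ennreal (wt u powr (- real m))"
          using C0 s gauss_pos[of u] by (simp only: ennreal_mult mult_nonneg_nonneg less_imp_le zero_le_power powr_ge_zero abs_ge_zero add_nonneg_nonneg zero_le_one)
        finally show "ennreal (d u) * indicator U u \<le> ennreal (C0 * s) * (ennreal (wt u ^ K * gauss u) * indicator U u) + ennreal (C0 * s ^ (m - 1)) * ennreal (wt u powr (- real m))"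
          by (auto simp: indicator_def)
      qed
      also have "\<dots> = ennreal (C0 * s) * (\<integral>\<^sup>+u. ennreal (wt u ^ K * gauss u) * indicator U u \<partial>lborel) + ennreal (C0 * s ^ (m - 1)) * ennreal Dm"
        unfolding Dm(2)[symmetric] by (subst nn_integral_add) (auto simp: nn_integral_cmult)
      also have "\<dots> \<le> ennreal (C0 * s) * ennreal (A * wt y ^ K * gauss y) + ennreal (C0 * s ^ (m - 1)) * ennreal Dm"
        by (intro add_right_mono mult_left_mono U) auto
      also have "\<dots> = ennreal (\<beta> y)"
      proof -
        have "ennreal (C0 * s) * ennreal (A * wt y ^ K * gauss y) = ennreal (C0 * s * (A * wt y ^ K * gauss y))"
          using C0 s A gauss_pos[of y] by (intro ennreal_mult[symmetric]) (auto intro!: mult_nonneg_nonneg simp: less_imp_le)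
        moreover have "ennreal (C0 * s ^ (m - 1)) * ennreal Dm = ennreal (C0 * s ^ (m - 1) * Dm)"
          using C0 s Dm by (intro ennreal_mult[symmetric]) auto
        moreover have "ennreal (\<beta> y) = ennreal (C0 * s * (A * wt y ^ K * gauss y)) + ennreal (C0 * s ^ (m - 1) * Dm)"
          unfolding \<beta>_def distrib_left mult.assoc[of C0, symmetric] using C0 s A(1) Dm(1) gauss_pos[of y]
          by (intro ennreal_plus) (auto intro!: mult_nonneg_nonneg simp: less_imp_le)
        ultimately show ?thesis by simp
      qed
      finally show ?thesis .
    qed
    have diff: "\<bar>measure \<mu> U - measure \<N> U\<bar> \<le> \<beta> y"
      if "U \<in> sets borel" "(\<integral>\<^sup>+u. ennreal (d u) * indicator U u \<partial>lborel) \<le> ennreal (\<beta> y)" for U y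
      using that d0 f0 \<beta>0 close gauss_pos
      by (intro measure_diff_bound[where f = f and g = gauss and d = d])
        (auto simp: \<mu>_def d_def less_imp_le intro: mu.real_distribution_axioms[unfolded \<mu>_def] nu.real_distribution_axioms)
    \<comment> \<open>The right tail is used for \<open>y \<ge> 0\<close> and the left tail for
      \<open>y < 0\<close>: integrating on the side away from the origin keeps the factor
      \<open>gauss y\<close> in the bound.\<close>
    have cdf_close: "\<bar>cdf \<mu> y - \<Phi> y\<bar> \<le> \<beta> y" for y
    proof (cases "y \<ge> 0")
      case True
      have "(\<integral>\<^sup>+u. ennreal (d u) * indicator {y<..} u \<partial>lborel) \<le> (\<integral>\<^sup>+u. ennreal (d u) * indicator {y..} u \<partial>lborel)"
        by (intro nn_integral_mono) (auto simp: indicator_def)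
      also have "\<dots> \<le> ennreal (\<beta> y)" by (intro tail A True) simp
      finally have "\<bar>measure \<mu> {y<..} - measure \<N> {y<..}\<bar> \<le> \<beta> y" by (intro diff) auto
      moreover have "cdf \<rho> y = 1 - measure \<rho> {y<..}" if "real_distribution \<rho>" for \<rho>
      proof -
        interpret real_distribution \<rho> by fact
        have "UNIV - {y<..} = {..y}" by auto
        then show ?thesis using prob_compl[of "{y<..}"] by (simp add: cdf_def2)
      qed
      ultimately show ?thesis
        using mu.real_distribution_axioms nu.real_distribution_axioms by (simp add: abs_minus_commute)
    next
      case False
      then have "(\<integral>\<^sup>+u. ennreal (wt u ^ K * gauss u) * indicator {- y..} u \<partial>lborel) \<le> ennreal (A * wt (- y) ^ K * gauss (- y))"
        by (intro A) simp
      from tail[OF _ gauss_lower_tail[OF this]] show ?thesis unfolding cdf_def2 by (intro diff) auto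
    qed
    define T where "T = quantile_map"
    have [measurable]: "T \<in> borel_measurable borel" unfolding T_def by simp
    define h where "h y = B * (s * wt y ^ K + s ^ (m - 1) / gauss y)" for y
    have T_close: "\<bar>T y - y\<bar> \<le> h y" if y: "wt y * h y \<le> 1" for y
    proof -
      have h0: "h y \<ge> 0" unfolding h_def using B s gauss_pos[of y] by (intro mult_nonneg_nonneg add_nonneg_nonneg) (auto simp: less_imp_le)
      have "exp (- 3 / 2) * gauss y * h y = C0 * (A + Dm) * (s * (wt y ^ K * gauss y) + s ^ (m - 1))"
      proof -
        have "exp (- 3 / 2) * exp (3 / 2) = (1::real)" by (simp flip: exp_add)
        moreover have "gauss y * (s * wt y ^ K + s ^ (m - 1) / gauss y) = s * (wt y ^ K * gauss y) + s ^ (m - 1)"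
          using gauss_pos[of y] by (simp add: distrib_left mult_ac)
        moreover have "exp (- 3 / 2) * gauss y * h y = (exp (- 3 / 2) * exp (3 / 2)) * (C0 * (A + Dm)) * (gauss y * (s * wt y ^ K + s ^ (m - 1) / gauss y))"
          unfolding h_def B_def by (simp only: mult_ac)
        ultimately show ?thesis by simp
      qed
      moreover have "\<beta> y \<le> C0 * (A + Dm) * (s * (wt y ^ K * gauss y) + s ^ (m - 1))"
      proof -
        have "C0 * (A + Dm) * (s * (wt y ^ K * gauss y) + s ^ (m - 1)) - \<beta> y = C0 * (Dm * (s * (wt y ^ K * gauss y)) + A * s ^ (m - 1))"
          unfolding \<beta>_def by (simp add: algebra_simps)
        moreover have "\<dots> \<ge> 0"
          using C0 A Dm s gauss_pos[of y] by (intro mult_nonneg_nonneg add_nonneg_nonneg) (auto simp: less_imp_le)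
        ultimately show ?thesis by linarith
      qed
      ultimately have "\<bar>cdf \<mu> y - \<Phi> y\<bar> \<le> exp (- 3 / 2) * gauss y * h y"
        using cdf_close[of y] by linarith
      then show ?thesis
        unfolding T_def using std_normal_cdf_increment[OF h0 y] by (intro quantile_map_close) linarith+
    qed
    have E_int: "(\<integral>\<^sup>+y. ennreal (wt y ^ n * gauss y powr (1 - \<theta>) + wt y powr (p - real m)) \<partial>lborel) \<le> ennreal (G + Dp)"
    proof -
      have "(\<integral>\<^sup>+y. ennreal (wt y ^ n * gauss y powr (1 - \<theta>) + wt y powr (p - real m)) \<partial>lborel) \<le>
        (\<integral>\<^sup>+y. ennreal (wt y ^ n * exp (- ((1 - \<theta>) / 2) * y\<^sup>2)) + ennreal (wt y powr (p - real m)) \<partial>lborel)"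
      proof (intro nn_integral_mono)
        fix y
        have "gauss y powr (1 - \<theta>) \<le> gexp y powr (1 - \<theta>)"
          using gauss_le_exp[of y] gauss_pos[of y] \<theta> by (intro powr_mono2) (auto simp: less_imp_le)
        also have "\<dots> = exp (- ((1 - \<theta>) / 2) * y\<^sup>2)" by (simp add: powr_def)
        finally have "wt y ^ n * gauss y powr (1 - \<theta>) \<le> wt y ^ n * exp (- ((1 - \<theta>) / 2) * y\<^sup>2)"
          by (intro mult_left_mono) auto
        then show "ennreal (wt y ^ n * gauss y powr (1 - \<theta>) + wt y powr (p - real m)) \<le> ennreal (wt y ^ n * exp (- ((1 - \<theta>) / 2) * y\<^sup>2)) + ennreal (wt y powr (p - real m))"
          by (subst ennreal_plus[symmetric]) (auto intro!: ennreal_leI)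
      qed
      also have "\<dots> = ennreal G + ennreal Dp"
        unfolding G(2)[symmetric] Dp(2)[symmetric] by (rule nn_integral_add) auto
      finally show ?thesis using G Dp by simp
    qed
    have "(\<integral>\<^sup>+y. ennreal (\<bar>y\<bar> powr p) \<partial>\<mu>) \<le> ennreal CM"
    proof -
      have "(\<integral>\<^sup>+y. ennreal (\<bar>y\<bar> powr p) \<partial>\<mu>) = (\<integral>\<^sup>+y. ennreal (f y) * ennreal (\<bar>y\<bar> powr p) \<partial>lborel)"
        unfolding \<mu>_def by (rule nn_integral_density) auto
      also have "\<dots> \<le> (\<integral>\<^sup>+y. ennreal C1 * (ennreal (wt y ^ (P + K) * exp (- (1 / 2) * y\<^sup>2)) + ennreal (S ^ (m - 1)) * ennreal (wt y powr (p - real m))) \<partial>lborel)"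
      proof (intro nn_integral_mono)
        fix y :: real
        let ?w = "1 + \<bar>y\<bar>"
        have "\<bar>y\<bar> powr p \<le> ?w powr p" using p by (intro powr_mono2) auto
        then have "f y * \<bar>y\<bar> powr p \<le> C1 * (?w ^ K * gauss y + s ^ (m - 1) * ?w powr (- real m)) * ?w powr p"
          using f_le[of y] f0[of y] C1 gauss_pos[of y] s
          by (intro mult_mono) (auto intro!: mult_nonneg_nonneg add_nonneg_nonneg simp: less_imp_le)
        also have "\<dots> = C1 * (?w powr p * ?w ^ K * gauss y + s ^ (m - 1) * ?w powr (p - real m))"
          by (simp add: powr_diff powr_minus field_simps)
        also have "\<dots> \<le> C1 * (?w ^ (P + K) * exp (- (1 / 2) * y\<^sup>2) + S ^ (m - 1) * ?w powr (p - real m))"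
        proof (intro mult_left_mono add_mono mult_right_mono)
          have "?w powr p \<le> ?w ^ P" unfolding P_def using p by (intro powr_le_power_ceiling) auto
          then have "?w powr p * ?w ^ K \<le> ?w ^ (P + K)" unfolding power_add by (intro mult_right_mono) auto
          then show "?w powr p * ?w ^ K * gauss y \<le> ?w ^ (P + K) * exp (- (1 / 2) * y\<^sup>2)"
            using gauss_le_exp[of y] gauss_pos[of y] by (intro mult_mono) (auto simp: less_imp_le)
          show "s ^ (m - 1) \<le> S ^ (m - 1)" using s by (intro power_mono) auto
        qed (use C1 in auto)
        finally have "ennreal (f y * \<bar>y\<bar> powr p) \<le> ennreal (C1 * (?w ^ (P + K) * exp (- (1 / 2) * y\<^sup>2) + S ^ (m - 1) * ?w powr (p - real m)))"
          by (rule ennreal_leI)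
        moreover have "ennreal (f y * \<bar>y\<bar> powr p) = ennreal (f y) * ennreal (\<bar>y\<bar> powr p)"
          using f0 by (intro ennreal_mult) auto
        moreover have "ennreal (C1 * (?w ^ (P + K) * exp (- (1 / 2) * y\<^sup>2) + S ^ (m - 1) * ?w powr (p - real m))) =
          ennreal C1 * (ennreal (?w ^ (P + K) * exp (- (1 / 2) * y\<^sup>2)) + ennreal (S ^ (m - 1)) * ennreal (?w powr (p - real m)))"
          using C1 S by (simp add: ennreal_mult ennreal_plus)
        ultimately show "ennreal (f y) * ennreal (\<bar>y\<bar> powr p) \<le> ennreal C1 * (ennreal (?w ^ (P + K) * exp (- (1 / 2) * y\<^sup>2)) + ennreal (S ^ (m - 1)) * ennreal (?w powr (p - real m)))"
          by simp
      qed
      also have "\<dots> = ennreal C1 * (ennreal GP + ennreal (S ^ (m - 1)) * ennreal Dp)"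
        unfolding GP(2)[symmetric] Dp(2)[symmetric]
        by (subst nn_integral_cmult, simp, subst nn_integral_add) (auto simp: nn_integral_cmult)
      also have "\<dots> = ennreal CM"
        unfolding CM_def using C1 GP Dp S by (simp add: ennreal_mult ennreal_plus)
      finally show ?thesis .
    qed
    moreover have "(\<integral>\<^sup>+y. ennreal (\<bar>T y - y\<bar> powr p) \<partial>\<mu>) \<le> ennreal (CT * s powr p)"
    proof -
      let ?E = "\<lambda>y. wt y ^ n * gauss y powr (1 - \<theta>) + wt y powr (p - real m)"
      have E0: "?E y \<ge> 0" for y by simp
      \<comment> \<open>\<open>T\<close> carries the law with density \<open>f\<close> to the normal
        law, so a high moment of \<open>T\<close> is a normal moment, although the law with density
        \<open>f\<close> need not have moments of order \<open>p + r\<close>.\<close>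
      have JT: "(\<integral>\<^sup>+y. ennreal (f y) * ennreal (\<bar>T y\<bar> powr (p + r)) \<partial>lborel) \<le> ennreal GR"
      proof -
        have "(\<integral>\<^sup>+y. ennreal (f y) * ennreal (\<bar>T y\<bar> powr (p + r)) \<partial>lborel) = (\<integral>\<^sup>+y. ennreal (\<bar>T y\<bar> powr (p + r)) \<partial>\<mu>)"
          unfolding \<mu>_def by (rule nn_integral_density[symmetric]) auto
        also have "\<dots> = (\<integral>\<^sup>+z. ennreal (\<bar>z\<bar> powr (p + r)) \<partial>distr \<mu> borel T)"
          by (rule nn_integral_distr[symmetric]) (auto simp: \<mu>_def)
        finally show ?thesis using JR unfolding T_def distr_quantile_map by simp
      qed
      have "(\<integral>\<^sup>+y. ennreal (\<bar>T y - y\<bar> powr p) \<partial>\<mu>) = (\<integral>\<^sup>+y. ennreal (f y) * ennreal (\<bar>T y - y\<bar> powr p) \<partial>lborel)"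
        unfolding \<mu>_def by (rule nn_integral_density) auto
      also have "\<dots> \<le> (\<integral>\<^sup>+y. ennreal (C * s powr p) * ennreal (?E y) + ennreal (2 powr p * s powr p) * (ennreal (f y) * ennreal (\<bar>T y\<bar> powr (p + r))) \<partial>lborel)"
      proof (intro nn_integral_mono)
        fix y
        have "\<bar>T y - y\<bar> powr p * f y \<le> C * s powr p * ?E y + 2 powr p * s powr p * \<bar>T y\<bar> powr (p + r) * f y"
          by (rule pw[where a = "\<bar>y\<bar>"]) (use s gauss_pos[of y] gauss_le_1[of y] f0[of y] f_le[of y] T_close[of y] in \<open>auto simp: h_def abs_triangle_ineq4\<close>)
        then have "ennreal (\<bar>T y - y\<bar> powr p * f y) \<le> ennreal (C * s powr p * ?E y + 2 powr p * s powr p * \<bar>T y\<bar> powr (p + r) * f y)"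
          by (rule ennreal_leI)
        also have "\<dots> = ennreal (C * s powr p * ?E y) + ennreal (2 powr p * s powr p * \<bar>T y\<bar> powr (p + r) * f y)"
          using C f0 by (intro ennreal_plus) (auto intro!: mult_nonneg_nonneg add_nonneg_nonneg)
        also have "ennreal (C * s powr p * ?E y) = ennreal (C * s powr p) * ennreal (?E y)"
          using C by (intro ennreal_mult) auto
        also have "ennreal (2 powr p * s powr p * \<bar>T y\<bar> powr (p + r) * f y) = ennreal (2 powr p * s powr p) * (ennreal (f y) * ennreal (\<bar>T y\<bar> powr (p + r)))"
          using f0 by (simp add: ennreal_mult mult_ac)
        also have "ennreal (\<bar>T y - y\<bar> powr p * f y) = ennreal (f y) * ennreal (\<bar>T y - y\<bar> powr p)"
          using f0 by (simp add: ennreal_mult mult.commute)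
        finally show "ennreal (f y) * ennreal (\<bar>T y - y\<bar> powr p) \<le> ennreal (C * s powr p) * ennreal (?E y) + ennreal (2 powr p * s powr p) * (ennreal (f y) * ennreal (\<bar>T y\<bar> powr (p + r)))" .
      qed
      also have "\<dots> = ennreal (C * s powr p) * (\<integral>\<^sup>+y. ennreal (?E y) \<partial>lborel) + ennreal (2 powr p * s powr p) * (\<integral>\<^sup>+y. ennreal (f y) * ennreal (\<bar>T y\<bar> powr (p + r)) \<partial>lborel)"
        by (subst nn_integral_add) (auto simp: nn_integral_cmult)
      also have "\<dots> \<le> ennreal (C * s powr p) * ennreal (G + Dp) + ennreal (2 powr p * s powr p) * ennreal GR"
        by (intro add_mono mult_left_mono E_int JT) auto
      also have "\<dots> = ennreal (C * s powr p * (G + Dp) + 2 powr p * s powr p * GR)"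
        using C G Dp GR by (subst (1 2) ennreal_mult[symmetric]) auto
      also have "C * s powr p * (G + Dp) + 2 powr p * s powr p * GR = CT * s powr p"
        by (simp add: CT_def algebra_simps)
      finally show ?thesis .
    qed
    ultimately show ?thesis
      unfolding \<mu>_def[symmetric] using distr_quantile_map \<open>T \<in> borel_measurable borel\<close> T_def by blast
  qed
  show ?thesis
  proof (intro exI[of _ "CM + CT"] conjI allI impI)
    show "0 \<le> CM + CT" using nn by simp
    fix s :: real and f :: "real \<Rightarrow> real"
    assume s: "0 < s" "s \<le> S" and f: "f \<in> borel_measurable borel" "\<forall>y. 0 \<le> f y" "prob_space (dens f)"
      "near_normal C0 K m s f"
    note M = main[OF s f(1) f(2)[rule_format] f(3) f(4)[rule_format]]
    have le: "ennreal CM \<le> ennreal (CM + CT)" "ennreal (CT * s powr p) \<le> ennreal ((CM + CT) * s powr p)"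
      using nn by (auto intro!: ennreal_leI mult_right_mono)
    show "(\<integral>\<^sup>+y. ennreal (\<bar>y\<bar> powr p) \<partial>dens f) \<le> ennreal (CM + CT)"
      using M le(1) by (meson order_trans)
    show "\<exists>T\<in>borel_measurable borel. distr (dens f) borel T = \<N> \<and>
      (\<integral>\<^sup>+y. ennreal (\<bar>T y - y\<bar> powr p) \<partial>dens f) \<le> ennreal ((CM + CT) * s powr p)"
      using M le(2) by (meson order_trans)
  qed
qed

section \<open>Edgeworth expansion of the smoothed law\<close>

lemma mean_value_power_bound:
  fixes u u' :: "real \<Rightarrow> complex"
  assumes I: "convex I" "0 \<in> I" and zero: "u 0 = 0" and K: "K \<ge> 0"
    and deriv: "\<And>t. t \<in> I \<Longrightarrow> (u has_vector_derivative u' t) (at t within I)"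
    and bound: "\<And>t. t \<in> I \<Longrightarrow> norm (u' t) \<le> K * \<bar>t\<bar> ^ j"
    and t: "t \<in> I"
  shows "norm (u t) \<le> K * \<bar>t\<bar> ^ Suc j"
proof -
  have seg: "closed_segment 0 t \<subseteq> I" using I t by (simp add: closed_segment_subset)
  have "norm (u t - u 0) \<le> (K * \<bar>t\<bar> ^ j) * norm (t - 0)"
  proof (rule differentiable_bound[where S = "closed_segment 0 t" and f' = "\<lambda>r h. h *\<^sub>R u' r"])
    fix r assume r: "r \<in> closed_segment 0 t"
    show "(u has_derivative (\<lambda>h. h *\<^sub>R u' r)) (at r within closed_segment 0 t)"
      using deriv[of r] r seg has_vector_derivative_within_subset
      unfolding has_vector_derivative_def[symmetric] by blast
    have rt: "\<bar>r\<bar> \<le> \<bar>t\<bar>" using r by (auto simp: closed_segment_eq_real_ivl split: if_splits)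
    have "onorm (\<lambda>h. h *\<^sub>R u' r) \<le> norm (u' r)" by (intro onorm_le) (simp add: mult.commute)
    also have "\<dots> \<le> K * \<bar>r\<bar> ^ j" using bound r seg by blast
    also have "\<dots> \<le> K * \<bar>t\<bar> ^ j" using K rt by (intro mult_left_mono power_mono) auto
    finally show "onorm (\<lambda>h. h *\<^sub>R u' r) \<le> K * \<bar>t\<bar> ^ j" .
  qed auto
  then show ?thesis using zero by (simp add: mult_ac)
qed

lemma symbol_chain:
  assumes "\<And>i n t. N \<le> i \<Longrightarrow> i < N + k \<Longrightarrow> t \<in> I n \<Longrightarrow> (D i n has_vector_derivative D (Suc i) n t) (at t within I n)"
    and "\<And>i. N \<le> i \<Longrightarrow> i \<le> N + k \<Longrightarrow> wbounded \<sigma> I a c (D i)"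
  shows "symbol \<sigma> I k a c (D N)"
  using assms
proof (induction k arbitrary: N)
  case (Suc k)
  have "symbol \<sigma> I k a c (D (Suc N))" by (rule Suc.IH) (use Suc.prems in auto)
  then show ?case using Suc.prems(1)[of N] Suc.prems(2)[of N] by (intro symbol_SucI) auto
qed simp

lemma symbol_gaussian: "(\<And>n. \<sigma> n > 0) \<Longrightarrow> symbol \<sigma> (\<lambda>n. UNIV) k 0 (-1/2) (\<lambda>n t. of_real (gexp t))"
proof (induction k)
  have b: "wbounded \<sigma> (\<lambda>n. UNIV) 0 (-1/2) (\<lambda>n t. of_real (gexp t))"
    unfolding wbounded_def by (intro conjI allI exI[of _ 1] exI[of _ 0] continuous_intros) auto
  case 0
  show ?case using b by simp
  case (Suc k)
  have "symbol \<sigma> (\<lambda>n. UNIV) k (0 + 0) (0 + -1/2) (\<lambda>n t. (-1 * of_real t) * of_real (gexp t))"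
    by (intro symbol_mult symbol_cmult symbol_of_real Suc)
  moreover have "((\<lambda>t. of_real (gexp t) :: complex) has_vector_derivative (-1 * of_real t) * of_real (gexp t)) (at t)" for t
  proof -
    have "((\<lambda>t. of_real (gexp t) :: complex) has_vector_derivative of_real (- t * gexp t)) (at t)"
      by (intro has_vector_derivative_of_real) (auto intro!: derivative_eq_intros simp flip: has_real_derivative_iff_has_vector_derivative)
    then show ?thesis by simp
  qed
  ultimately show ?case using b by (intro symbol_SucI) auto
qed

text \<open>
  \<open>D i n\<close> plays the role of the \<open>i\<close>-th derivative of \<open>\<Lambda>\<^sub>n\<close>, and \<open>\<zeta>\<close> is the law of the smoothing
  variable.
\<close>

locale edgeworth =
  fixes \<sigma> :: "nat \<Rightarrow> real" and \<delta> \<epsilon> Cb :: real and m :: nat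
    and D :: "nat \<Rightarrow> nat \<Rightarrow> real \<Rightarrow> complex" and \<zeta> :: "real measure"
  assumes delta: "\<delta> > 0" "\<And>n. \<sigma> n \<ge> \<delta>" and m: "m \<ge> 3" and eps: "\<epsilon> > 0" and Cb: "Cb \<ge> 0"
    and deriv: "\<And>i n t. i \<le> m \<Longrightarrow> t \<in> {-\<epsilon> * \<sigma> n..\<epsilon> * \<sigma> n} \<Longrightarrow>
      (D i n has_vector_derivative D (Suc i) n t) (at t within {-\<epsilon> * \<sigma> n..\<epsilon> * \<sigma> n})"
    and zero: "\<And>i n. i < 3 \<Longrightarrow> D i n 0 = 0"
    and bound: "\<And>i n t. 3 \<le> i \<Longrightarrow> i \<le> Suc m \<Longrightarrow> t \<in> {-\<epsilon> * \<sigma> n..\<epsilon> * \<sigma> n} \<Longrightarrow> norm (D i n t) \<le> Cb * (1 / \<sigma> n) ^ (i - 2)"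
    and quarter: "\<And>n t. t \<in> {-\<epsilon> * \<sigma> n..\<epsilon> * \<sigma> n} \<Longrightarrow> norm (D 0 n t) \<le> t\<^sup>2 / 4"
    and zeta: "real_distribution \<zeta>" "\<And>j. j \<le> 2 * m + 2 \<Longrightarrow> integrable \<zeta> (\<lambda>x. \<bar>x\<bar> ^ j)"
      "\<And>t. \<bar>t\<bar> > \<epsilon> / 2 \<Longrightarrow> char \<zeta> t = 0"
begin

lemma sigma_pos: "\<sigma> n > 0" using delta(1) delta(2)[of n] by linarith

abbreviation I where "I n \<equiv> {-\<epsilon> * \<sigma> n..\<epsilon> * \<sigma> n}"

lemma interval_contains_0: "convex (I n)" "0 \<in> I n"
  using eps sigma_pos[of n] by auto

text \<open>The Taylor polynomial of \<open>\<Lambda>\<^sub>n\<close> of degree \<open>m\<close> at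
  0; its coefficients below order 3 vanish by \<open>zero\<close>.\<close>

definition L :: "nat \<Rightarrow> real \<Rightarrow> complex" where
  "L n t = (\<Sum>i<Suc m. D i n 0 * of_real t ^ i / fact i)"

text \<open>The exponential series of \<open>L\<close> is cut before the power \<open>m - 1\<close>,
  because from there on powers of \<open>L\<close> have scale at least \<open>m - 1\<close> and
  belong to the remainder.\<close>

definition P where "P n t = (\<Sum>k<m - 1. L n t ^ k / fact k)"

text \<open>The \<open>i\<close>-th derivative of \<open>char \<zeta> (t / \<sigma> n)\<close> in
  \<open>t\<close>; each differentiation brings a factor \<open>1 / \<sigma> n\<close>.\<close>

definition Z where "Z i n t = of_real ((1 / \<sigma> n) ^ i) * char_deriv \<zeta> i (t / \<sigma> n)"

text \<open>The Taylor polynomial of \<open>Z 0\<close> of degree \<open>m - 2\<close>; not to be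
  confused with the transport map, also written \<open>T\<close>.\<close>

definition T where "T n t = (\<Sum>i<m - 1. Z i n 0 * of_real t ^ i / fact i)"

lemma D_wbounded: "3 \<le> i \<Longrightarrow> i \<le> m \<Longrightarrow> wbounded \<sigma> I 1 0 (D i)"
  unfolding wbounded_def
proof (intro conjI allI)
  fix n assume i: "3 \<le> i" "i \<le> m"
  show "continuous_on (I n) (D i n)"
    by (meson deriv[OF i(2)] continuous_on_eq_continuous_within has_vector_derivative_continuous)
next
  assume i: "3 \<le> i" "i \<le> m"
  have "norm (D i n t) \<le> (Cb * (1 / \<delta>) ^ (i - 2 - 1)) * (1 / \<sigma> n) ^ 1 * wt t ^ 0 * exp (0 * t\<^sup>2)" if "t \<in> I n" for n t
  proof -
    have "(1 / \<sigma> n) ^ (i - 2) \<le> (1 / \<delta>) ^ (i - 2 - 1) * (1 / \<sigma> n) ^ 1"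
      using i delta by (intro pow_inv_le) auto
    from mult_left_mono[OF this Cb] bound[of i t n] i that show ?thesis by (simp add: mult_ac)
  qed
  then show "\<exists>C\<ge>0. \<exists>K. \<forall>n. \<forall>t\<in>I n. norm (D i n t) \<le> C * (1 / \<sigma> n) ^ 1 * wt t ^ K * exp (0 * t\<^sup>2)"
    using Cb delta(1) by (intro exI[of _ "Cb * (1 / \<delta>) ^ (i - 2 - 1)"] conjI exI[of _ 0]) auto
qed

text \<open>Orders 0, 1 and 2 vanish at 0, so the Taylor remainder with three terms is
  \<open>D 0\<close> itself, and three integrations carry the scale 1 of \<open>D 3\<close> over to
  it.\<close>

lemma D0_symbol: "symbol \<sigma> I m 1 0 (D 0)"
proof -
  have "symbol \<sigma> I (m - 3) 1 0 (D 3)"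
    using m by (intro symbol_chain deriv D_wbounded) auto
  then have "symbol \<sigma> I (m - 3 + 3) 1 0 (\<lambda>n t. D 0 n t - (\<Sum>i<3. D i n 0 * of_real t ^ i / fact i))"
    using m by (intro symbol_taylor sigma_pos interval_contains_0 deriv) auto
  then show ?thesis using m by (simp add: zero)
qed

text \<open>A symbol must be continuous, but the top derivative \<open>D (m + 1)\<close> is only
  known to be bounded. The Taylor term of order \<open>m\<close> is therefore subtracted beforehand,
  in \<open>D'\<close>: then \<open>D' m\<close> is the increment of \<open>D m\<close> from 0,
  which is continuous and, by the mean value inequality,
  \<open>O((1 / \<sigma> n)^(m-1) |t|)\<close>.\<close>

lemma remainder_symbol: "symbol \<sigma> I m (m - 1) 0 (\<lambda>n t. D 0 n t - L n t)"
proof -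
  define D' where "D' i n t = D i n t - D m n 0 * of_real t ^ (m - i) / fact (m - i)" for i n t
  have "symbol \<sigma> I (0 + m) (m - 1) 0 (\<lambda>n t. D' 0 n t - (\<Sum>i<m. D' i n 0 * of_real t ^ i / fact i))"
  proof (rule symbol_taylor[where \<sigma> = \<sigma>, OF sigma_pos interval_contains_0])
    fix n i t assume i: "i < m" and t: "t \<in> I n"
    obtain j where j: "m - i = Suc j" "m - Suc i = j" using i by (metis Suc_diff_Suc)
    have "((\<lambda>t. of_real t ^ Suc j :: complex) has_vector_derivative of_nat (Suc j) * of_real t ^ j) (at t within I n)"
      using DERIV_power[OF DERIV_ident, where n = "Suc j"] by (intro has_vector_derivative_real_field) simp
    then have "((\<lambda>t. (D m n 0 / fact (Suc j)) * of_real t ^ Suc j) has_vector_derivative (D m n 0 / fact (Suc j)) * (of_nat (Suc j) * of_real t ^ j)) (at t within I n)"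
      by (intro has_vector_derivative_mult_right)
    moreover have "(D m n 0 / fact (Suc j)) * (of_nat (Suc j) * of_real t ^ j) = D m n 0 * of_real t ^ j / fact j"
      by (simp add: fact_Suc del: of_nat_Suc)
    moreover have "(\<lambda>t. (D m n 0 / fact (Suc j)) * of_real t ^ Suc j) = (\<lambda>t. D m n 0 * of_real t ^ Suc j / fact (Suc j))"
      by auto
    ultimately have "((\<lambda>t. D m n 0 * of_real t ^ (m - i) / fact (m - i)) has_vector_derivative D m n 0 * of_real t ^ (m - Suc i) / fact (m - Suc i)) (at t within I n)"
      unfolding j by metis
    then show "(D' i n has_vector_derivative D' (Suc i) n t) (at t within I n)"
      unfolding D'_def[abs_def] using i t by (intro has_vector_derivative_diff deriv) auto
  next
    have "norm (D' m n t) \<le> Cb * (1 / \<sigma> n) ^ (m - 1) * wt t ^ 1 * exp (0 * t\<^sup>2)" if t: "t \<in> I n" for n t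
    proof -
      have "norm (D' m n t) \<le> Cb * (1 / \<sigma> n) ^ (m - 1) * \<bar>t\<bar> ^ Suc 0"
      proof (rule mean_value_power_bound[OF interval_contains_0, where u' = "D (Suc m) n"])
        fix r assume r: "r \<in> I n"
        have "((\<lambda>t. D m n t - D m n 0) has_vector_derivative D (Suc m) n r - 0) (at r within I n)"
          using deriv[of m r n] r by (intro has_vector_derivative_diff) auto
        then show "(D' m n has_vector_derivative D (Suc m) n r) (at r within I n)"
          by (simp add: D'_def[abs_def])
        show "norm (D (Suc m) n r) \<le> Cb * (1 / \<sigma> n) ^ (m - 1) * \<bar>r\<bar> ^ 0"
          using bound[of "Suc m" r n] r m by simp
      qed (use t Cb sigma_pos[of n] in \<open>auto simp: D'_def\<close>)
      also have "\<dots> \<le> Cb * (1 / \<sigma> n) ^ (m - 1) * wt t"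
        using Cb sigma_pos[of n] by (intro mult_left_mono) auto
      finally show ?thesis by simp
    qed
    moreover have "continuous_on (I n) (D' m n)" for n
    proof -
      have "continuous_on (I n) (D m n)"
        by (meson deriv[OF order_refl] continuous_on_eq_continuous_within has_vector_derivative_continuous)
      then show ?thesis unfolding D'_def[abs_def] by (intro continuous_intros) auto
    qed
    ultimately show "symbol \<sigma> I 0 (m - 1) 0 (D' m)"
      using Cb unfolding symbol.simps wbounded_def by blast
  qed auto
  moreover have "D' 0 n t - (\<Sum>i<m. D' i n 0 * of_real t ^ i / fact i) = D 0 n t - L n t" for n t
  proof -
    \<comment> \<open>The subtracted monomial has degree \<open>m\<close>, so its derivatives of
      order below \<open>m\<close> vanish at 0 and the lower Taylor coefficients are
      unchanged.\<close>
    have "(\<Sum>i<m. D' i n 0 * of_real t ^ i / fact i) = (\<Sum>i<m. D i n 0 * of_real t ^ i / fact i)"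
      by (intro sum.cong) (auto simp: D'_def power_0_left)
    then show ?thesis by (simp add: D'_def L_def)
  qed
  ultimately show ?thesis by simp
qed

lemma L_poly_family: "poly_family \<sigma> 1 L"
proof -
  have "poly_family \<sigma> 1 (\<lambda>n t. (D i n 0 / fact i) * of_real t ^ i)" if "i < Suc m" for i
  proof (cases "i < 3")
    case True
    then show ?thesis using zero poly_family_zero by simp
  next
    case False
    have "poly_family \<sigma> (i - 2) (\<lambda>n t. (D i n 0 / fact i) * of_real t ^ i)"
    proof (rule poly_family.monom[OF Cb])
      fix n
      have "norm (D i n 0 / fact i) \<le> norm (D i n 0)"
        by (simp add: norm_divide divide_le_eq mult_le_cancel_left1)
      also have "\<dots> \<le> Cb * (1 / \<sigma> n) ^ (i - 2)" using bound[of i 0 n] interval_contains_0(2)[of n] that False by simp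
      finally show "norm (D i n 0 / fact i) \<le> Cb * (1 / \<sigma> n) ^ (i - 2)" .
    qed
    then show ?thesis by (rule poly_family_weaken[where \<sigma> = \<sigma>, OF delta, rotated]) (use False in simp)
  qed
  then have "poly_family \<sigma> 1 (\<lambda>n t. \<Sum>i<Suc m. (D i n 0 / fact i) * of_real t ^ i)" by (intro poly_family_sum) auto
  then show ?thesis unfolding L_def[abs_def] by simp
qed

text \<open>The constant term 1 is split off because it will produce the normal density itself;
  everything else has scale 1.\<close>

lemma P_poly_family: "\<exists>V. poly_family \<sigma> 1 V \<and> P = (\<lambda>n t. 1 + V n t)"
proof -
  have "poly_family \<sigma> 1 (\<lambda>n t. (1 / fact k) * L n t ^ k)" if "k \<in> {1..<m - 1}" for k
  proof (rule poly_family_cmult[where \<sigma> = \<sigma>, OF sigma_pos], rule poly_family_weaken[where \<sigma> = \<sigma>, OF delta])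
    show "poly_family \<sigma> (k * 1) (\<lambda>n t. L n t ^ k)" by (rule poly_family_power[where \<sigma> = \<sigma>, OF sigma_pos L_poly_family])
  qed (use that in auto)
  then have "poly_family \<sigma> 1 (\<lambda>n t. \<Sum>k\<in>{1..<m - 1}. (1 / fact k) * L n t ^ k)" by (intro poly_family_sum) auto
  moreover have "P n t = 1 + (\<Sum>k\<in>{1..<m - 1}. (1 / fact k) * L n t ^ k)" for n t
  proof -
    have "{..<m - 1} = insert 0 {1..<m - 1}" using m by auto
    then show ?thesis unfolding P_def by simp
  qed
  ultimately show ?thesis by (intro exI[of _ "\<lambda>n t. \<Sum>k\<in>{1..<m - 1}. (1 / fact k) * L n t ^ k"]) auto
qed

lemma Z_norm: "i \<le> 2 * m + 2 \<Longrightarrow> norm (Z i n t) \<le> (LINT x|\<zeta>. \<bar>x\<bar> ^ i) * (1 / \<sigma> n) ^ i"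
proof -
  assume i: "i \<le> 2 * m + 2"
  interpret real_distribution \<zeta> by (rule zeta)
  have "norm (Z i n t) = (1 / \<sigma> n) ^ i * norm (char_deriv \<zeta> i (t / \<sigma> n))"
    using sigma_pos[of n] unfolding Z_def norm_mult norm_of_real by (simp add: abs_of_pos)
  also have "\<dots> \<le> (1 / \<sigma> n) ^ i * (LINT x|\<zeta>. \<bar>x\<bar> ^ i)"
    using sigma_pos[of n] by (intro mult_left_mono norm_char_deriv_le) auto
  finally show ?thesis by (simp add: mult.commute)
qed

lemma T_poly_family: "\<exists>V. poly_family \<sigma> 1 V \<and> T = (\<lambda>n t. 1 + V n t)"
proof -
  have "poly_family \<sigma> 1 (\<lambda>n t. (Z i n 0 / fact i) * of_real t ^ i)" if "i \<in> {1..<m - 1}" for i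
  proof (rule poly_family_weaken[where \<sigma> = \<sigma>, OF delta])
    show "poly_family \<sigma> i (\<lambda>n t. (Z i n 0 / fact i) * of_real t ^ i)"
    proof (rule poly_family.monom)
      show "(LINT x|\<zeta>. \<bar>x\<bar> ^ i) \<ge> 0" by simp
      fix n
      have "norm (Z i n 0 / fact i) \<le> norm (Z i n 0)"
        by (simp add: norm_divide divide_le_eq mult_le_cancel_left1)
      also have "\<dots> \<le> (LINT x|\<zeta>. \<bar>x\<bar> ^ i) * (1 / \<sigma> n) ^ i" using that by (intro Z_norm) auto
      finally show "norm (Z i n 0 / fact i) \<le> (LINT x|\<zeta>. \<bar>x\<bar> ^ i) * (1 / \<sigma> n) ^ i" .
    qed
  qed (use that in auto)
  then have "poly_family \<sigma> 1 (\<lambda>n t. \<Sum>i\<in>{1..<m - 1}. (Z i n 0 / fact i) * of_real t ^ i)" by (intro poly_family_sum) auto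
  moreover have "T n t = 1 + (\<Sum>i\<in>{1..<m - 1}. (Z i n 0 / fact i) * of_real t ^ i)" for n t
  proof -
    interpret real_distribution \<zeta> by (rule zeta)
    have "{..<m - 1} = insert 0 {1..<m - 1}" using m by auto
    moreover have "Z 0 n 0 = 1" by (simp add: Z_def char_deriv_0 char_zero)
    ultimately show ?thesis unfolding T_def by simp
  qed
  ultimately show ?thesis by (intro exI[of _ "\<lambda>n t. \<Sum>i\<in>{1..<m - 1}. (Z i n 0 / fact i) * of_real t ^ i"]) auto
qed

lemma Z_deriv:
  assumes "i + 2 \<le> 2 * m + 2"
  shows "(Z i n has_vector_derivative Z (Suc i) n t) (at t within A)"
proof -
  interpret real_distribution \<zeta> by (rule zeta)
  have "(char_deriv \<zeta> i has_vector_derivative char_deriv \<zeta> (Suc i) (t / \<sigma> n)) (at (t / \<sigma> n))"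
    using assms by (intro char_deriv_has_derivative zeta) auto
  moreover have "((\<lambda>t. t / \<sigma> n) has_real_derivative 1 / \<sigma> n) (at t)"
    by (intro DERIV_cdivide DERIV_ident)
  ultimately have "((\<lambda>t. char_deriv \<zeta> i (t / \<sigma> n)) has_vector_derivative (1 / \<sigma> n) *\<^sub>R char_deriv \<zeta> (Suc i) (t / \<sigma> n)) (at t)"
    using vector_diff_chain_at[of "\<lambda>t. t / \<sigma> n" "1 / \<sigma> n" t "char_deriv \<zeta> i" "char_deriv \<zeta> (Suc i) (t / \<sigma> n)"]
    by (simp add: has_real_derivative_iff_has_vector_derivative o_def)
  then have "((\<lambda>t. of_real ((1 / \<sigma> n) ^ i) * char_deriv \<zeta> i (t / \<sigma> n)) has_vector_derivative of_real ((1 / \<sigma> n) ^ i) * ((1 / \<sigma> n) *\<^sub>R char_deriv \<zeta> (Suc i) (t / \<sigma> n))) (at t)"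
    by (rule has_vector_derivative_mult_right)
  then have "(Z i n has_vector_derivative Z (Suc i) n t) (at t)"
    by (simp add: Z_def[abs_def] scaleR_conv_of_real)
  then show ?thesis by (rule has_vector_derivative_at_within)
qed

lemma Z_wbounded: "b \<le> i \<Longrightarrow> i \<le> 2 * m \<Longrightarrow> wbounded \<sigma> A b 0 (Z i)"
  unfolding wbounded_def
proof (intro conjI allI)
  fix n assume i: "i \<le> 2 * m"
  have "(Z i n has_vector_derivative Z (Suc i) n t) (at t within A n)" for t
    by (rule Z_deriv) (use i in simp)
  then show "continuous_on (A n) (Z i n)"
    by (meson continuous_on_eq_continuous_within has_vector_derivative_continuous)
next
  assume i: "b \<le> i" "i \<le> 2 * m"
  let ?J = "LINT x|\<zeta>. \<bar>x\<bar> ^ i"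
  have J: "?J \<ge> 0" by simp
  have "norm (Z i n t) \<le> (?J * (1 / \<delta>) ^ (i - b)) * (1 / \<sigma> n) ^ b * wt t ^ 0 * exp (0 * t\<^sup>2)" for n t
    using Z_norm[of i n t] i mult_left_mono[OF pow_inv_le[OF delta i(1), of n] J] by (simp add: mult_ac)
  moreover have "?J * (1 / \<delta>) ^ (i - b) \<ge> 0" using J delta(1) by (intro mult_nonneg_nonneg) auto
  ultimately show "\<exists>C\<ge>0. \<exists>K. \<forall>n. \<forall>t\<in>A n. norm (Z i n t) \<le> C * (1 / \<sigma> n) ^ b * wt t ^ K * exp (0 * t\<^sup>2)"
    by blast
qed

lemma Z0_symbol: "symbol \<sigma> A m 0 0 (Z 0)"
  by (intro symbol_chain Z_deriv Z_wbounded) auto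

text \<open>The remainder is integrated up from \<open>Z (m - 1)\<close>, which has scale
  \<open>m - 1\<close>; keeping \<open>m\<close> further derivatives of it calls for moments of
  \<open>\<zeta>\<close> of order about \<open>2 * m\<close>.\<close>

lemma Z_remainder_symbol: "symbol \<sigma> (\<lambda>n. UNIV) m (m - 1) 0 (\<lambda>n t. Z 0 n t - T n t)"
proof -
  have "symbol \<sigma> (\<lambda>n. UNIV) m (m - 1) 0 (Z (m - 1))"
    by (intro symbol_chain Z_deriv Z_wbounded) auto
  then have "symbol \<sigma> (\<lambda>n. UNIV) (m + (m - 1)) (m - 1) 0 (\<lambda>n t. Z 0 n t - (\<Sum>i<m - 1. Z i n 0 * of_real t ^ i / fact i))"
    by (intro symbol_taylor sigma_pos Z_deriv) auto
  then show ?thesis unfolding T_def[symmetric] by (rule symbol_mono_order) simp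
qed

text \<open>The difference splits into \<open>exp_tail (m - 1) (D 0)\<close>, which has scale
  \<open>m - 1\<close> because \<open>D 0\<close> has scale 1, and the terms
  \<open>D 0^k - L^k\<close> for \<open>k < m - 1\<close>, which inherit the scale of
  \<open>D 0 - L\<close>.\<close>

lemma exp_remainder_symbol: "symbol \<sigma> I m (m - 1) (1/4) (\<lambda>n t. exp (D 0 n t) - P n t)"
proof -
  have L0: "symbol \<sigma> I m 0 0 L"
    by (rule symbol_poly_family[where \<sigma> = \<sigma>, OF sigma_pos poly_family_weaken[where \<sigma> = \<sigma>, OF delta _ L_poly_family]]) simp
  have D0: "symbol \<sigma> I m 0 0 (D 0)" by (rule symbol_weaken_scale[where \<sigma> = \<sigma>, OF delta _ D0_symbol]) simp
  \<comment> \<open>The induction step writes the difference of powers as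
    \<open>D 0 * (D 0^k - L^k) + (D 0 - L) * L^k\<close>; each summand has one factor of scale
    \<open>m - 1\<close>.\<close>
  have pow: "symbol \<sigma> I m (m - 1) 0 (\<lambda>n t. D 0 n t ^ k - L n t ^ k)" for k
  proof (induction k)
    case 0
    show ?case using symbol_zero by simp
  next
    case (Suc k)
    have Lk: "symbol \<sigma> I m 0 0 (\<lambda>n t. L n t ^ k)" using symbol_power[where \<sigma> = \<sigma>, OF sigma_pos L0, of k] by simp
    have "symbol \<sigma> I m (m - 1) 0 (\<lambda>n t. D 0 n t * (D 0 n t ^ k - L n t ^ k) + (D 0 n t - L n t) * L n t ^ k)"
      using symbol_add[where \<sigma> = \<sigma>, OF sigma_pos symbol_mult[where \<sigma> = \<sigma>, OF sigma_pos D0 Suc] symbol_mult[where \<sigma> = \<sigma>, OF sigma_pos Lk remainder_symbol]] by (simp add: mult.commute)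
    then show ?case by (simp add: algebra_simps)
  qed
  have "symbol \<sigma> I m (m - 1) (1/4) (\<lambda>n t. exp_tail (m - 1) (D 0 n t) + (\<Sum>k<m - 1. (1 / fact k) * (D 0 n t ^ k - L n t ^ k)))"
    by (intro symbol_add symbol_sum symbol_cmult sigma_pos symbol_exp_tail[where \<sigma> = \<sigma>, OF delta D0_symbol quarter] symbol_weaken_exp[where \<sigma> = \<sigma>, OF sigma_pos _ pow]) auto
  then show ?thesis
    by (rule symbol_cong) (simp add: exp_tail_def P_def right_diff_distrib sum_subtractf)
qed

text \<open>What is left of the characteristic function beside \<open>P * T * gexp\<close>. The part
  with \<open>exp (D 0)\<close> is controlled on \<open>I n\<close> only and is cut off there, where
  \<open>Z 0\<close> already vanishes near the end points; the polynomial part lives on the whole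
  line.\<close>

definition \<rho> where
  "\<rho> n t = of_real (gexp t) *
     ((if \<bar>t\<bar> \<le> \<epsilon> * \<sigma> n then (exp (D 0 n t) - P n t) * Z 0 n t else 0) + P n t * (Z 0 n t - T n t))"

lemma Z0: "Z 0 n t = char \<zeta> (t / \<sigma> n)"
  by (simp add: Z_def char_deriv_0)

lemma Z0_zero: "\<epsilon> / 2 * \<sigma> n < \<bar>t\<bar> \<Longrightarrow> Z 0 n t = 0"
proof -
  assume "\<epsilon> / 2 * \<sigma> n < \<bar>t\<bar>"
  then have "\<epsilon> / 2 < \<bar>t\<bar> / \<sigma> n" using sigma_pos[of n] by (simp only: pos_less_divide_eq)
  moreover have "\<bar>t / \<sigma> n\<bar> = \<bar>t\<bar> / \<sigma> n" using sigma_pos[of n] by (simp add: abs_divide)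
  ultimately show ?thesis unfolding Z0 by (intro zeta(3)) (simp only:)
qed

text \<open>The weights combine to \<open>- 1/2 + 1/4 = - 1/4\<close>: the bound
  \<open>t\<^sup>2 / 4\<close> from \<open>quarter\<close> leaves enough Gaussian decay for Fourier
  integrals.\<close>

lemma \<rho>_symbol: "symbol \<sigma> (\<lambda>n. UNIV) m (m - 1) (-1/4) \<rho>"
proof -
  have 1: "symbol \<sigma> (\<lambda>n. UNIV) m (m - 1) (1/4) (\<lambda>n t. if \<bar>t\<bar> \<le> \<epsilon> * \<sigma> n then (exp (D 0 n t) - P n t) * Z 0 n t else 0)"
  proof (rule symbol_glue[where \<sigma> = \<sigma>, OF sigma_pos, of "\<epsilon> / 2" \<epsilon>])
    show "symbol \<sigma> I m (m - 1) (1/4) (\<lambda>n t. (exp (D 0 n t) - P n t) * Z 0 n t)"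
      using symbol_mult[where \<sigma> = \<sigma>, OF sigma_pos exp_remainder_symbol Z0_symbol] by simp
  qed (use eps Z0_zero in auto)
  obtain V where V: "poly_family \<sigma> 1 V" "P = (\<lambda>n t. 1 + V n t)" using P_poly_family by blast
  have "poly_family \<sigma> 0 P" unfolding V(2) by (intro poly_family.add poly_family_const poly_family_weaken[where \<sigma> = \<sigma>, OF delta _ V(1)]) simp
  then have "symbol \<sigma> (\<lambda>n. UNIV) m (0 + (m - 1)) (0 + 0) (\<lambda>n t. P n t * (Z 0 n t - T n t))"
    by (intro symbol_mult[where \<sigma> = \<sigma>, OF sigma_pos] symbol_poly_family[where \<sigma> = \<sigma>, OF sigma_pos] Z_remainder_symbol)
  then have 2: "symbol \<sigma> (\<lambda>n. UNIV) m (m - 1) (1/4) (\<lambda>n t. P n t * (Z 0 n t - T n t))"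
    by (intro symbol_weaken_exp[where \<sigma> = \<sigma> and c = 0 and d = "1/4", OF sigma_pos]) simp_all
  have "symbol \<sigma> (\<lambda>n. UNIV) m (0 + (m - 1)) (-1/2 + 1/4) \<rho>"
    unfolding \<rho>_def[abs_def] by (intro symbol_mult[where \<sigma> = \<sigma>, OF sigma_pos] symbol_gaussian[where \<sigma> = \<sigma>, OF sigma_pos] symbol_add[where \<sigma> = \<sigma>, OF sigma_pos 1 2])
  then show ?thesis by simp
qed

text \<open>On \<open>I n\<close> this is algebra. Outside, \<open>Z 0\<close> vanishes and
  \<open>char \<eta>\<close> does not matter: both sides are 0 because \<open>\<rho>\<close> reduces
  to \<open>- P * T * gexp\<close>.\<close>

lemma char_decomposition:
  assumes "\<And>t. t \<in> I n \<Longrightarrow> char \<eta> t = exp (D 0 n t - of_real (t\<^sup>2 / 2))"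
  shows "char \<eta> t * char \<zeta> (t / \<sigma> n) = (P n t * T n t) * of_real (gexp t) + \<rho> n t"
proof (cases "\<bar>t\<bar> \<le> \<epsilon> * \<sigma> n")
  case True
  then have "t \<in> I n" by auto
  then have "char \<eta> t = exp (D 0 n t - of_real (t\<^sup>2 / 2))" by (rule assms)
  also have "D 0 n t - of_real (t\<^sup>2 / 2) = D 0 n t + of_real (- t\<^sup>2 / 2)" by simp
  also have "exp \<dots> = exp (D 0 n t) * of_real (gexp t)" by (simp only: exp_add exp_of_real)
  finally have *: "char \<eta> t = exp (D 0 n t) * of_real (gexp t)" .
  have ring: "e * g * z = p * v * g + g * ((e - p) * z + p * (z - v))" for e g z p v :: complex
    by (simp add: algebra_simps)
  show ?thesis unfolding * \<rho>_def Z0[symmetric] using True by (simp only: if_True ring)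
next
  case False
  then have "\<epsilon> / 2 * \<sigma> n < \<bar>t\<bar>" using eps sigma_pos[of n] mult_strict_right_mono[of "\<epsilon> / 2" \<epsilon> "\<sigma> n"] by linarith
  then have "Z 0 n t = 0" by (rule Z0_zero)
  then show ?thesis using False by (simp add: \<rho>_def flip: Z0)
qed

text \<open>With \<open>P * T = 1 + V\<close>, the three parts of the characteristic function invert
  to the normal density, to a correction of size \<open>1 / \<sigma> n\<close> relative to it up to
  a polynomial, and to a remainder with polynomial decay.\<close>

theorem density_expansion:
  "\<exists>C0\<ge>0. \<exists>K. \<forall>n \<eta> \<mu>. (\<forall>t\<in>I n. char \<eta> t = exp (D 0 n t - of_real (t\<^sup>2 / 2))) \<longrightarrow> real_distribution \<mu> \<longrightarrow>
    (\<forall>t. char \<mu> t = char \<eta> t * char \<zeta> (t / \<sigma> n)) \<longrightarrow>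
    (\<exists>f. f \<in> borel_measurable borel \<and> (\<forall>y. 0 \<le> f y) \<and> \<mu> = dens f \<and>
      near_normal C0 K m (1 / \<sigma> n) f)"
proof -
  obtain V1 where V1: "poly_family \<sigma> 1 V1" "P = (\<lambda>n t. 1 + V1 n t)" using P_poly_family by blast
  obtain V2 where V2: "poly_family \<sigma> 1 V2" "T = (\<lambda>n t. 1 + V2 n t)" using T_poly_family by blast
  define V where "V n t = V1 n t + V2 n t + V1 n t * V2 n t" for n t
  have "poly_family \<sigma> (1 + 1) (\<lambda>n t. V1 n t * V2 n t)" by (rule poly_family_mult[where \<sigma> = \<sigma>, OF sigma_pos V1(1) V2(1)])
  then have "poly_family \<sigma> 1 (\<lambda>n t. V1 n t * V2 n t)" by (rule poly_family_weaken[where \<sigma> = \<sigma>, OF delta, rotated]) simp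
  then have V: "poly_family \<sigma> 1 V" unfolding V_def[abs_def] by (intro poly_family.add V1 V2)
  have PT: "P n t * T n t = 1 + V n t" for n t unfolding V1(2) V2(2) V_def by (simp add: algebra_simps)
  obtain C K where C: "C \<ge> 0" "\<And>n x. norm (fourier (\<lambda>t. V n t * of_real (gexp t)) x) \<le> C * (1 / \<sigma> n) ^ 1 * wt x ^ K * gexp x"
    and Vint: "\<And>n. integrable lborel (\<lambda>t. V n t * of_real (gexp t))"
    using fourier_poly_family[where \<sigma> = \<sigma>, OF sigma_pos V] by blast
  obtain E where E: "E \<ge> 0" "\<And>n x. \<bar>x\<bar> ^ m * norm (fourier (\<rho> n) x) \<le> E * (1 / \<sigma> n) ^ (m - 1)"
    using fourier_symbol[where \<sigma> = \<sigma>, OF sigma_pos _ \<rho>_symbol] by auto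
  \<comment> \<open>The bound with \<open>m\<close> derivatives says nothing near
    \<open>x = 0\<close>; the one without derivatives fills this gap, and together they give the
    weight \<open>wt x powr (- m)\<close>.\<close>
  obtain F where F: "F \<ge> 0" "\<And>n x. norm (fourier (\<rho> n) x) \<le> F * (1 / \<sigma> n) ^ (m - 1)"
    using fourier_symbol[where \<sigma> = \<sigma>, OF sigma_pos _ symbol_mono_order[OF \<rho>_symbol, of 0]] by auto
  have \<rho>_bound: "norm (fourier (\<rho> n) x) \<le> 2 ^ m * (F + E) * ((1 / \<sigma> n) ^ (m - 1) * wt x powr (- real m))" for n x
  proof -
    have "wt x ^ m * norm (fourier (\<rho> n) x) \<le> 2 ^ m * (1 + \<bar>x\<bar> ^ m) * norm (fourier (\<rho> n) x)"
      by (intro mult_right_mono one_plus_power_le) auto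
    also have "\<dots> = 2 ^ m * (norm (fourier (\<rho> n) x) + \<bar>x\<bar> ^ m * norm (fourier (\<rho> n) x))" by (simp add: algebra_simps)
    also have "\<dots> \<le> 2 ^ m * (F * (1 / \<sigma> n) ^ (m - 1) + E * (1 / \<sigma> n) ^ (m - 1))"
      by (intro mult_left_mono add_mono E F) auto
    also have "\<dots> = 2 ^ m * (F + E) * (1 / \<sigma> n) ^ (m - 1)" by (simp only: distrib_right distrib_left mult.assoc)
    finally have *: "wt x ^ m * norm (fourier (\<rho> n) x) \<le> 2 ^ m * (F + E) * (1 / \<sigma> n) ^ (m - 1)" .
    have w: "wt x ^ m > 0" by simp
    have "wt x powr (- real m) = 1 / wt x ^ m" by (simp add: powr_minus powr_realpow divide_inverse)
    then show ?thesis using * w by (simp add: pos_le_divide_eq mult.commute mult.left_commute)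
  qed
  define C0 where "C0 = C * sqrt (2 * pi) + 2 ^ m * (F + E)"
  have "C0 \<ge> 0" using C E F by (simp add: C0_def)
  moreover have "\<exists>f. f \<in> borel_measurable borel \<and> (\<forall>y. 0 \<le> f y) \<and> \<mu> = dens f \<and>
      near_normal C0 K m (1 / \<sigma> n) f"
    if eta: "\<forall>t\<in>I n. char \<eta> t = exp (D 0 n t - of_real (t\<^sup>2 / 2))" and mu: "real_distribution \<mu>"
      and ch: "\<forall>t. char \<mu> t = char \<eta> t * char \<zeta> (t / \<sigma> n)" for n \<eta> \<mu>
  proof -
    interpret real_distribution \<mu> by (rule mu)
    let ?g = "\<lambda>t. of_real (gexp t) :: complex"
    have dec: "char \<mu> = (\<lambda>t. (?g t + V n t * ?g t) + \<rho> n t)"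
    proof
      fix t
      have "char \<mu> t = (P n t * T n t) * ?g t + \<rho> n t"
        using ch char_decomposition[of n \<eta> t] eta by simp
      then show "char \<mu> t = (?g t + V n t * ?g t) + \<rho> n t" unfolding PT by (simp add: distrib_right)
    qed
    have gint: "integrable lborel ?g" using integrable_gauss_bounded[OF gauss_bounded_monom[of 0]] by simp
    have \<rho>int: "integrable lborel (\<rho> n)"
      by (rule integrable_gauss_bounded[OF wbounded_gauss_bounded[where \<sigma> = \<sigma>, OF symbol_wbounded[OF \<rho>_symbol] sigma_pos]]) simp
    have gVint: "integrable lborel (\<lambda>t. ?g t + V n t * ?g t)" by (intro Bochner_Integration.integrable_add gint Vint)
    have cint: "integrable lborel (char \<mu>)" unfolding dec by (intro Bochner_Integration.integrable_add gVint \<rho>int)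
    define f where "f y = Re (1 / (2 * pi) * fourier (char \<mu>) y)" for y
    note inv = density_char_inversion[OF cint, folded f_def]
    have four: "fourier (char \<mu>) y = of_real (sqrt (2 * pi) * gexp y) + fourier (\<lambda>t. V n t * ?g t) y + fourier (\<rho> n) y" for y
      unfolding dec fourier_add[OF gVint \<rho>int] fourier_add[OF gint Vint] fourier_gauss ..
    have "\<bar>f y - gauss y\<bar> \<le> C0 * ((1 / \<sigma> n) * wt y ^ K * gauss y + (1 / \<sigma> n) ^ (m - 1) * wt y powr (- real m))" for y
    proof -
      let ?R = "fourier (\<lambda>t. V n t * ?g t) y + fourier (\<rho> n) y"
      have "Re (complex_of_real (1 / (2 * pi)) * z) = Re z / (2 * pi)" for z by simp
      then have "f y = Re (fourier (char \<mu>) y) / (2 * pi)" unfolding f_def .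
      also have "Re (fourier (char \<mu>) y) = sqrt (2 * pi) * gexp y + Re ?R"
        unfolding four plus_complex.sel Re_complex_of_real by (rule add.assoc)
      also have "(sqrt (2 * pi) * gexp y + Re ?R) / (2 * pi) = gauss y + Re ?R / (2 * pi)"
      proof -
        have "sqrt (2 * pi) / (2 * pi) = 1 / sqrt (2 * pi)"
          using real_sqrt_mult_self[of "2 * pi"] pi_gt_zero by (simp add: field_simps)
        moreover have "(c * e + r) / d = (c / d) * e + r / d" for c d e r :: real
          by (simp add: add_divide_distrib)
        ultimately show ?thesis unfolding std_normal_density_def by (simp only:)
      qed
      finally have "\<bar>f y - gauss y\<bar> = \<bar>Re ?R\<bar> / (2 * pi)" by simp
      also have "\<dots> \<le> norm ?R / 1"
        using pi_gt3 by (intro frac_le abs_Re_le_cmod) auto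
      also have "\<dots> \<le> C * (1 / \<sigma> n) ^ 1 * wt y ^ K * gexp y + 2 ^ m * (F + E) * ((1 / \<sigma> n) ^ (m - 1) * wt y powr (- real m))"
        unfolding div_by_1 by (intro order_trans[OF norm_triangle_ineq] add_mono C \<rho>_bound)
      also have "C * (1 / \<sigma> n) ^ 1 * wt y ^ K * gexp y = C * sqrt (2 * pi) * ((1 / \<sigma> n) * wt y ^ K * gauss y)"
      proof -
        have "gexp y = sqrt (2 * pi) * gauss y" by (simp add: std_normal_density_def)
        then show ?thesis by (simp only: power_one_right mult_ac)
      qed
      also have "C * sqrt (2 * pi) * ((1 / \<sigma> n) * wt y ^ K * gauss y) + 2 ^ m * (F + E) * ((1 / \<sigma> n) ^ (m - 1) * wt y powr (- real m)) \<le>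
        C0 * ((1 / \<sigma> n) * wt y ^ K * gauss y) + C0 * ((1 / \<sigma> n) ^ (m - 1) * wt y powr (- real m))"
        using C E F sigma_pos[of n] gauss_pos[of y] unfolding C0_def
        by (intro add_mono mult_right_mono) (auto intro!: mult_nonneg_nonneg simp: less_imp_le)
      finally show ?thesis by (simp only: distrib_left)
    qed
    moreover have "f \<in> borel_measurable borel" using inv(3) by (rule borel_measurable_continuous_onI)
    ultimately show ?thesis using inv(1,2) by blast
  qed
  ultimately show ?thesis by blast
qed

end

section \<open>From the growth condition to the hypotheses of the expansion\<close>

text \<open>A nonvanishing continuous function on an interval has a continuous logarithm.
  Subtracting its value at 0, a period of \<open>exp\<close>, normalizes it, and uniqueness
  identifies the result with \<open>cont_log\<close>.\<close>

lemma cont_log_exp: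
  fixes f :: "real \<Rightarrow> complex" and a :: real
  assumes cont: "continuous_on {-a..a} f" and nz: "\<And>t. t \<in> {-a..a} \<Longrightarrow> f t \<noteq> 0" and f0: "f 0 = 1" and t: "t \<in> {-a..a}"
  shows "exp (cont_log f t) = f t"
proof -
  have conv: "convex {-a..a}" by simp
  obtain g where g: "continuous_on {-a..a} g" "\<And>x. x \<in> {-a..a} \<Longrightarrow> f x = exp (g x)"
    using continuous_logarithm_on_contractible[OF cont convex_imp_contractible[OF conv] nz] by blast
  have "0 \<in> {-a..a}" using t by auto
  then have seg: "closed_segment 0 t \<subseteq> {-a..a}" using conv t by (simp add: closed_segment_subset)
  have e0: "exp (g 0) = 1" using g(2)[OF \<open>0 \<in> {-a..a}\<close>] f0 by simp
  have "cont_log f t = g t - g 0"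
  proof (rule cont_log_eqI)
    show "continuous_on (closed_segment 0 t) (\<lambda>t. g t - g 0)"
      by (intro continuous_intros continuous_on_subset[OF g(1) seg])
    show "exp (g s - g 0) = f s" if "s \<in> closed_segment 0 t" for s
      using g(2)[of s] that seg e0 by (auto simp: exp_diff)
  qed simp
  then show ?thesis using g(2)[OF t] e0 by (simp add: exp_diff)
qed

lemma cont_log_0: "f 0 = 1 \<Longrightarrow> cont_log f 0 = 0"
  using cont_log_eqI[of 0 "\<lambda>_. 0" f] by auto

lemma nth_vderiv_has_derivative:
  assumes "times_differentiable_on k f I" "i < k" "t \<in> I"
  shows "(nth_vderiv I i f has_vector_derivative nth_vderiv I (Suc i) f t) (at t within I)"
proof -
  have "nth_vderiv I i f differentiable (at t within I)"
    using assms by (auto simp: times_differentiable_on_def differentiable_on_def)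
  then show ?thesis by (simp add: vector_derivative_works nth_vderiv_def)
qed

text \<open>The growth condition comes with a separate interval for each \<open>j\<close>, and its
  derivatives are taken within that interval. At common interior points they are all the ordinary
  derivative, so one family of derivatives can serve all orders.\<close>

lemma nth_vderiv_interior_eq:
  assumes "open U" "U \<subseteq> I" "U \<subseteq> J" "t \<in> U"
  shows "nth_vderiv I i f t = nth_vderiv J i f t"
  using assms(4)
proof (induction i arbitrary: t)
  case (Suc i)
  have "vector_derivative (nth_vderiv I i f) (at t) = vector_derivative (nth_vderiv J i f) (at t)"
  proof (rule vector_derivative_cong_eq)
    show "\<forall>\<^sub>F x in nhds t. x \<in> UNIV \<longrightarrow> nth_vderiv I i f x = nth_vderiv J i f x"
      using assms(1) Suc unfolding eventually_nhds by blast
  qed auto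
  moreover have "at t within I = at t" "at t within J = at t"
    using assms Suc.prems by (auto intro!: at_within_interior simp: interior_def)
  ultimately show ?case by (simp add: nth_vderiv_def)
qed (simp add: nth_vderiv_def)

text \<open>Mean 0 and variance 1 give the characteristic function the derivatives 0 and -1 at 0.
  Differentiating \<open>exp (D 0 t - t\<^sup>2 / 2)\<close> twice and comparing yields
  \<open>D 1 0 = 0\<close> and \<open>D 2 0 - 1 = -1\<close>.\<close>

lemma low_order_vanish:
  fixes D :: "nat \<Rightarrow> real \<Rightarrow> complex" and a :: real
  assumes eta: "real_distribution \<eta>" and mom: "integrable \<eta> (\<lambda>x. x)" "integrable \<eta> (\<lambda>x. x\<^sup>2)"
      "(LINT x|\<eta>. x) = 0" "(LINT x|\<eta>. x\<^sup>2) = 1"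
    and a: "a > 0"
    and deriv: "\<And>i t. i < 2 \<Longrightarrow> t \<in> {-a..a} \<Longrightarrow> (D i has_vector_derivative D (Suc i) t) (at t within {-a..a})"
    and char: "\<And>t. t \<in> {-a..a} \<Longrightarrow> char \<eta> t = exp (D 0 t - of_real (t\<^sup>2 / 2))"
    and D0: "D 0 0 = 0"
  shows "D 1 0 = 0" and "D 2 0 = 0"
proof -
  interpret real_distribution \<eta> by (rule eta)
  have "integrable \<eta> (\<lambda>x. \<bar>x\<bar> ^ 0)" "integrable \<eta> (\<lambda>x. \<bar>x\<bar> ^ 1)" "integrable \<eta> (\<lambda>x. \<bar>x\<bar> ^ 2)"
    using mom by auto
  then have cd: "(char_deriv \<eta> 0 has_vector_derivative char_deriv \<eta> 1 t) (at t)"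
      "(char_deriv \<eta> 1 has_vector_derivative char_deriv \<eta> 2 t) (at t)" for t
    using char_deriv_has_derivative[of 0 t] char_deriv_has_derivative[of 1 t] by (simp_all add: numeral_2_eq_2)
  have c1: "char_deriv \<eta> 1 0 = 0"
  proof -
    have "char_deriv \<eta> 1 0 = (LINT x|\<eta>. \<i> * of_real x)" unfolding char_deriv_def by simp
    also have "\<dots> = \<i> * of_real (LINT x|\<eta>. x)"
      by (simp only: integral_mult_right_zero integral_complex_of_real)
    finally show ?thesis using mom(3) by simp
  qed
  have c2: "char_deriv \<eta> 2 0 = -1"
  proof -
    have "char_deriv \<eta> 2 0 = (LINT x|\<eta>. of_real (- (x\<^sup>2)))" unfolding char_deriv_def by (simp add: power_mult_distrib)
    also have "\<dots> = of_real (LINT x|\<eta>. - (x\<^sup>2))" by (rule integral_complex_of_real)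
    finally show ?thesis using mom(4) by simp
  qed
  let ?I = "{-a..a}"
  have 0: "0 \<in> ?I" using a by simp
  have uniq: "d = d'" if "(f has_vector_derivative d) (at t within ?I)" "(f has_vector_derivative d') (at t within ?I)" "t \<in> ?I"
    for f :: "real \<Rightarrow> complex" and d d' t
    by (rule vector_derivative_unique_within_closed_interval[of "-a" a t, unfolded box_real]) (use that a in auto)
  have sq: "((\<lambda>t. of_real (t\<^sup>2 / 2) :: complex) has_vector_derivative of_real t) (at t within ?I)" for t
    by (intro has_vector_derivative_of_real) (auto intro!: derivative_eq_intros simp flip: has_real_derivative_iff_has_vector_derivative)
  have c0: "char_deriv \<eta> 0 t = exp (D 0 t - of_real (t\<^sup>2 / 2))" if "t \<in> ?I" for t
    using char[OF that] by (simp add: char_deriv_0)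
  have d1: "char_deriv \<eta> 1 t = (D 1 t - of_real t) * char_deriv \<eta> 0 t" if t: "t \<in> ?I" for t
  proof (rule uniq[OF has_vector_derivative_at_within[OF cd(1)] _ t])
    have "((\<lambda>t. D 0 t - of_real (t\<^sup>2 / 2)) has_vector_derivative D 1 t - of_real t) (at t within ?I)"
      using deriv[of 0 t] t by (intro has_vector_derivative_diff sq) auto
    from field_vector_diff_chain_within[OF this, of exp "exp (D 0 t - of_real (t\<^sup>2 / 2))"]
    have "((\<lambda>t. exp (D 0 t - of_real (t\<^sup>2 / 2))) has_vector_derivative (D 1 t - of_real t) * exp (D 0 t - of_real (t\<^sup>2 / 2))) (at t within ?I)"
      by (simp add: o_def DERIV_exp has_field_derivative_at_within)
    then have "((\<lambda>t. exp (D 0 t - of_real (t\<^sup>2 / 2))) has_vector_derivative (D 1 t - of_real t) * char_deriv \<eta> 0 t) (at t within ?I)"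
      by (simp only: c0[OF t])
    then show "(char_deriv \<eta> 0 has_vector_derivative (D 1 t - of_real t) * char_deriv \<eta> 0 t) (at t within ?I)"
      by (rule has_vector_derivative_transform[OF t, rotated]) (rule c0)
  qed
  have one: "char_deriv \<eta> 0 0 = 1" by (simp add: char_deriv_0 char_zero)
  show D1: "D 1 0 = 0" using d1[OF 0] c1 one by simp
  have "((\<lambda>t. (D 1 t - of_real t) * char_deriv \<eta> 0 t) has_vector_derivative (D 1 0 - of_real 0) * char_deriv \<eta> 1 0 + (D 2 0 - 1) * char_deriv \<eta> 0 0) (at 0 within ?I)"
  proof (intro has_vector_derivative_mult has_vector_derivative_diff)
    show "(D 1 has_vector_derivative D 2 0) (at 0 within ?I)" using deriv[of 1 0] 0 by (simp add: numeral_2_eq_2)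
    show "(of_real has_vector_derivative 1) (at 0 within ?I)"
      using has_vector_derivative_of_real[of "\<lambda>x. x" 1 "at 0 within ?I"] by simp
    show "(char_deriv \<eta> 0 has_vector_derivative char_deriv \<eta> 1 0) (at 0 within ?I)"
      by (rule has_vector_derivative_at_within[OF cd(1)])
  qed
  then have "((char_deriv \<eta> 1) has_vector_derivative (D 1 0 - of_real 0) * char_deriv \<eta> 1 0 + (D 2 0 - 1) * char_deriv \<eta> 0 0) (at 0 within ?I)"
    by (rule has_vector_derivative_transform[OF 0, rotated]) (rule d1)
  from uniq[OF has_vector_derivative_at_within[OF cd(2)] this 0]
  show "D 2 0 = 0" using c2 one D1 c1 by simp
qed

lemma cubic_bound:
  fixes D :: "nat \<Rightarrow> real \<Rightarrow> complex" and a K :: real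
  assumes K: "K \<ge> 0" and zero: "\<And>i. i < 3 \<Longrightarrow> D i 0 = 0"
    and deriv: "\<And>i t. i < 3 \<Longrightarrow> t \<in> {-a..a} \<Longrightarrow> (D i has_vector_derivative D (Suc i) t) (at t within {-a..a})"
    and bound: "\<And>t. t \<in> {-a..a} \<Longrightarrow> norm (D 3 t) \<le> K"
    and t: "t \<in> {-a..a}"
  shows "norm (D 0 t) \<le> K * \<bar>t\<bar> ^ 3"
proof -
  have I: "convex {-a..a}" "0 \<in> {-a..a}" using t by auto
  have 2: "norm (D 2 t) \<le> K * \<bar>t\<bar> ^ Suc 0" if "t \<in> {-a..a}" for t
    by (rule mean_value_power_bound[OF I _ K, where u' = "D 3"]) (use zero[of 2] deriv[of 2] bound that in \<open>auto simp: eval_nat_numeral\<close>)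
  have 1: "norm (D 1 t) \<le> K * \<bar>t\<bar> ^ Suc (Suc 0)" if "t \<in> {-a..a}" for t
    by (rule mean_value_power_bound[OF I _ K, where u' = "D 2"]) (use zero[of 1] deriv[of 1] 2 that in \<open>auto simp: eval_nat_numeral\<close>)
  have 0: "norm (D 0 t) \<le> K * \<bar>t\<bar> ^ Suc (Suc (Suc 0))"
    by (rule mean_value_power_bound[OF I _ K, where u' = "D 1"]) (use zero[of 0] deriv[of 0] 1 t in auto)
  then show ?thesis by (simp add: eval_nat_numeral)
qed

lemma (in prob_space) standardized_law:
  assumes "centered_L2 M X" "L2_norm M X > 0"
  defines "\<eta> \<equiv> distr M borel (\<lambda>w. X w / L2_norm M X)"
  shows "real_distribution \<eta>" and "integrable \<eta> (\<lambda>x. x)" and "integrable \<eta> (\<lambda>x. x\<^sup>2)"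
    and "(LINT x|\<eta>. x) = 0" and "(LINT x|\<eta>. x\<^sup>2) = 1"
proof -
  have X[measurable]: "X \<in> borel_measurable M" and i2: "integrable M (\<lambda>w. (X w)\<^sup>2)" and i1: "integrable M X"
    and m: "(LINT w|M. X w) = 0" using assms by (auto simp: centered_L2_def)
  let ?s = "L2_norm M X"
  show "real_distribution \<eta>" unfolding \<eta>_def by (intro real_distribution_distr) measurable
  show "integrable \<eta> (\<lambda>x. x)" unfolding \<eta>_def using i1 by (subst integrable_distr_eq) auto
  show "integrable \<eta> (\<lambda>x. x\<^sup>2)" unfolding \<eta>_def using i2 by (subst integrable_distr_eq) (auto simp: power_divide)
  show "(LINT x|\<eta>. x) = 0" unfolding \<eta>_def using m by (subst integral_distr) auto
  have "(LINT w|M. (X w)\<^sup>2) \<ge> 0" by simp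
  then have "?s\<^sup>2 = (LINT w|M. (X w)\<^sup>2)" unfolding L2_norm_def by simp
  moreover have "(LINT x|\<eta>. x\<^sup>2) = (LINT w|M. (X w)\<^sup>2) / ?s\<^sup>2" unfolding \<eta>_def by (subst integral_distr) (auto simp: power_divide)
  ultimately show "(LINT x|\<eta>. x\<^sup>2) = 1" using assms(2) by (metis divide_self less_irrefl zero_eq_power2)
qed

text \<open>The shift by \<open>Suc\<close> is due to the locale ranging over all natural numbers
  while the sequence starts at 1.\<close>

lemma growth_condition_edgeworth:
  assumes "prob_space M" and S: "\<And>n. centered_L2 M (S (Suc n))" "\<And>n. L2_norm M (S (Suc n)) > 0"
    and delta: "\<delta> > 0" "\<And>n. L2_norm M (S (Suc n)) \<ge> \<delta>"
    and m: "m \<ge> 3" and growth: "growth_condition M S m"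
  shows "\<exists>\<epsilon> Cb D \<zeta>. edgeworth (\<lambda>n. L2_norm M (S (Suc n))) \<delta> \<epsilon> Cb m D \<zeta> \<and>
    (\<forall>n. \<forall>t\<in>{-\<epsilon> * L2_norm M (S (Suc n))..\<epsilon> * L2_norm M (S (Suc n))}.
      char (distr M borel (\<lambda>w. S (Suc n) w / L2_norm M (S (Suc n)))) t = exp (D 0 n t - of_real (t\<^sup>2 / 2)))"
proof -
  interpret prob_space M by fact
  define \<sigma> where "\<sigma> n = L2_norm M (S (Suc n))" for n
  have pos: "\<sigma> n > 0" for n using S(2) by (simp add: \<sigma>_def)
  let ?G = "\<lambda>j C e n. (\<forall>t\<in>{- e * \<sigma> n..e * \<sigma> n}. normalized_char M (S (Suc n)) t \<noteq> 0) \<and>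
    times_differentiable_on j (Lambda M (S (Suc n))) {- e * \<sigma> n..e * \<sigma> n} \<and>
    (\<forall>t\<in>{- e * \<sigma> n..e * \<sigma> n}. norm (nth_vderiv {- e * \<sigma> n..e * \<sigma> n} j (Lambda M (S (Suc n))) t) \<le> C / \<sigma> n ^ (j - 2))"
  have "\<forall>j\<in>{3..m + 1}. \<exists>C e. C > 0 \<and> e > 0 \<and> (\<forall>n. ?G j C e n)"
  proof
    fix j assume "j \<in> {3..m + 1}"
    then obtain C e where Ce: "C > 0" "e > 0" "\<forall>n\<ge>1. let s = L2_norm M (S n); I = {-e * s..e * s} in
          (\<forall>t\<in>I. normalized_char M (S n) t \<noteq> 0) \<and> times_differentiable_on j (Lambda M (S n)) I \<and>
          (\<forall>t\<in>I. norm (nth_vderiv I j (Lambda M (S n)) t) \<le> C / s ^ (j - 2))"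
      using growth unfolding growth_condition_def by blast
    have "?G j C e n" for n
      using Ce(3)[rule_format, of "Suc n", unfolded Let_def, folded \<sigma>_def] by simp
    then show "\<exists>C e. C > 0 \<and> e > 0 \<and> (\<forall>n. ?G j C e n)" using Ce(1,2) by blast
  qed
  then obtain C e where Ce: "\<And>j. j \<in> {3..m + 1} \<Longrightarrow> C j > 0 \<and> e j > 0 \<and> (\<forall>n. ?G j (C j) (e j) n)"
    unfolding bchoice_iff by blast
  define Cb where "Cb = Max (C ` {3..m + 1})"
  define e0 where "e0 = Min (e ` {3..m + 1})"
  have ne: "finite {3..m + 1}" "{3..m + 1} \<noteq> {}" using m by auto
  have Cb_ge: "C j \<le> Cb" if "j \<in> {3..m + 1}" for j unfolding Cb_def using that by auto
  have e0_le: "e0 \<le> e j" if "j \<in> {3..m + 1}" for j unfolding e0_def using that by auto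
  have e0: "e0 > 0" unfolding e0_def using ne Ce by (subst Min_gr_iff) auto
  have mem: "m + 1 \<in> {3..m + 1}" "3 \<in> {3..m + 1}" using m by auto
  have Cb: "Cb > 0" using Cb_ge[OF mem(1)] Ce[OF mem(1)] by linarith
  \<comment> \<open>Smaller than every \<open>e j\<close>, so that \<open>?I n\<close> is interior
    to all intervals of the growth condition; at most \<open>1 / (4 * Cb)\<close>, so that the cubic
    bound \<open>Cb |t|^3 / \<sigma> n\<close> is at most \<open>t\<^sup>2 / 4\<close>.\<close>
  define \<epsilon> where "\<epsilon> = min (e0 / 2) (1 / (4 * Cb))"
  have \<epsilon>: "\<epsilon> > 0" "\<epsilon> < e0" "\<epsilon> * Cb \<le> 1 / 4" using e0 Cb by (auto simp: \<epsilon>_def min_def field_simps)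
  \<comment> \<open>The interval belonging to \<open>j = m + 1\<close> admits \<open>m + 1\<close>
    derivatives, so derivatives of all orders are iterated within it.\<close>
  define J where "J n = {- e (m + 1) * \<sigma> n..e (m + 1) * \<sigma> n}" for n
  define D where "D i n = nth_vderiv (J n) i (Lambda M (S (Suc n)))" for i n
  let ?I = "\<lambda>n. {-\<epsilon> * \<sigma> n..\<epsilon> * \<sigma> n}"
  have sub: "?I n \<subseteq> {-e0 * \<sigma> n<..<e0 * \<sigma> n}" for n
    using mult_strict_right_mono[OF \<epsilon>(2) pos[of n]] by auto
  have subj: "{-e0 * \<sigma> n<..<e0 * \<sigma> n} \<subseteq> {- e j * \<sigma> n..e j * \<sigma> n}" if "j \<in> {3..m + 1}" for j n
  proof
    fix x assume x: "x \<in> {-e0 * \<sigma> n<..<e0 * \<sigma> n}"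
    have "e0 * \<sigma> n \<le> e j * \<sigma> n" using e0_le[OF that] pos[of n] by (intro mult_right_mono) auto
    then show "x \<in> {- e j * \<sigma> n..e j * \<sigma> n}" using x by auto
  qed
  have IJ: "?I n \<subseteq> J n" for n unfolding J_def using sub subj[OF mem(1)] by blast
  have deriv: "(D i n has_vector_derivative D (Suc i) n t) (at t within ?I n)" if "i \<le> m" "t \<in> ?I n" for i n t
  proof -
    have "(D i n has_vector_derivative D (Suc i) n t) (at t within J n)"
      unfolding D_def using Ce[OF mem(1)] that IJ[of n]
      by (intro nth_vderiv_has_derivative[of "m + 1"]) (auto simp: J_def)
    then show ?thesis using IJ has_vector_derivative_within_subset by blast
  qed
  have bound: "norm (D i n t) \<le> Cb * (1 / \<sigma> n) ^ (i - 2)" if i: "3 \<le> i" "i \<le> Suc m" and t: "t \<in> ?I n" for i n t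
  proof -
    have i': "i \<in> {3..m + 1}" using i by auto
    have t': "t \<in> {-e0 * \<sigma> n<..<e0 * \<sigma> n}" using sub t by blast
    have "D i n t = nth_vderiv {- e i * \<sigma> n..e i * \<sigma> n} i (Lambda M (S (Suc n))) t"
      unfolding D_def J_def by (rule nth_vderiv_interior_eq[OF open_greaterThanLessThan subj[OF mem(1)] subj[OF i'] t'])
    also have "norm \<dots> \<le> C i / \<sigma> n ^ (i - 2)" using Ce[OF i'] subj[OF i', of n] t' by blast
    also have "\<dots> \<le> Cb * (1 / \<sigma> n) ^ (i - 2)"
      using Cb_ge[OF i'] pos[of n] by (simp add: power_divide divide_right_mono)
    finally show ?thesis .
  qed
  have D0: "D 0 n t = cont_log (normalized_char M (S (Suc n))) t + of_real (t\<^sup>2 / 2)" for n t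
    by (simp add: D_def nth_vderiv_def Lambda_def)
  note law = standardized_law[OF S]
  have nchar: "normalized_char M (S (Suc n)) = char (distr M borel (\<lambda>w. S (Suc n) w / \<sigma> n))" for n
    by (simp add: normalized_char_def \<sigma>_def)
  have char: "char (distr M borel (\<lambda>w. S (Suc n) w / \<sigma> n)) t = exp (D 0 n t - of_real (t\<^sup>2 / 2))" if t: "t \<in> ?I n" for n t
  proof -
    interpret X: real_distribution "distr M borel (\<lambda>w. S (Suc n) w / \<sigma> n)" unfolding \<sigma>_def by (rule law)
    have "exp (cont_log (normalized_char M (S (Suc n))) t) = normalized_char M (S (Suc n)) t"
    proof (rule cont_log_exp[where a = "e (m + 1) * \<sigma> n"])
      show "continuous_on {- (e (m + 1) * \<sigma> n)..e (m + 1) * \<sigma> n} (normalized_char M (S (Suc n)))"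
        unfolding nchar by (intro continuous_at_imp_continuous_on ballI X.isCont_char)
      show "normalized_char M (S (Suc n)) 0 = 1" unfolding nchar by (rule X.char_zero)
    qed (use Ce[OF mem(1)] t IJ[of n] in \<open>auto simp: J_def\<close>)
    then show ?thesis unfolding D0 nchar by simp
  qed
  have D00: "D 0 n 0 = 0" for n
  proof -
    interpret X: real_distribution "distr M borel (\<lambda>w. S (Suc n) w / \<sigma> n)" unfolding \<sigma>_def by (rule law)
    show ?thesis unfolding D0 nchar using X.char_zero by (simp add: cont_log_0)
  qed
  have D12: "D 1 n 0 = 0 \<and> D 2 n 0 = 0" for n
  proof -
    have a: "\<epsilon> * \<sigma> n > 0" using \<epsilon>(1) pos[of n] by simp
    have d: "(D i n has_vector_derivative D (Suc i) n t) (at t within {- (\<epsilon> * \<sigma> n)..\<epsilon> * \<sigma> n})"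
      if "i < 2" "t \<in> {- (\<epsilon> * \<sigma> n)..\<epsilon> * \<sigma> n}" for i t
      using deriv[of i t n] that m by simp
    have c: "char (distr M borel (\<lambda>w. S (Suc n) w / \<sigma> n)) t = exp (D 0 n t - of_real (t\<^sup>2 / 2))"
      if "t \<in> {- (\<epsilon> * \<sigma> n)..\<epsilon> * \<sigma> n}" for t
      using that by (intro char) simp
    note * = low_order_vanish[OF law[of n, folded \<sigma>_def] a, of "\<lambda>i. D i n", OF d c D00]
    show ?thesis using * by blast
  qed
  have zero: "D i n 0 = 0" if "i < 3" for i n
  proof -
    have "i = 0 \<or> i = 1 \<or> i = 2" using that by auto
    then show ?thesis using D00 D12 by auto
  qed
  have quarter: "norm (D 0 n t) \<le> t\<^sup>2 / 4" if t: "t \<in> ?I n" for n t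
  proof -
    have "norm (D 0 n t) \<le> (Cb * (1 / \<sigma> n)) * \<bar>t\<bar> ^ 3"
    proof (rule cubic_bound[where a = "\<epsilon> * \<sigma> n" and D = "\<lambda>i. D i n"])
      show "norm (D 3 n t) \<le> Cb * (1 / \<sigma> n)" if "t \<in> {- (\<epsilon> * \<sigma> n)..\<epsilon> * \<sigma> n}" for t
        using bound[of 3 t n] that m by simp
      show "(D i n has_vector_derivative D (Suc i) n t) (at t within {- (\<epsilon> * \<sigma> n)..\<epsilon> * \<sigma> n})"
        if "i < 3" "t \<in> {- (\<epsilon> * \<sigma> n)..\<epsilon> * \<sigma> n}" for i t
        using deriv[of i t n] that m by simp
    qed (use t zero Cb pos[of n] in auto)
    also have "\<dots> = (Cb * (\<bar>t\<bar> / \<sigma> n)) * t\<^sup>2" by (simp add: power3_eq_cube power2_eq_square)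
    also have "\<dots> \<le> (1 / 4) * t\<^sup>2"
    proof (rule mult_right_mono)
      have "\<bar>t\<bar> / \<sigma> n \<le> \<epsilon>" using t pos[of n] by (simp add: pos_divide_le_eq abs_le_iff)
      then have "Cb * (\<bar>t\<bar> / \<sigma> n) \<le> Cb * \<epsilon>" using Cb by (intro mult_left_mono) auto
      then show "Cb * (\<bar>t\<bar> / \<sigma> n) \<le> 1 / 4" using \<epsilon>(3) mult.commute[of Cb \<epsilon>] by linarith
    qed simp
    finally show ?thesis by simp
  qed
  obtain \<zeta> where \<zeta>: "real_distribution \<zeta>" "\<And>j. j \<le> 2 * m + 2 \<Longrightarrow> integrable \<zeta> (\<lambda>x. \<bar>x\<bar> ^ j)"
     "\<And>t. \<bar>t\<bar> > \<epsilon> / 2 \<Longrightarrow> char \<zeta> t = 0"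
    using band_limited_law_scaled[of "\<epsilon> / 2" "2 * m + 2"] \<epsilon>(1) by auto
  have "edgeworth \<sigma> \<delta> \<epsilon> Cb m D \<zeta>"
  proof (rule edgeworth.intro)
    show "\<delta> \<le> \<sigma> n" for n using delta(2) by (simp add: \<sigma>_def)
  qed (fact delta(1) m \<epsilon>(1) less_imp_le[OF Cb] deriv zero bound quarter \<zeta>)+
  moreover have "\<forall>n. \<forall>t\<in>?I n. char (distr M borel (\<lambda>w. S (Suc n) w / \<sigma> n)) t = exp (D 0 n t - of_real (t\<^sup>2 / 2))"
    using char by blast
  ultimately show ?thesis unfolding \<sigma>_def by blast
qed

section \<open>The Wasserstein bound\<close>

lemma sum4_powr_le:
  fixes x y z w p :: real
  assumes "x \<ge> 0" "y \<ge> 0" "z \<ge> 0" "w \<ge> 0" "p \<ge> 0"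
  shows "(x + y + z + w) powr p \<le> 4 powr p * (x powr p + y powr p + z powr p + w powr p)"
proof -
  have "((x + y) + (z + w)) powr p \<le> 2 powr p * ((x + y) powr p + (z + w) powr p)"
    using assms by (intro powr_add_le) auto
  also have "\<dots> \<le> 2 powr p * (2 powr p * (x powr p + y powr p) + 2 powr p * (z powr p + w powr p))"
    using assms by (intro mult_left_mono add_mono powr_add_le) auto
  also have "\<dots> = (2 powr p * 2 powr p) * (x powr p + y powr p + z powr p + w powr p)" by (simp add: algebra_simps)
  also have "2 powr p * 2 powr p = (4::real) powr p" by (simp flip: powr_mult)
  finally show ?thesis by (simp add: add.assoc)
qed

text \<open>The coupling is the joint law of \<open>W\<close> and \<open>T(Y)\<close> on the product
  space, and \<open>|W - T(Y)| \<le> |W - X| + s |Z| + |T(Y) - Y|\<close>, where each summand is of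
  order \<open>s\<close> in \<open>L^p\<close>.\<close>

lemma wasserstein_coupling_bound:
  fixes p c s S CM CZ :: real
  assumes "prob_space M" "real_distribution \<zeta>" and [measurable]: "X \<in> borel_measurable M" "W \<in> borel_measurable M" "T \<in> borel_measurable borel"
    and p: "p \<ge> 1" and s: "0 < s" "s \<le> S" and nn: "c \<ge> 0" "CM \<ge> 0" "CZ \<ge> 0"
    and mu: "\<mu> = distr (M \<Otimes>\<^sub>M \<zeta>) borel (\<lambda>z. X (fst z) + s * snd z)"
    and T: "distr \<mu> borel T = \<nu>"
    and W: "\<And>w. \<bar>W w - X w\<bar> \<le> c * s * (1 + \<bar>X w\<bar>)"
    and moment: "(\<integral>\<^sup>+y. ennreal (\<bar>y\<bar> powr p) \<partial>\<mu>) \<le> ennreal CM"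
    and transport: "(\<integral>\<^sup>+y. ennreal (\<bar>T y - y\<bar> powr p) \<partial>\<mu>) \<le> ennreal (CM * s powr p)"
    and noise: "(\<integral>\<^sup>+z. ennreal (\<bar>z\<bar> powr p) \<partial>\<zeta>) \<le> ennreal CZ"
  shows "wasserstein p (distr M borel W) \<nu> \<le>
    ennreal ((4 powr p * (c powr p + c powr p * CM + (c * S + 1) powr p * CZ + CM)) powr (1 / p) * s)"
proof -
  interpret M: prob_space M by fact
  interpret Z: real_distribution \<zeta> by fact
  interpret pair_prob_space M \<zeta> ..
  let ?\<Omega> = "M \<Otimes>\<^sub>M \<zeta>"
  have [measurable_cong]: "sets \<zeta> = sets borel" by simp
  define Y where "Y z = X (fst z) + s * snd z" for z :: "'a \<times> real"
  have [measurable]: "Y \<in> borel_measurable ?\<Omega>" unfolding Y_def[abs_def] by measurable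
  have mu': "\<mu> = distr ?\<Omega> borel Y" unfolding mu Y_def[abs_def] ..
  define \<gamma> where "\<gamma> = distr ?\<Omega> (borel \<Otimes>\<^sub>M borel) (\<lambda>z. (W (fst z), T (Y z)))"
  have "\<gamma> \<in> couplings (distr M borel W) \<nu>"
    unfolding couplings_def
  proof (intro CollectI conjI)
    show "prob_space \<gamma>" unfolding \<gamma>_def by (intro prob_space_distr) measurable
    show "sets \<gamma> = sets (borel \<Otimes>\<^sub>M borel)" by (simp add: \<gamma>_def)
    have "distr \<gamma> borel fst = distr ?\<Omega> borel (\<lambda>z. W (fst z))"
      unfolding \<gamma>_def by (subst distr_distr) (auto simp: comp_def)
    also have "\<dots> = distr (distr ?\<Omega> M fst) borel W" by (subst distr_distr) (auto simp: comp_def)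
    also have "distr ?\<Omega> M fst = M" by (rule Z.distr_pair_fst)
    finally show "distr \<gamma> borel fst = distr M borel W" .
    have "distr \<gamma> borel snd = distr ?\<Omega> borel (\<lambda>z. T (Y z))"
      unfolding \<gamma>_def by (subst distr_distr) (auto simp: comp_def)
    also have "\<dots> = distr \<mu> borel T" unfolding mu' by (subst distr_distr) (auto simp: comp_def)
    finally show "distr \<gamma> borel snd = \<nu>" using T by simp
  qed
  then have le: "wasserstein p (distr M borel W) \<nu> \<le> Lp_norm p \<gamma> (\<lambda>z. fst z - snd z)"
    unfolding wasserstein_def by (rule INF_lower)
  define Q where "Q = 4 powr p * (c powr p + c powr p * CM + (c * S + 1) powr p * CZ + CM)"
  have Q0: "Q \<ge> 0" using nn by (auto simp: Q_def intro!: mult_nonneg_nonneg add_nonneg_nonneg)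
  define k where "k = 4 powr p"
  have pw: "\<bar>W (fst z) - T (Y z)\<bar> powr p \<le> k * ((c powr p * s powr p) + (c powr p * s powr p) * \<bar>Y z\<bar> powr p
      + ((c * S + 1) powr p * s powr p) * \<bar>snd z\<bar> powr p + \<bar>T (Y z) - Y z\<bar> powr p)" for z
  proof -
    \<comment> \<open>The hypotheses contain no moment of \<open>X\<close>; it is controlled through
      \<open>Y\<close> and the noise.\<close>
    have XY: "\<bar>X (fst z)\<bar> \<le> \<bar>Y z\<bar> + s * \<bar>snd z\<bar>"
      using abs_triangle_ineq4[of "Y z" "s * snd z"] s(1) by (simp add: Y_def abs_mult)
    have "\<bar>W (fst z) - T (Y z)\<bar> \<le> \<bar>W (fst z) - X (fst z)\<bar> + \<bar>X (fst z) - Y z\<bar> + \<bar>T (Y z) - Y z\<bar>" by linarith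
    also have "\<bar>X (fst z) - Y z\<bar> = s * \<bar>snd z\<bar>" using s(1) by (simp add: Y_def abs_mult)
    also have "\<bar>W (fst z) - X (fst z)\<bar> \<le> c * s * (1 + (\<bar>Y z\<bar> + s * \<bar>snd z\<bar>))"
      using W[of "fst z"] mult_left_mono[OF XY, of "c * s"] nn(1) s(1) by (simp add: distrib_left)
    also have "c * s * (1 + (\<bar>Y z\<bar> + s * \<bar>snd z\<bar>)) + s * \<bar>snd z\<bar> + \<bar>T (Y z) - Y z\<bar>
      = c * s + c * s * \<bar>Y z\<bar> + (c * s + 1) * (s * \<bar>snd z\<bar>) + \<bar>T (Y z) - Y z\<bar>" by (simp add: algebra_simps)
    also have "\<dots> \<le> c * s + c * s * \<bar>Y z\<bar> + (c * S + 1) * (s * \<bar>snd z\<bar>) + \<bar>T (Y z) - Y z\<bar>"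
      using nn(1) s by (intro add_mono mult_right_mono mult_left_mono order_refl) auto
    finally have "\<bar>W (fst z) - T (Y z)\<bar> powr p \<le> (c * s + c * s * \<bar>Y z\<bar> + (c * S + 1) * (s * \<bar>snd z\<bar>) + \<bar>T (Y z) - Y z\<bar>) powr p"
      using p by (intro powr_mono2) auto
    also have "\<dots> \<le> k * ((c * s) powr p + (c * s * \<bar>Y z\<bar>) powr p + ((c * S + 1) * (s * \<bar>snd z\<bar>)) powr p + \<bar>T (Y z) - Y z\<bar> powr p)"
      unfolding k_def using nn(1) s p by (intro sum4_powr_le) auto
    finally show ?thesis by (simp only: powr_mult mult.assoc)
  qed
  have I: "(\<integral>\<^sup>+z. ennreal (\<bar>W (fst z) - T (Y z)\<bar> powr p) \<partial>?\<Omega>) \<le> ennreal (Q * s powr p)"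
  proof -
    let ?a = "c powr p * s powr p" and ?b = "(c * S + 1) powr p * s powr p"
    have k0: "k \<ge> 0" by (simp add: k_def)
    have 1: "(\<integral>\<^sup>+z. ennreal (\<bar>Y z\<bar> powr p) \<partial>?\<Omega>) \<le> ennreal CM"
      using moment unfolding mu' by (subst (asm) nn_integral_distr) auto
    have 2: "(\<integral>\<^sup>+z. ennreal (\<bar>T (Y z) - Y z\<bar> powr p) \<partial>?\<Omega>) \<le> ennreal (CM * s powr p)"
      using transport unfolding mu' by (subst (asm) nn_integral_distr) auto
    have 3: "(\<integral>\<^sup>+z. ennreal (\<bar>snd z\<bar> powr p) \<partial>?\<Omega>) \<le> ennreal CZ"
    proof -
      have "(\<integral>\<^sup>+z. ennreal (\<bar>snd z\<bar> powr p) \<partial>?\<Omega>) = (\<integral>\<^sup>+x. \<integral>\<^sup>+z. ennreal (\<bar>z\<bar> powr p) \<partial>\<zeta> \<partial>M)"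
        by (subst Z.nn_integral_fst[symmetric]) auto
      also have "\<dots> = (\<integral>\<^sup>+z. ennreal (\<bar>z\<bar> powr p) \<partial>\<zeta>)" by (simp add: M.emeasure_space_1)
      finally show ?thesis using noise by simp
    qed
    have "(\<integral>\<^sup>+z. ennreal (\<bar>W (fst z) - T (Y z)\<bar> powr p) \<partial>?\<Omega>) \<le>
      (\<integral>\<^sup>+z. ennreal k * (ennreal ?a + ennreal ?a * ennreal (\<bar>Y z\<bar> powr p) + ennreal ?b * ennreal (\<bar>snd z\<bar> powr p) + ennreal (\<bar>T (Y z) - Y z\<bar> powr p)) \<partial>?\<Omega>)"
    proof (intro nn_integral_mono)
      fix z
      show "ennreal (\<bar>W (fst z) - T (Y z)\<bar> powr p) \<le> ennreal k * (ennreal ?a + ennreal ?a * ennreal (\<bar>Y z\<bar> powr p) + ennreal ?b * ennreal (\<bar>snd z\<bar> powr p) + ennreal (\<bar>T (Y z) - Y z\<bar> powr p))"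
        using ennreal_leI[OF pw[of z]] k0 by (simp add: ennreal_mult ennreal_plus)
    qed
    also have "\<dots> = ennreal k * (ennreal ?a + ennreal ?a * (\<integral>\<^sup>+z. ennreal (\<bar>Y z\<bar> powr p) \<partial>?\<Omega>) + ennreal ?b * (\<integral>\<^sup>+z. ennreal (\<bar>snd z\<bar> powr p) \<partial>?\<Omega>) + (\<integral>\<^sup>+z. ennreal (\<bar>T (Y z) - Y z\<bar> powr p) \<partial>?\<Omega>))"
      by (simp add: nn_integral_cmult nn_integral_add emeasure_space_1)
    also have "\<dots> \<le> ennreal k * (ennreal ?a + ennreal ?a * ennreal CM + ennreal ?b * ennreal CZ + ennreal (CM * s powr p))"
      by (intro mult_left_mono add_mono order_refl 1 2 3) auto
    also have "\<dots> = ennreal (k * (?a + ?a * CM + ?b * CZ + CM * s powr p))"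
      using nn k0 by (simp add: ennreal_mult ennreal_plus)
    also have "k * (?a + ?a * CM + ?b * CZ + CM * s powr p) = Q * s powr p"
      by (simp add: Q_def k_def algebra_simps)
    finally show ?thesis .
  qed
  have "Lp_norm p \<gamma> (\<lambda>z. fst z - snd z) \<le> ennreal (Q powr (1 / p) * s)"
  proof -
    define J where "J = (\<integral>\<^sup>+x. ennreal (\<bar>fst x - snd x\<bar> powr p) \<partial>\<gamma>)"
    have "J = (\<integral>\<^sup>+z. ennreal (\<bar>W (fst z) - T (Y z)\<bar> powr p) \<partial>?\<Omega>)"
      unfolding J_def \<gamma>_def by (subst nn_integral_distr) auto
    then have J: "J \<le> ennreal (Q * s powr p)" using I by simp
    \<comment> \<open>Finiteness excludes the infinite branch in \<open>Lp_norm\<close>.\<close>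
    then have "J \<noteq> \<infinity>" by (auto simp: top_unique)
    have "enn2real J \<le> Q * s powr p" using J Q0 by (intro enn2real_leI) auto
    then have "enn2real J powr (1 / p) \<le> (Q * s powr p) powr (1 / p)" using p by (intro powr_mono2) auto
    also have "\<dots> = Q powr (1 / p) * s" using p s by (simp add: powr_mult powr_powr)
    finally show ?thesis
      using \<open>J \<noteq> \<infinity>\<close> unfolding Lp_norm_def Let_def J_def[symmetric] by (simp add: ennreal_leI)
  qed
  then show ?thesis using le unfolding Q_def by (rule order_trans[rotated])
qed

lemma bounded_seq_from_eventually:
  fixes u :: "nat \<Rightarrow> real"
  assumes "\<forall>\<^sub>F n in sequentially. \<bar>u n\<bar> \<le> C"
  shows "\<exists>K\<ge>0. \<forall>n. \<bar>u n\<bar> \<le> K"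
proof -
  have "Bseq u" using assms by (intro BfunI) simp
  then show ?thesis by (auto simp: Bseq_def intro: less_imp_le)
qed

lemma inverse_bounded:
  fixes u :: "nat \<Rightarrow> real"
  assumes "filterlim u at_top sequentially" "\<And>n. n \<ge> 1 \<Longrightarrow> u n > 0"
  shows "\<exists>K>0. \<forall>n\<ge>1. 1 / u n \<le> K"
proof -
  have "\<forall>\<^sub>F n in sequentially. 1 \<le> u n" using assms(1) unfolding filterlim_at_top by blast
  then have "\<forall>\<^sub>F n in sequentially. \<bar>1 / u n\<bar> \<le> 1"
    by eventually_elim (simp add: abs_of_pos divide_le_eq)
  then obtain K where K: "K \<ge> 0" "\<And>n. \<bar>1 / u n\<bar> \<le> K"
    using bounded_seq_from_eventually[of "\<lambda>n. 1 / u n" 1] by blast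
  have "1 / u n \<le> K + 1" for n using abs_ge_self[of "1 / u n"] K(2)[of n] by linarith
  then show ?thesis using K(1) by (intro exI[of _ "K + 1"]) simp
qed

theorem theorem9:
  fixes M :: "'a measure" and S :: "nat \<Rightarrow> 'a \<Rightarrow> real"
    and A B :: "nat \<Rightarrow> real" and m :: nat and p :: real
  assumes "prob_space M"
    and "\<And>n. n \<ge> 1 \<Longrightarrow> centered_L2 M (S n)"
    and "\<And>n. n \<ge> 1 \<Longrightarrow> L2_norm M (S n) > 0"
    and "filterlim (\<lambda>n. L2_norm M (S n)) at_top sequentially"
    and "bounded (A ` {1..})"
    and "\<And>n. n \<ge> 1 \<Longrightarrow> B n > 0"
    and "(\<lambda>n. B n - L2_norm M (S n)) \<in> O(\<lambda>_. 1)"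
    and "m \<ge> 2"
    and "growth_condition M S m"
    and "1 \<le> p" and "p < real m - 1"
  shows "\<exists>C>0. \<forall>n\<ge>1.
    wasserstein p (distr M borel (\<lambda>w. (S n w - A n) / B n)) std_normal_distribution
      \<le> ennreal (C * inverse (B n))"
proof -
  interpret prob_space M by fact
  define \<sigma> where "\<sigma> n = L2_norm M (S n)" for n
  have \<sigma>_pos: "\<sigma> n > 0" if "n \<ge> 1" for n using assms(3) that by (simp add: \<sigma>_def)
  obtain a where a: "\<And>n. n \<ge> 1 \<Longrightarrow> \<bar>A n\<bar> \<le> a"
    using assms(5) unfolding bounded_iff by auto
  have "a \<ge> 0" using a[of 1] by simp
  obtain b where b: "b \<ge> 0" "\<And>n. \<bar>B n - \<sigma> n\<bar> \<le> b"
  proof -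
    obtain c where "c > 0" "\<forall>\<^sub>F n in sequentially. norm (B n - \<sigma> n) \<le> c * norm (1::real)"
      using assms(7) unfolding \<sigma>_def by (elim landau_o.bigE)
    then show ?thesis using that bounded_seq_from_eventually[of "\<lambda>n. B n - \<sigma> n" c] by auto
  qed
  have lim: "filterlim \<sigma> at_top sequentially" using assms(4) by (simp add: \<sigma>_def[abs_def])
  obtain K1 where K1: "K1 > 0" "\<And>n. n \<ge> 1 \<Longrightarrow> 1 / \<sigma> n \<le> K1"
    using inverse_bounded[of \<sigma>, OF lim \<sigma>_pos] by blast
  have limB: "filterlim B at_top sequentially"
  proof (rule filterlim_at_top_mono)
    show "filterlim (\<lambda>n. - b + \<sigma> n) at_top sequentially"
      by (intro filterlim_tendsto_add_at_top[OF tendsto_const] lim)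
    show "\<forall>\<^sub>F n in sequentially. - b + \<sigma> n \<le> B n"
      using b(2) by (intro always_eventually allI) (smt (verit))
  qed
  obtain K2 where K2: "K2 > 0" "\<And>n. n \<ge> 1 \<Longrightarrow> 1 / B n \<le> K2"
    using inverse_bounded[of B, OF limB assms(6)] by blast
  \<comment> \<open>For \<open>m = 2\<close> there is no \<open>p\<close> with
    \<open>1 \<le> p < m - 1\<close>.\<close>
  have m: "m \<ge> 3" using assms(10,11) by linarith
  define \<delta> where "\<delta> = 1 / K1"
  have \<delta>: "\<delta> > 0" "\<And>n. n \<ge> 1 \<Longrightarrow> \<sigma> n \<ge> \<delta>"
    using K1 \<sigma>_pos by (auto simp: \<delta>_def field_simps)
  \<comment> \<open>Both constants come from \<open>|B n - \<sigma> n| \<le> b\<close>: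
    \<open>c1\<close> serves the passage from \<open>X\<close> to the variable of the theorem,
    \<open>c2\<close> the final replacement of \<open>1 / \<sigma> n\<close> by
    \<open>1 / B n\<close>.\<close>
  define c1 where "c1 = 1 + b * K2"
  define c2 where "c2 = 1 + b * K1"
  have c1: "1 / B n \<le> c1 * (1 / \<sigma> n)" if n: "n \<ge> 1" for n
  proof -
    have "\<sigma> n \<le> B n + b" using b(2)[of n] by linarith
    then have "\<sigma> n * (1 / B n) \<le> (B n + b) * (1 / B n)" using assms(6)[OF n] by (intro mult_right_mono) auto
    also have "\<dots> = 1 + b * (1 / B n)" using assms(6)[OF n] by (simp add: field_simps)
    also have "\<dots> \<le> c1" unfolding c1_def using K2(2)[OF n] b(1) by (intro add_left_mono mult_left_mono) auto
    finally show ?thesis using \<sigma>_pos[OF n] by (simp add: pos_le_divide_eq mult.commute)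
  qed
  have c2: "1 / \<sigma> n \<le> c2 * inverse (B n)" if n: "n \<ge> 1" for n
  proof -
    have "B n \<le> \<sigma> n + b" using b(2)[of n] by linarith
    then have "B n * (1 / \<sigma> n) \<le> (\<sigma> n + b) * (1 / \<sigma> n)" using \<sigma>_pos[OF n] by (intro mult_right_mono) auto
    also have "\<dots> = 1 + b * (1 / \<sigma> n)" using \<sigma>_pos[OF n] by (simp add: field_simps)
    also have "\<dots> \<le> c2" unfolding c2_def using K1(2)[OF n] b(1) by (intro add_left_mono mult_left_mono) auto
    finally show ?thesis using assms(6)[OF n] by (simp add: pos_le_divide_eq mult.commute divide_inverse[symmetric])
  qed
  obtain \<epsilon> Cb D \<zeta> where ew: "edgeworth (\<lambda>n. \<sigma> (Suc n)) \<delta> \<epsilon> Cb m D \<zeta>"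
    and char: "\<And>n t. t \<in> {-\<epsilon> * \<sigma> (Suc n)..\<epsilon> * \<sigma> (Suc n)} \<Longrightarrow>
      char (distr M borel (\<lambda>w. S (Suc n) w / \<sigma> (Suc n))) t = exp (D 0 n t - of_real (t\<^sup>2 / 2))"
  proof -
    have "\<exists>\<epsilon> Cb D \<zeta>. edgeworth (\<lambda>n. L2_norm M (S (Suc n))) \<delta> \<epsilon> Cb m D \<zeta> \<and>
      (\<forall>n. \<forall>t\<in>{-\<epsilon> * L2_norm M (S (Suc n))..\<epsilon> * L2_norm M (S (Suc n))}.
        char (distr M borel (\<lambda>w. S (Suc n) w / L2_norm M (S (Suc n)))) t = exp (D 0 n t - of_real (t\<^sup>2 / 2)))"
      using \<delta>(2) by (intro growth_condition_edgeworth assms \<delta>(1) m) (simp_all add: \<sigma>_def)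
    then show ?thesis using that unfolding \<sigma>_def by blast
  qed
  interpret ew: edgeworth "\<lambda>n. \<sigma> (Suc n)" \<delta> \<epsilon> Cb m D \<zeta> by (rule ew)
  interpret Z: real_distribution \<zeta> by (rule ew.zeta)
  obtain C0 K where C0: "C0 \<ge> 0" and expansion: "\<And>n \<eta> \<mu>. (\<forall>t\<in>{-\<epsilon> * \<sigma> (Suc n)..\<epsilon> * \<sigma> (Suc n)}. char \<eta> t = exp (D 0 n t - of_real (t\<^sup>2 / 2))) \<Longrightarrow> real_distribution \<mu> \<Longrightarrow>
    (\<forall>t. char \<mu> t = char \<eta> t * char \<zeta> (t / \<sigma> (Suc n))) \<Longrightarrow>
    (\<exists>f. f \<in> borel_measurable borel \<and> (\<forall>y. 0 \<le> f y) \<and> \<mu> = dens f \<and>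
      near_normal C0 K m (1 / \<sigma> (Suc n)) f)"
    using ew.density_expansion by blast
  obtain CM where CM: "CM \<ge> 0" and transport: "\<forall>s f. 0 < s \<longrightarrow> s \<le> K1 \<longrightarrow> f \<in> borel_measurable borel \<longrightarrow> (\<forall>y. 0 \<le> f y) \<longrightarrow>
    prob_space (dens f) \<longrightarrow>
    near_normal C0 K m s f \<longrightarrow>
    (\<integral>\<^sup>+y. ennreal (\<bar>y\<bar> powr p) \<partial>dens f) \<le> ennreal CM \<and>
    (\<exists>T\<in>borel_measurable borel. distr (dens f) borel T = \<N> \<and>
      (\<integral>\<^sup>+y. ennreal (\<bar>T y - y\<bar> powr p) \<partial>dens f) \<le> ennreal (CM * s powr p))"
    using transport_to_std_normal[OF assms(10,11) C0 K1(1), of K] by blast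
  obtain CZ where CZ: "CZ \<ge> 0" "(\<integral>\<^sup>+z. ennreal (\<bar>z\<bar> powr p) \<partial>\<zeta>) \<le> ennreal CZ"
  proof -
    have int: "integrable \<zeta> (\<lambda>x. 1 + \<bar>x\<bar> ^ m)" using ew.zeta(2)[of m] by simp
    have "(\<integral>\<^sup>+z. ennreal (\<bar>z\<bar> powr p) \<partial>\<zeta>) \<le> (\<integral>\<^sup>+z. ennreal (1 + \<bar>z\<bar> ^ m) \<partial>\<zeta>)"
    proof (intro nn_integral_mono ennreal_leI)
      fix z :: real
      show "\<bar>z\<bar> powr p \<le> 1 + \<bar>z\<bar> ^ m"
      proof (cases "\<bar>z\<bar> \<le> 1")
        case True
        then have "\<bar>z\<bar> powr p \<le> 1" using assms(10) by (intro powr_le1) auto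
        then show ?thesis by (simp add: add_increasing2)
      next
        case False
        then have "\<bar>z\<bar> powr p \<le> \<bar>z\<bar> powr real m" using assms(11) by (intro powr_mono) auto
        also have "\<dots> = \<bar>z\<bar> ^ m" using False by (intro powr_realpow) auto
        finally show ?thesis by simp
      qed
    qed
    also have "\<dots> = ennreal (LINT z|\<zeta>. 1 + \<bar>z\<bar> ^ m)"
      using int by (intro nn_integral_eq_integral) auto
    finally show ?thesis using that[of "LINT z|\<zeta>. 1 + \<bar>z\<bar> ^ m"] by simp
  qed
  define c where "c = c1 * (a + b)"
  have c1_pos: "c1 > 0" "c2 > 0" using b(1) K1(1) K2(1) by (auto simp: c1_def c2_def intro: add_pos_nonneg)
  have c: "c \<ge> 0" using c1_pos b(1) \<open>a \<ge> 0\<close> by (simp add: c_def)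
  define Q where "Q = (4 powr p * (c powr p + c powr p * CM + (c * K1 + 1) powr p * CZ + CM)) powr (1 / p)"
  have main: "wasserstein p (distr M borel (\<lambda>w. (S n w - A n) / B n)) \<N> \<le> ennreal (Q * (1 / \<sigma> n))" if n: "n \<ge> 1" for n
  proof -
    obtain k where k: "n = Suc k" using n by (cases n) auto
    have [measurable]: "S n \<in> borel_measurable M" using assms(2)[OF n] by (simp add: centered_L2_def)
    let ?X = "\<lambda>w. S n w / \<sigma> n" and ?s = "1 / \<sigma> n"
    have s: "0 < ?s" "?s \<le> K1" using \<sigma>_pos[OF n] K1(2)[OF n] by auto
    define \<mu> where "\<mu> = distr (M \<Otimes>\<^sub>M \<zeta>) borel (\<lambda>z. ?X (fst z) + ?s * snd z)"
    interpret pair_prob_space M \<zeta> ..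
    have mz[measurable]: "(\<lambda>z. ?s * z) \<in> borel_measurable \<zeta>" by measurable
    have mY: "(\<lambda>z. ?X (fst z) + ?s * snd z) \<in> borel_measurable (M \<Otimes>\<^sub>M \<zeta>)" by measurable
    have mu: "real_distribution \<mu>"
      unfolding \<mu>_def real_distribution_def real_distribution_axioms_def using prob_space_distr[OF mY] by simp
    have ch: "\<forall>t. char \<mu> t = char (distr M borel ?X) t * char \<zeta> (t / \<sigma> (Suc k))"
    proof
      fix t
      have "char \<mu> t = char (distr M borel ?X) t * char (distr \<zeta> borel (\<lambda>z. ?s * z)) t"
        unfolding \<mu>_def by (intro char_pair_add assms(1) Z.prob_space_axioms mz) measurable
      also have "char (distr \<zeta> borel (\<lambda>z. ?s * z)) t = char \<zeta> (t / \<sigma> n)"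
        unfolding char_def by (subst integral_distr[OF mz]) (auto simp: mult_ac)
      finally show "char \<mu> t = char (distr M borel ?X) t * char \<zeta> (t / \<sigma> (Suc k))" unfolding k .
    qed
    have cX: "\<forall>t\<in>{-\<epsilon> * \<sigma> (Suc k)..\<epsilon> * \<sigma> (Suc k)}. char (distr M borel ?X) t = exp (D 0 k t - of_real (t\<^sup>2 / 2))"
      unfolding k using char by blast
    obtain f where f: "f \<in> borel_measurable borel" "\<forall>y. 0 \<le> f y" "\<mu> = dens f"
      "near_normal C0 K m ?s f"
      using expansion[OF cX mu ch] unfolding k by blast
    have "prob_space (dens f)"
      using mu unfolding f(3) real_distribution_def by blast
    from transport[rule_format, OF s f(1) f(2)[rule_format] this f(4)[rule_format]] obtain T where T: "(\<integral>\<^sup>+y. ennreal (\<bar>y\<bar> powr p) \<partial>\<mu>) \<le> ennreal CM"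
      "T \<in> borel_measurable borel" "distr \<mu> borel T = \<N>"
      "(\<integral>\<^sup>+y. ennreal (\<bar>T y - y\<bar> powr p) \<partial>\<mu>) \<le> ennreal (CM * ?s powr p)"
      unfolding f(3) by blast
    show ?thesis unfolding Q_def
    proof (rule wasserstein_coupling_bound[OF assms(1) ew.zeta(1) _ _ T(2) assms(10) s c CM CZ(1) \<mu>_def T(3) _ T(1,4) CZ(2)])
      fix w
      have Bn: "B n > 0" by (rule assms(6)[OF n])
      \<comment> \<open>As \<open>\<sigma> n - B n\<close> and \<open>A n\<close> are bounded, the
        affine change moves \<open>X\<close> by at most a multiple of
        \<open>(1 + |X|) / B n\<close>.\<close>
      have "(S n w - A n) / B n - ?X w = (?X w * (\<sigma> n - B n) - A n) * (1 / B n)"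
        using Bn \<sigma>_pos[OF n] by (simp add: field_simps)
      then have "\<bar>(S n w - A n) / B n - ?X w\<bar> = \<bar>?X w * (\<sigma> n - B n) - A n\<bar> * (1 / B n)"
        using Bn by (simp only: abs_mult abs_of_pos zero_less_divide_1_iff)
      also have "\<dots> \<le> ((a + b) * (1 + \<bar>?X w\<bar>)) * (c1 * ?s)"
      proof (rule mult_mono)
        have "\<bar>?X w * (\<sigma> n - B n) - A n\<bar> \<le> \<bar>?X w\<bar> * \<bar>\<sigma> n - B n\<bar> + \<bar>A n\<bar>"
          by (rule order_trans[OF abs_triangle_ineq4]) (simp add: abs_mult)
        also have "\<dots> \<le> \<bar>?X w\<bar> * b + a"
          using b(2)[of n] a[OF n] by (intro add_mono mult_left_mono) (auto simp: abs_minus_commute)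
        also have "\<dots> \<le> (a + b) * (1 + \<bar>?X w\<bar>)"
        proof -
          have "0 \<le> a * \<bar>?X w\<bar> + b" using b(1) \<open>a \<ge> 0\<close> by (intro add_nonneg_nonneg mult_nonneg_nonneg abs_ge_zero)
          then show ?thesis unfolding distrib_left distrib_right mult_1_right mult.commute[of "\<bar>?X w\<bar>" b] by linarith
        qed
        finally show "\<bar>?X w * (\<sigma> n - B n) - A n\<bar> \<le> (a + b) * (1 + \<bar>?X w\<bar>)" .
        show "1 / B n \<le> c1 * ?s" by (rule c1[OF n])
      qed (use b(1) \<open>a \<ge> 0\<close> Bn in auto)
      also have "\<dots> = c * ?s * (1 + \<bar>?X w\<bar>)" unfolding c_def by (simp only: mult_ac)
      finally show "\<bar>(S n w - A n) / B n - ?X w\<bar> \<le> c * ?s * (1 + \<bar>?X w\<bar>)" .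
    qed measurable
  qed
  show ?thesis
  \<comment> \<open>Adding 1 keeps the constant positive when \<open>Q = 0\<close>.\<close>
  proof (intro exI[of _ "(Q + 1) * c2"] conjI allI impI)
    have Q: "Q \<ge> 0" by (simp add: Q_def)
    show "0 < (Q + 1) * c2" using Q c1_pos(2) by simp
    fix n :: nat assume n: "n \<ge> 1"
    have "Q * (1 / \<sigma> n) \<le> (Q + 1) * (c2 * inverse (B n))"
      using Q c2[OF n] \<sigma>_pos[OF n] by (intro mult_mono) auto
    then have "ennreal (Q * (1 / \<sigma> n)) \<le> ennreal ((Q + 1) * c2 * inverse (B n))"
      by (intro ennreal_leI) (simp only: mult.assoc)
    then show "wasserstein p (distr M borel (\<lambda>w. (S n w - A n) / B n)) \<N>
      \<le> ennreal ((Q + 1) * c2 * inverse (B n))"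
      using main[OF n] by (rule order_trans[rotated])
  qed
qed

end
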